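(* Let $X$ be an integer-valued random variable with $\mathbb{E}[X]=0$, $\mathbb{P}(X<-1)=0$ and $\mathbb{P}(X\ge x)\sim L(x)/x$ as $x\to\infty$, where $L$ is slowly varying at $\infty$. Let $W_0=0$, $W_n=X_1+\cdots+X_n$ with $(X_i)_{i\ge1}$ i.i.d. copies of $X$, and $\zeta=\inf\{i\ge1:W_i<0\}$. Let $(\vec W^{(n)}_i:i\ge0)$ have the law of $(W_i:i\ge0)$ under $\mathbb{P}(\,\cdot\mid\zeta\ge n)$, and let $(\vec Z^{(n)}_i:i\ge0)$ be the process defined in the context. Then $$d_{\mathrm{TV}}\left((\vec W^{(n)}_i:i\ge0),(\vec Z^{(n)}_i:i\ge0)\right)\longrightarrow0\quad\text{as } n\to\infty,$$ where $d_{\mathrm{TV}}$ denotes the total variation distance on $\mathbb{R}^{\mathbb{Z}_+}$ equipped with the product topology.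
   Context: $(a_n)_{n\ge1}$ and $(b_n)_{n\ge1}$ are sequences such that $n\,\mathbb{P}(X\ge a_n)\to 1$ and $b_n=n\,\mathbb{E}[X\mathbf{1}_{|X|\le a_n}]$ (one has $b_n\to-\infty$). Weak ladder times: $T_0=0$ and $T_{i+1}=\inf\{j>T_i: W_j\ge W_{T_i}\}$ for $i\ge0$. $I_n=\max\{0\le j\le n:\exists\, i\ge0,\ T_i=j\}$ is the last weak ladder time of $(W_i:0\le i\le n)$. The process $(\vec Z^{(n)}_i:i\ge0)$ is defined by the following law, built jointly with a random variable having the law of $I_n$ (still denoted $I_n$). For every $j\ge1$, conditionally given $\{I_n=j-1\}$, the three random variables $(\vec Z^{(n)}_i:0\le i<j)$, $Y^{(n)}_j:=\vec Z^{(n)}_j-\vec Z^{(n)}_{j-1}$ and $(\vec Z^{(n)}_{i+j}-\vec Z^{(n)}_j:i\ge0)$ are independent, with - $(\vec Z^{(n)}_i:0\le i<j)$ distributed as $(W_i:0\le i<j)$ under $\mathbb{P}(\,\cdot\mid\zeta\ge j)$; - $Y^{(n)}_j$ distributed as $X$ under $\mathbb{P}(\,\cdot\mid X\ge|b_n|)$; - $(\vec Z^{(n)}_{i+j}-\vec Z^{(n)}_j:i\ge0)$ distributed as $(W_i:i\ge0)$. The total variation distance between random variables means the total variation distance between their laws. *)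

theory Defs
  imports "HOL-Probability.Probability" "HOL-Library.Landau_Symbols"
begin

definition slowly_varying :: "(real \<Rightarrow> real) \<Rightarrow> bool" where
  "slowly_varying L \<longleftrightarrow>
     (\<exists>x0. (\<forall>x\<ge>x0. L x > 0) \<and> L \<in> borel_measurable (restrict_space borel {x0..})) \<and>
     (\<forall>c>0. ((\<lambda>x. L (c * x) / L x) \<longlongrightarrow> 1) at_top)"

text \<open>Meant for probability measures on the same measurable space. The convention is without the
  factor 2 of the \<open>\<ell>\<^sup>1\<close> normalisation.\<close>
definition tv_dist :: "'a measure \<Rightarrow> 'a measure \<Rightarrow> real" where
  "tv_dist \<mu> \<nu> = (SUP A\<in>sets \<mu>. \<bar>measure \<mu> A - measure \<nu> A\<bar>)"

text \<open>The probability measure \<open>\<P>(\<cdot> | P)\<close>, for an event \<open>P\<close> of positive probability.\<close>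
definition given :: "'a measure \<Rightarrow> ('a \<Rightarrow> bool) \<Rightarrow> 'a measure" where
  "given M P = uniform_measure M {\<omega> \<in> space M. P \<omega>}"

definition walk :: "(nat \<Rightarrow> 'a \<Rightarrow> int) \<Rightarrow> 'a \<Rightarrow> nat \<Rightarrow> real" where
  "walk \<xi> \<omega> n = (\<Sum>i=1..n. real_of_int (\<xi> i \<omega>))"

text \<open>The following functionals of a path take values in \<^typ>\<open>enat\<close>, where \<open>Inf {} = \<infinity>\<close>.\<close>

definition first_negative :: "(nat \<Rightarrow> real) \<Rightarrow> enat" where
  "first_negative w = Inf (enat ` {i. i \<ge> 1 \<and> w i < 0})"

primrec weak_ladder_time :: "(nat \<Rightarrow> real) \<Rightarrow> nat \<Rightarrow> enat" where
  "weak_ladder_time w 0 = 0"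
| "weak_ladder_time w (Suc i) =
     (case weak_ladder_time w i of
        enat t \<Rightarrow> Inf (enat ` {j. j > t \<and> w j \<ge> w t})
      | \<infinity> \<Rightarrow> \<infinity>)"

definition last_weak_ladder_time :: "nat \<Rightarrow> (nat \<Rightarrow> real) \<Rightarrow> nat" where
  "last_weak_ladder_time n w = Max {j. j \<le> n \<and> (\<exists>i. weak_ladder_time w i = enat j)}"

text \<open>Mutual independence of three random variables with values in different types: this is
  \<open>prob_space.indep_vars\<close> unfolded, as the latter needs a single type of values.\<close>
definition indep_vars3 ::
  "'a measure \<Rightarrow> 'b measure \<Rightarrow> ('a \<Rightarrow> 'b) \<Rightarrow> 'c measure \<Rightarrow> ('a \<Rightarrow> 'c) \<Rightarrow>
   'd measure \<Rightarrow> ('a \<Rightarrow> 'd) \<Rightarrow> bool" where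
  "indep_vars3 Q A f B g C h \<longleftrightarrow>
     f \<in> measurable Q A \<and> g \<in> measurable Q B \<and> h \<in> measurable Q C \<and>
     prob_space.indep_sets Q
       (\<lambda>k::nat. if k = 0 then {f -` S \<inter> space Q | S. S \<in> sets A}
                 else if k = 1 then {g -` S \<inter> space Q | S. S \<in> sets B}
                 else {h -` S \<inter> space Q | S. S \<in> sets C})
       {0, 1, 2}"

text \<open>On the probability space \<open>N\<close>, the pair \<open>(I, Z)\<close> has the law of the last weak ladder time
  \<open>I\<^sub>n\<close> together with the path having a big jump at time \<open>I\<^sub>n + 1\<close>. The space \<open>M\<close> carries the walk \<open>W\<close>
  and the generic step \<open>X\<close>; the threshold for the big jump is \<open>\<bar>\<beta>\<bar>\<close>. The path space
  \<^typ>\<open>nat \<Rightarrow> real\<close> has the Borel sets of the product topology.\<close>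
definition big_jump_process ::
  "'a measure \<Rightarrow> ('a \<Rightarrow> int) \<Rightarrow> ('a \<Rightarrow> nat \<Rightarrow> real) \<Rightarrow> real \<Rightarrow> nat \<Rightarrow>
   'b measure \<Rightarrow> ('b \<Rightarrow> nat) \<Rightarrow> ('b \<Rightarrow> nat \<Rightarrow> real) \<Rightarrow> bool" where
  "big_jump_process M X W \<beta> n N I Z \<longleftrightarrow>
     prob_space N \<and>
     I \<in> measurable N (count_space UNIV) \<and>
     Z \<in> measurable N borel \<and>
     distr N (count_space UNIV) I
       = distr M (count_space UNIV) (\<lambda>\<omega>. last_weak_ladder_time n (W \<omega>)) \<and>
     (\<forall>j\<ge>1. \<P>(\<omega> in N. I \<omega> = j - 1) > 0 \<longrightarrow>
       (let Q = given N (\<lambda>\<omega>. I \<omega> = j - 1);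
            paths_j = (\<Pi>\<^sub>M i\<in>{..<j}. (borel :: real measure));
            before = (\<lambda>\<omega>. restrict (Z \<omega>) {..<j});
            Y = (\<lambda>\<omega>. Z \<omega> j - Z \<omega> (j - 1));
            after = (\<lambda>\<omega> i. Z \<omega> (i + j) - Z \<omega> j)
        in indep_vars3 Q paths_j before borel Y borel after \<and>
           distr Q paths_j before
             = distr (given M (\<lambda>\<omega>. first_negative (W \<omega>) \<ge> enat j)) paths_j
                 (\<lambda>\<omega>. restrict (W \<omega>) {..<j}) \<and>
           distr Q borel Y
             = distr (given M (\<lambda>\<omega>. real_of_int (X \<omega>) \<ge> \<bar>\<beta>\<bar>)) borel
                 (\<lambda>\<omega>. real_of_int (X \<omega>)) \<and>
           distr Q borel after = distr M borel W))"

end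

theory Submission
  imports Defs
begin

text \<open>
  Write \<open>p\<^sub>j = P(\<zeta> \<ge> j)\<close>, \<open>q\<^sub>k = P(W\<^sub>1 < 0, \<dots>, W\<^sub>k < 0)\<close>, \<open>U\<^sub>n = p\<^sub>1 + \<dots> + p\<^sub>n\<close> and
  \<open>t\<^sub>n = P(X \<ge> \<bar>b\<^sub>n\<bar>)\<close>. Time reversal gives \<open>P(I\<^sub>n = j - 1) = p\<^sub>j q\<^bsub>n+1-j\<^esub>\<close>, so the factor \<open>p\<^sub>j\<close> cancels
  and the law of \<open>Z\<close> has, with respect to that of the walk, the density
  \<open>\<Sum>\<^sub>j q\<^bsub>n+1-j\<^esub> 1{\<zeta> \<ge> j, X\<^sub>j \<ge> \<bar>b\<^sub>n\<bar>} / t\<^sub>n\<close>. As \<open>q\<close> decreases, it is at least \<open>q\<^sub>n / t\<^sub>n\<close> when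
  \<open>\<zeta> \<ge> n\<close> and some \<open>X\<^sub>j \<ge> \<bar>b\<^sub>n\<bar>\<close> with \<open>j \<le> n\<close>. Comparing with the density \<open>1{\<zeta> \<ge> n} / p\<^sub>n\<close>,
  it suffices that \<open>liminf q\<^sub>n p\<^sub>n / t\<^sub>n \<ge> 1\<close> and that, given \<open>\<zeta> \<ge> n\<close>, a step of size at least
  \<open>\<bar>b\<^sub>n\<bar>\<close> before time \<open>n\<close> has probability tending to 1.

  Both follow from \<open>p\<^sub>n \<sim> U\<^sub>n t\<^sub>n\<close>. The lower bound uses the weak law \<open>W\<^sub>n / b\<^sub>n \<rightarrow> 1\<close> after the
  first big jump. For the upper bound, surviving until \<open>n\<close> without a step of size
  \<open>(1 - \<epsilon>)\<bar>b\<^sub>n\<bar>\<close> forces, after survival up to a small fraction \<open>\<delta>n\<close>, another event whose probability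
  tends to 0; iterating \<open>p\<^sub>n \<le> o(1) p\<^bsub>\<delta>n\<^esub> + C U\<^sub>n t\<^sub>n\<close> gives \<open>p\<^sub>n = O(U\<^sub>n t\<^sub>n)\<close>, which makes the first
  term negligible. Finally \<open>n t\<^sub>n \<rightarrow> 0\<close> makes \<open>U\<close> slowly varying, and the identity
  \<open>\<Sum>\<^sub>j p\<^sub>j q\<^bsub>n+1-j\<^esub> = 1\<close> then yields \<open>q\<^sub>n U\<^sub>n \<rightarrow> 1\<close>.
\<close>

section \<open>Integer walks on the sequence space\<close>

text \<open>The \<open>j\<close>-th step \<open>X\<^sub>j\<close> of the walk is \<open>x (j - 1)\<close>.\<close>
definition partial_sum :: "(nat \<Rightarrow> int) \<Rightarrow> nat \<Rightarrow> int" where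
  "partial_sum x n = (\<Sum>i<n. x i)"

definition shift_seq :: "nat \<Rightarrow> (nat \<Rightarrow> 'a) \<Rightarrow> nat \<Rightarrow> 'a" where
  "shift_seq j x = (\<lambda>i. x (i + j))"

text \<open>Entries from \<open>k\<close> on stay in place, so the map comes from an injection of
  the indices and preserves a product of identical laws.\<close>

definition reverse_prefix :: "nat \<Rightarrow> (nat \<Rightarrow> 'a) \<Rightarrow> nat \<Rightarrow> 'a" where
  "reverse_prefix k x = (\<lambda>i. x (if i < k then k - 1 - i else i))"

text \<open>Encodes membership in the sigma-algebra of the first \<open>k\<close> steps without
  mentioning measurability, which \<open>sets_determined\<close> derives from the countability of
  the integers.\<close>

definition determined_by_prefix :: "nat \<Rightarrow> (nat \<Rightarrow> 'a) set \<Rightarrow> bool" where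
  "determined_by_prefix k A \<longleftrightarrow> (\<forall>x\<in>A. \<forall>y. (\<forall>i<k. x i = y i) \<longrightarrow> y \<in> A)"

lemma determined_by_prefixI:
  assumes "\<And>x y. (\<And>i. i < k \<Longrightarrow> x i = y i) \<Longrightarrow> x \<in> A \<Longrightarrow> y \<in> A"
  shows "determined_by_prefix k A"
  using assms unfolding determined_by_prefix_def by blast

lemma determined_by_prefix_iff:
  assumes "determined_by_prefix k A" "\<And>i. i < k \<Longrightarrow> x i = y i"
  shows "x \<in> A \<longleftrightarrow> y \<in> A"
  using assms unfolding determined_by_prefix_def by metis

lemma partial_sum_0 [simp]: "partial_sum x 0 = 0"
  by (simp add: partial_sum_def)

lemma partial_sum_Suc [simp]: "partial_sum x (Suc n) = partial_sum x n + x n"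
  by (simp add: partial_sum_def)

lemma partial_sum_cong:
  "(\<And>i. i < n \<Longrightarrow> x i = y i) \<Longrightarrow> partial_sum x n = partial_sum y n"
  by (simp add: partial_sum_def)

lemma partial_sum_shift_seq:
  "partial_sum (shift_seq j x) i = partial_sum x (i + j) - partial_sum x j"
  by (induction i) (simp_all add: shift_seq_def)

lemma partial_sum_reverse_prefix:
  assumes "i \<le> k"
  shows "partial_sum (reverse_prefix k x) i = partial_sum x k - partial_sum x (k - i)"
  using assms
proof (induction i)
  case (Suc i)
  then have "partial_sum x (k - i) = partial_sum x (k - Suc i) + x (k - Suc i)"
    by (metis Suc_diff_Suc Suc_le_lessD partial_sum_Suc)
  with Suc show ?case by (simp add: reverse_prefix_def)
qed simp

section \<open>The canonical space of i.i.d. integer steps: Markov property and time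
  reversal\<close>

locale iid_steps =
  fixes p :: "int pmf"

sublocale iid_steps \<subseteq> sequence_space "measure_pmf p"
  unfolding sequence_space_def
  by (intro product_prob_spaceI) (rule measure_pmf.prob_space_axioms)

context iid_steps
begin

lemma space_S [simp]: "space S = UNIV"
  by (simp add: space_PiM)

text \<open>Finitely many integer coordinates range over a countable set, on which the product
  sigma-algebra contains every subset; \<open>A\<close> is the preimage of its own image under
  restriction to these coordinates.\<close>

lemma sets_determined:
  assumes "determined_by_prefix k A"
  shows "A \<in> sets S"
proof -
  define R where "R = (\<lambda>x::nat \<Rightarrow> int. restrict x {..<k})"
  have "sets (PiM {..<k} (\<lambda>_. measure_pmf p)) = sets (PiM {..<k} (\<lambda>_. count_space (UNIV :: int set)))"
    by (intro sets_PiM_cong) simp_all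
  also have "\<dots> = sets (count_space (PiE {..<k} (\<lambda>_. (UNIV :: int set))))"
    by (subst count_space_PiM_finite) simp_all
  finally have sets_R: "sets (PiM {..<k} (\<lambda>_. measure_pmf p)) = Pow (PiE {..<k} (\<lambda>_. (UNIV :: int set)))"
    by simp
  have "R \<in> measurable S (PiM {..<k} (\<lambda>_. measure_pmf p))"
    unfolding R_def by (rule measurable_restrict_subset) simp
  moreover have "R ` A \<in> sets (PiM {..<k} (\<lambda>_. measure_pmf p))"
    unfolding sets_R by (auto simp: R_def PiE_def)
  ultimately have "R -` (R ` A) \<inter> space S \<in> sets S"
    by (rule measurable_sets)
  also have "R -` (R ` A) \<inter> space S = A"
  proof -
    have "y \<in> A" if "R y = R x" "x \<in> A" for x y
    proof -
      have "x i = y i" if "i < k" for i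
        using fun_cong[OF \<open>R y = R x\<close>, of i] that by (simp add: R_def)
      with assms \<open>x \<in> A\<close> show ?thesis unfolding determined_by_prefix_def by blast
    qed
    thus ?thesis by auto
  qed
  finally show ?thesis .
qed

lemma measurable_shift_seq [measurable]: "shift_seq j \<in> measurable S S"
  unfolding shift_seq_def by (rule measurable_PiM_single') (auto intro: measurable_component_singleton)

lemma sets_shift:
  assumes "B \<in> sets S"
  shows "{x. shift_seq j x \<in> B} \<in> sets S"
  using measurable_sets[OF measurable_shift_seq assms] by (simp add: vimage_def)

text \<open>Markov property at a fixed time: gluing the first \<open>j\<close> entries of one
  sequence to an independent second one reproduces the product measure, and the event becomes the
  rectangle \<open>A \<times> B\<close>.\<close>

lemma prob_prefix_shift:
  assumes A: "determined_by_prefix j A" and B: "B \<in> sets S"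
  shows "P.prob (A \<inter> {x. shift_seq j x \<in> B}) = P.prob A * P.prob B"
proof -
  let ?f = "\<lambda>(\<omega>, \<omega>'). comb_seq j \<omega> \<omega>' :: nat \<Rightarrow> int"
  let ?E = "A \<inter> {x. shift_seq j x \<in> B}"
  note SA = sets_determined[OF A]
  have SE: "?E \<in> sets S" using SA sets_shift[OF B] by auto
  have "comb_seq j \<omega> \<omega>' \<in> A \<longleftrightarrow> \<omega> \<in> A" for \<omega> \<omega>'
    by (rule determined_by_prefix_iff[OF A]) (simp add: comb_seq_less)
  moreover have "shift_seq j (comb_seq j \<omega> \<omega>') = \<omega>'" for \<omega> \<omega>' :: "nat \<Rightarrow> int"
    by (simp add: shift_seq_def comb_seq_add)
  ultimately have pre: "?f -` ?E \<inter> space (S \<Otimes>\<^sub>M S) = A \<times> B"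
    by (auto simp: space_pair_measure)
  have "emeasure S ?E = emeasure (distr (S \<Otimes>\<^sub>M S) S ?f) ?E"
    by (simp only: PiM_comb_seq)
  also have "\<dots> = emeasure (S \<Otimes>\<^sub>M S) (A \<times> B)"
    by (subst emeasure_distr[OF measurable_comb_seq SE]) (simp only: pre)
  also have "\<dots> = emeasure S A * emeasure S B"
    using SA B by (intro P.emeasure_pair_measure_Times)
  finally show ?thesis
    by (simp add: measure_def enn2real_mult)
qed

lemma sets_prefix_shift_UN:
  assumes "countable J" "\<And>j. j \<in> J \<Longrightarrow> determined_by_prefix j (A j)" "\<And>j. j \<in> J \<Longrightarrow> B j \<in> sets S"
  shows "(\<Union>j\<in>J. A j \<inter> {x. shift_seq j x \<in> B j}) \<in> sets S"
  using assms sets_determined sets_shift by (intro sets.countable_UN' sets.Int) auto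

text \<open>Strong Markov property for a time with finitely many values: \<open>A j\<close> says
  that the time equals \<open>j\<close>, and \<open>B j\<close> constrains the walk restarted there.
  The versions \<open>_le\<close> and \<open>_ge\<close> below serve when the \<open>B j\<close> are
  bounded uniformly.\<close>

lemma prob_prefix_shift_UN:
  assumes "finite J" "disjoint_family_on A J"
    and A: "\<And>j. j \<in> J \<Longrightarrow> determined_by_prefix j (A j)" and B: "\<And>j. j \<in> J \<Longrightarrow> B j \<in> sets S"
  shows "P.prob (\<Union>j\<in>J. A j \<inter> {x. shift_seq j x \<in> B j}) = (\<Sum>j\<in>J. P.prob (A j) * P.prob (B j))"
proof -
  have "P.prob (\<Union>j\<in>J. A j \<inter> {x. shift_seq j x \<in> B j})
      = (\<Sum>j\<in>J. P.prob (A j \<inter> {x. shift_seq j x \<in> B j}))"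
    using assms sets_determined sets_shift
    by (intro P.finite_measure_finite_Union) (auto simp: disjoint_family_on_def)
  thus ?thesis using A B by (simp add: prob_prefix_shift)
qed

lemma prob_UN_prefix:
  assumes "finite J" "disjoint_family_on A J" "\<And>j. j \<in> J \<Longrightarrow> determined_by_prefix j (A j)"
  shows "P.prob (\<Union>j\<in>J. A j) = (\<Sum>j\<in>J. P.prob (A j))"
  using assms sets_determined by (intro P.finite_measure_finite_Union) auto

lemma prob_prefix_shift_UN_le:
  assumes J: "finite J" "disjoint_family_on A J"
    and A: "\<And>j. j \<in> J \<Longrightarrow> determined_by_prefix j (A j)" and B: "\<And>j. j \<in> J \<Longrightarrow> B j \<in> sets S"
    and c: "\<And>j. j \<in> J \<Longrightarrow> P.prob (B j) \<le> c"
  shows "P.prob (\<Union>j\<in>J. A j \<inter> {x. shift_seq j x \<in> B j}) \<le> P.prob (\<Union>j\<in>J. A j) * c"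
proof -
  have "P.prob (\<Union>j\<in>J. A j) = (\<Sum>j\<in>J. P.prob (A j))"
    using J A by (rule prob_UN_prefix)
  moreover have "P.prob (\<Union>j\<in>J. A j \<inter> {x. shift_seq j x \<in> B j}) = (\<Sum>j\<in>J. P.prob (A j) * P.prob (B j))"
    using J A B by (rule prob_prefix_shift_UN)
  ultimately show ?thesis
    using c by (auto simp: sum_distrib_right intro!: sum_mono mult_left_mono)
qed

lemma prob_prefix_shift_UN_ge:
  assumes J: "finite J" "disjoint_family_on A J"
    and A: "\<And>j. j \<in> J \<Longrightarrow> determined_by_prefix j (A j)" and B: "\<And>j. j \<in> J \<Longrightarrow> B j \<in> sets S"
    and c: "\<And>j. j \<in> J \<Longrightarrow> c \<le> P.prob (B j)"
  shows "P.prob (\<Union>j\<in>J. A j) * c \<le> P.prob (\<Union>j\<in>J. A j \<inter> {x. shift_seq j x \<in> B j})"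
proof -
  have "P.prob (\<Union>j\<in>J. A j) = (\<Sum>j\<in>J. P.prob (A j))"
    using J A by (rule prob_UN_prefix)
  moreover have "P.prob (\<Union>j\<in>J. A j \<inter> {x. shift_seq j x \<in> B j}) = (\<Sum>j\<in>J. P.prob (A j) * P.prob (B j))"
    using J A B by (rule prob_prefix_shift_UN)
  ultimately show ?thesis
    using c by (auto simp: sum_distrib_right intro!: sum_mono mult_left_mono)
qed

lemma measurable_reverse_prefix [measurable]: "reverse_prefix k \<in> measurable S S"
  unfolding reverse_prefix_def
  by (rule measurable_PiM_single') (auto intro: measurable_component_singleton)

lemma prob_reverse_prefix:
  assumes "A \<in> sets S"
  shows "P.prob {x. reverse_prefix k x \<in> A} = P.prob A"
proof -
  have "inj (\<lambda>i::nat. if i < k then k - 1 - i else i)"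
    by (rule injI) (auto split: if_splits)
  from distr_PiM_reindex[OF _ this, of UNIV "\<lambda>_. measure_pmf p"]
  have "distr S S (reverse_prefix k) = S"
    by (simp add: reverse_prefix_def[abs_def] measure_pmf.prob_space_axioms restrict_UNIV)
  hence "P.prob A = measure (distr S S (reverse_prefix k)) A" by simp
  also have "\<dots> = P.prob (reverse_prefix k -` A \<inter> space S)"
    by (rule measure_distr) (use assms in auto)
  finally show ?thesis by (simp add: vimage_def)
qed

lemma distr_coordinate: "distr S (measure_pmf p) (\<lambda>x. x i) = measure_pmf p"
  using PiM_component[of i] by simp

lemma prob_coordinate: "P.prob {x. x i \<in> B} = measure_pmf.prob p B"
proof -
  have "measure (distr S (measure_pmf p) (\<lambda>x. x i)) B = P.prob ((\<lambda>x. x i) -` B \<inter> space S)"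
    by (rule measure_distr) auto
  thus ?thesis by (simp add: distr_coordinate vimage_def)
qed

end

section \<open>Weak ladder times\<close>

text \<open>Strictly between consecutive ladder times \<open>t < j\<close> the path is below
  \<open>w t\<close> by minimality of \<open>j\<close>, and up to \<open>t\<close> it is at most
  \<open>w t\<close> by induction.\<close>

lemma weak_ladder_time_imp_record:
  assumes "weak_ladder_time w i = enat j"
  shows "\<forall>s\<le>j. w s \<le> w j"
  using assms
proof (induction i arbitrary: j)
  case 0
  then show ?case by (simp add: zero_enat_def)
next
  case (Suc i)
  from Suc.prems obtain t where t: "weak_ladder_time w i = enat t"
    by (cases "weak_ladder_time w i") simp_all
  let ?A = "{j. j > t \<and> w j \<ge> w t}"
  have inf: "Inf (enat ` ?A) = enat j" using Suc.prems t by simp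
  \<comment> \<open>A finite infimum is not the default \<open>\<infinity>\<close> of the empty set,
    so it is attained.\<close>
  have "enat j \<in> enat ` ?A"
  proof -
    have "enat ` ?A \<noteq> {}"
    proof
      assume "enat ` ?A = {}"
      hence "Inf (enat ` ?A) = \<infinity>" by (simp only: Inf_empty top_enat_def)
      with inf show False by simp
    qed
    then obtain y where "y \<in> enat ` ?A" by blast
    from wellorder_InfI[OF this] inf show ?thesis by simp
  qed
  hence j: "j > t" "w j \<ge> w t" by auto
  have min: "j \<le> s" if "s > t" "w s \<ge> w t" for s
  proof -
    have "Inf (enat ` ?A) \<le> enat s" using that by (intro Inf_lower) auto
    thus ?thesis using inf by simp
  qed
  have "w s \<le> w j" if "s \<le> j" for s
  proof (cases "s \<le> t")
    case True
    with Suc.IH[OF t] j show ?thesis by (meson order_trans)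
  next
    case False
    with min[of s] that j show ?thesis by (cases "s = j") force+
  qed
  thus ?case by blast
qed

text \<open>Let \<open>r\<close> be the last record before \<open>j\<close>. The first later time at
  which the path is at least \<open>w r\<close> is itself a record, so it cannot precede
  \<open>j\<close>; hence \<open>j\<close> is the ladder time that follows \<open>r\<close>.\<close>

lemma record_imp_weak_ladder_time:
  assumes "\<forall>s\<le>j. w s \<le> w j"
  shows "\<exists>i. weak_ladder_time w i = enat j"
  using assms
proof (induction j rule: less_induct)
  case (less j)
  show ?case
  proof (cases "j = 0")
    case True
    then show ?thesis by (intro exI[of _ 0]) (simp add: zero_enat_def)
  next
    case False
    let ?R = "{r. r < j \<and> (\<forall>s\<le>r. w s \<le> w r)}"
    have R: "finite ?R" "?R \<noteq> {}" using False by auto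
    define r where "r = Max ?R"
    have r: "r < j" "\<forall>s\<le>r. w s \<le> w r" using Max_in[OF R] by (auto simp: r_def)
    have r_max: "s \<le> r" if "s \<in> ?R" for s using Max_ge[OF R(1) that] by (simp add: r_def)
    from less.IH[OF r] obtain i where i: "weak_ladder_time w i = enat r" by auto
    let ?A = "{k. k > r \<and> w k \<ge> w r}"
    have jA: "j \<in> ?A" using r less.prems by auto
    have "j \<le> k" if "k \<in> ?A" for k
    proof (rule ccontr)
      assume "\<not> j \<le> k"
      define l where "l = (LEAST k. k \<in> ?A)"
      have l: "l \<in> ?A" "l \<le> k" unfolding l_def using LeastI[of "\<lambda>k. k \<in> ?A", OF that] Least_le[of "\<lambda>k. k \<in> ?A", OF that] by auto
      have "w s \<le> w l" if "s \<le> l" for s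
      proof (cases "s \<le> r")
        case True
        with r(2) l show ?thesis by (force intro: order_trans)
      next
        case False
        have "s \<notin> ?A" if "s < l" using not_less_Least[OF that[unfolded l_def]] by auto
        with False l(1) that show ?thesis by (cases "s = l") auto
      qed
      with l \<open>\<not> j \<le> k\<close> have "l \<in> ?R" by auto
      from r_max[OF this] l show False by auto
    qed
    hence "Inf (enat ` ?A) = enat j"
      using jA by (intro antisym Inf_lower Inf_greatest) auto
    with i have "weak_ladder_time w (Suc i) = enat j" by simp
    thus ?thesis by blast
  qed
qed

text \<open>Ladder times are the records, so the last one up to \<open>n\<close> is the last time at
  which the maximum over \<open>{..n}\<close> is attained. The two conditions concern the path
  before and after \<open>t\<close>, which makes them independent for the walk.\<close>

lemma last_weak_ladder_time_eq_iff:
  assumes "t \<le> n"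
  shows "last_weak_ladder_time n w = t \<longleftrightarrow> (\<forall>s\<le>t. w s \<le> w t) \<and> (\<forall>s. t < s \<and> s \<le> n \<longrightarrow> w s < w t)"
proof -
  let ?R = "{j. j \<le> n \<and> (\<forall>s\<le>j. w s \<le> w j)}"
  have eq: "last_weak_ladder_time n w = Max ?R"
    unfolding last_weak_ladder_time_def
    using weak_ladder_time_imp_record record_imp_weak_ladder_time
    by (intro arg_cong[where f = Max] Collect_cong) blast
  have R: "finite ?R" "0 \<in> ?R" by auto
  hence "Max ?R = t \<longleftrightarrow> t \<in> ?R \<and> (\<forall>r\<in>?R. r \<le> t)" by (subst Max_eq_iff) auto
  also have "\<dots> \<longleftrightarrow> (\<forall>s\<le>t. w s \<le> w t) \<and> (\<forall>s. t < s \<and> s \<le> n \<longrightarrow> w s < w t)"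
  proof (intro iffI conjI)
    assume "t \<in> ?R \<and> (\<forall>r\<in>?R. r \<le> t)"
    hence t: "\<forall>s\<le>t. w s \<le> w t" "\<And>r. r \<in> ?R \<Longrightarrow> r \<le> t" by auto
    \<comment> \<open>The first later time not strictly below \<open>w t\<close> would be a record
      beyond \<open>t\<close>.\<close>
    have "w s < w t" if "t < s" "s \<le> n" for s
      using that
    proof (induction s rule: less_induct)
      case (less s)
      show ?case
      proof (rule ccontr)
        assume ws: "\<not> w s < w t"
        have "w k \<le> w s" if "k \<le> s" for k
        proof (cases "k \<le> t")
          case True
          with t(1) ws show ?thesis by (force intro: order_trans)
        next
          case False
          with less.IH[of k] ws that less.prems show ?thesis by (cases "k = s") auto
        qed
        with t(2)[of s] less.prems show False by auto
      qed
    qed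
    thus "\<forall>s. t < s \<and> s \<le> n \<longrightarrow> w s < w t" by blast
  next
    assume "(\<forall>s\<le>t. w s \<le> w t) \<and> (\<forall>s. t < s \<and> s \<le> n \<longrightarrow> w s < w t)"
    hence t: "\<forall>s\<le>t. w s \<le> w t" "\<And>s. t < s \<Longrightarrow> s \<le> n \<Longrightarrow> w s < w t" by auto
    have "r \<le> t" if "r \<in> ?R" for r
    proof (rule ccontr)
      assume "\<not> r \<le> t"
      with t(2)[of r] that show False by (auto simp: not_le[symmetric])
    qed
    thus "\<forall>r\<in>?R. r \<le> t" by blast
    from t(1) assms show "t \<in> ?R" by auto
  qed auto
  finally show ?thesis using eq by simp
qed

lemma last_weak_ladder_time_le: "last_weak_ladder_time n w \<le> n"
proof -
  have "{j. j \<le> n \<and> (\<exists>i. weak_ladder_time w i = enat j)} \<noteq> {}"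
    using record_imp_weak_ladder_time[of 0 w] by auto
  from Max_in[OF _ this] show ?thesis by (simp add: last_weak_ladder_time_def)
qed

lemma enat_le_first_negative_iff:
  "enat n \<le> first_negative w \<longleftrightarrow> (\<forall>i. 1 \<le> i \<and> i < n \<longrightarrow> w i \<ge> 0)"
  unfolding first_negative_def le_Inf_iff by (auto simp: not_le[symmetric])

section \<open>Tail, excess and truncated second moment\<close>

context iid_steps
begin

definition tail :: "real \<Rightarrow> real" where
  "tail x = measure_pmf.prob p {k. real_of_int k \<ge> x}"

text \<open>For a centred step this is minus the mean of the step truncated at \<open>x\<close>
  (\<open>excess_eq\<close>), so \<open>n * excess (a n)\<close> will be
  \<open>\<bar>b n\<bar>\<close>; in this form it visibly decreases for
  \<open>x \<ge> 0\<close>.\<close>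

definition excess :: "real \<Rightarrow> real" where
  "excess x = measure_pmf.expectation p (\<lambda>k. real_of_int k * indicator {k. real_of_int k > x} k)"

definition truncated_moment2 :: "real \<Rightarrow> real" where
  "truncated_moment2 x =
     measure_pmf.expectation p (\<lambda>k. (real_of_int k * indicator {k. real_of_int k \<le> x} k)\<^sup>2)"

lemma tail_nonneg [simp]: "tail x \<ge> 0"
  by (simp add: tail_def)

lemma tail_antimono: "x \<le> y \<Longrightarrow> tail y \<le> tail x"
  unfolding tail_def by (rule measure_pmf.finite_measure_mono) auto

end

text \<open>The slowly varying function is replaced by its consequences \<open>tail_pos\<close> and
  \<open>tail_ratio\<close>, the latter being regular variation of the tail with index -1.\<close>

locale cauchy_steps = iid_steps +
  assumes steps_ge: "\<And>k. k \<in> set_pmf p \<Longrightarrow> k \<ge> -1"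
    and integrable_step: "integrable (measure_pmf p) real_of_int"
    and mean_zero: "measure_pmf.expectation p real_of_int = 0"
    and tail_pos: "\<And>x. tail x > 0"
    and tail_ratio: "\<And>c. c > 0 \<Longrightarrow> ((\<lambda>x. tail (c * x) / tail x) \<longlongrightarrow> 1 / c) at_top"
begin

lemma integrable_truncated: "integrable (measure_pmf p) (\<lambda>k. real_of_int k * indicator A k)"
  using integrable_step by (rule integrable_real_mult_indicator[rotated]) simp

lemma integrable_indicator_step: "integrable (measure_pmf p) (indicator A :: int \<Rightarrow> real)"
  by (rule measure_pmf.integrable_const_bound[where B = 1]) (auto simp: indicator_def)

lemma excess_eq: "excess x = - measure_pmf.expectation p (\<lambda>k. real_of_int k * indicator {k. real_of_int k \<le> x} k)"
proof -
  have "excess x + measure_pmf.expectation p (\<lambda>k. real_of_int k * indicator {k. real_of_int k \<le> x} k)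
      = measure_pmf.expectation p
          (\<lambda>k. real_of_int k * indicator {k. real_of_int k > x} k + real_of_int k * indicator {k. real_of_int k \<le> x} k)"
    unfolding excess_def by (rule Bochner_Integration.integral_add[symmetric]) (rule integrable_truncated)+
  also have "(\<lambda>k. real_of_int k * indicator {k. real_of_int k > x} k + real_of_int k * indicator {k. real_of_int k \<le> x} k) = real_of_int"
    by (auto simp: indicator_def)
  finally show ?thesis using mean_zero by simp
qed

lemma excess_antimono:
  assumes "0 \<le> x" "x \<le> y"
  shows "excess y \<le> excess x"
  unfolding excess_def using assms
  by (intro integral_mono integrable_truncated) (auto simp: indicator_def)

lemma excess_diff_le:
  assumes "0 \<le> x" "x \<le> y"
  shows "excess x - excess y \<le> y * tail x"
proof -
  have "excess x \<le> measure_pmf.expectation p (\<lambda>k. real_of_int k * indicator {k. real_of_int k > y} k + y * indicator {k. real_of_int k \<ge> x} k)"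
    unfolding excess_def using assms
    by (intro integral_mono integrable_truncated Bochner_Integration.integrable_add integrable_mult_right
         integrable_indicator_step) (auto simp: indicator_def)
  also have "\<dots> = excess y + y * tail x"
    unfolding excess_def tail_def
    by (subst Bochner_Integration.integral_add[OF integrable_truncated integrable_mult_right[OF integrable_indicator_step]])
       simp
  finally show ?thesis by simp
qed

text \<open>Each step is replaced by the left end of its dyadic block between
  \<open>2 ^ i * x\<close> and \<open>2 ^ Suc i * x\<close>. The induction splits off the first
  block and passes from \<open>x\<close> to \<open>2 * x\<close>.\<close>

lemma excess_ge_dyadic:
  assumes "0 < x"
  shows "(\<Sum>i<J. 2 ^ i * x * (tail (2 ^ i * x) - tail (2 ^ Suc i * x)))
     \<le> measure_pmf.expectation p (\<lambda>k. real_of_int k * indicator {k. real_of_int k \<ge> x} k)"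
  using assms
proof (induction J arbitrary: x)
  case 0
  then show ?case by (auto intro!: integral_nonneg_AE simp: indicator_def)
next
  case (Suc J)
  define E where "E = (\<lambda>x. measure_pmf.expectation p (\<lambda>k. real_of_int k * indicator {k. real_of_int k \<ge> x} k))"
  have "(\<Sum>i<Suc J. 2 ^ i * x * (tail (2 ^ i * x) - tail (2 ^ Suc i * x)))
      = x * (tail x - tail (2 * x)) + (\<Sum>i<J. 2 ^ i * (2 * x) * (tail (2 ^ i * (2 * x)) - tail (2 ^ Suc i * (2 * x))))"
    by (subst sum.lessThan_Suc_shift) (simp add: mult_ac)
  also have "\<dots> \<le> x * (tail x - tail (2 * x)) + E (2 * x)"
    unfolding E_def using Suc.IH[of "2 * x"] Suc.prems by simp
  also have "\<dots> = measure_pmf.expectation p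
     (\<lambda>k. x * (indicator {k. real_of_int k \<ge> x} k - indicator {k. real_of_int k \<ge> 2 * x} k)
          + real_of_int k * indicator {k. real_of_int k \<ge> 2 * x} k)"
    unfolding E_def tail_def
    by (subst Bochner_Integration.integral_add[OF integrable_mult_right[OF Bochner_Integration.integrable_diff] integrable_truncated])
       (simp_all add: integrable_indicator_step Bochner_Integration.integral_diff)
  also have "\<dots> \<le> E x"
    unfolding E_def using Suc.prems
    by (intro integral_mono integrable_truncated Bochner_Integration.integrable_add integrable_mult_right
          Bochner_Integration.integrable_diff integrable_indicator_step)
       (auto simp: indicator_def)
  finally show ?case unfolding E_def .
qed

text \<open>By regular variation with index -1 every dyadic block contributes about
  \<open>x * tail x / 2\<close>, and the number of blocks is arbitrary.\<close>

lemma excess_ge_multiple_tail: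
  "eventually (\<lambda>x. excess x \<ge> K * (x * tail x)) at_top"
proof -
  obtain J :: nat where J: "K < real J / 2" using reals_Archimedean2[of "2 * K"] by (auto simp: mult.commute)
  define f where "f = (\<lambda>x. \<Sum>i<Suc J. 2 ^ i * (tail (2 ^ i * x) / tail x - tail (2 ^ Suc i * x) / tail x))"
  have "(f \<longlongrightarrow> (\<Sum>i<Suc J. 2 ^ i * (1 / 2 ^ i - 1 / 2 ^ Suc i))) at_top"
    unfolding f_def by (intro tendsto_intros tail_ratio) simp_all
  also have "(\<Sum>i<Suc J. 2 ^ i * (1 / 2 ^ i - 1 / 2 ^ Suc i)) = (\<Sum>i<Suc J. 1 / 2 :: real)"
    by (intro sum.cong) (auto simp: field_simps)
  finally have lim: "(f \<longlongrightarrow> real (Suc J) / 2) at_top" by simp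
  \<comment> \<open>The term of index 0 is removed so that the sum starts at \<open>2 * x\<close>:
    the dyadic bound counts steps at least equal to its starting point, while
    \<open>excess x\<close> counts steps strictly above \<open>x\<close>.\<close>
  have "((\<lambda>x. f x - (1 - tail (2 * x) / tail x)) \<longlongrightarrow> real (Suc J) / 2 - (1 - 1 / 2)) at_top"
    by (intro tendsto_intros lim tail_ratio) simp
  hence "eventually (\<lambda>x. f x - (1 - tail (2 * x) / tail x) > K) at_top"
    using J by (intro order_tendstoD(1)) (auto simp: field_simps)
  with eventually_gt_at_top[of 0] show ?thesis
  proof eventually_elim
    case (elim x)
    have tx: "tail x > 0" by (rule tail_pos)
    have f: "x * tail x * f x = (\<Sum>i<Suc J. 2 ^ i * x * (tail (2 ^ i * x) - tail (2 ^ Suc i * x)))"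
      unfolding f_def sum_distrib_left using tx by (intro sum.cong) (auto simp: field_simps)
    have *: "(\<Sum>i<J. 2 ^ i * (2*x) * (tail (2 ^ i * (2*x)) - tail (2 ^ Suc i * (2*x)))) =
       x * tail x * (f x - (1 - tail (2 * x) / tail x))"
      unfolding right_diff_distrib[of _ "f x"] f
      by (subst sum.lessThan_Suc_shift) (use tx in \<open>simp add: mult_ac field_simps\<close>)
    have "K * (x * tail x) \<le> (f x - (1 - tail (2 * x) / tail x)) * (x * tail x)"
      using elim tx by (intro mult_right_mono) auto
    also have "\<dots> \<le> measure_pmf.expectation p (\<lambda>k. real_of_int k * indicator {k. real_of_int k \<ge> 2 * x} k)"
      using excess_ge_dyadic[of "2 * x" J] elim * by (simp add: mult_ac)
    also have "\<dots> \<le> excess x"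
      unfolding excess_def using elim
      by (intro integral_mono integrable_truncated) (auto simp: indicator_def)
    finally show ?case .
  qed
qed

section \<open>Truncated second moment\<close>

lemma integrable_truncated_square:
  "integrable (measure_pmf p) (\<lambda>k. (real_of_int k * indicator {k. real_of_int k \<le> x} k)\<^sup>2)"
proof (rule measure_pmf.integrable_const_bound[where B = "max 1 (x\<^sup>2)"])
  show "AE k in measure_pmf p. norm ((real_of_int k * indicator {k. real_of_int k \<le> x} k)\<^sup>2) \<le> max 1 (x\<^sup>2)"
  proof (rule AE_pmfI)
    fix k assume "k \<in> set_pmf p"
    hence "real_of_int k \<ge> -1" using steps_ge by force
    have "(real_of_int k)\<^sup>2 \<le> max 1 (x\<^sup>2)" if "real_of_int k \<le> x"
    proof (cases "k \<ge> 0")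
      case True
      hence "(real_of_int k)\<^sup>2 \<le> x\<^sup>2" using that by (intro power_mono) auto
      thus ?thesis by simp
    next
      case False
      with \<open>real_of_int k \<ge> -1\<close> have "k = -1" by simp
      thus ?thesis by simp
    qed
    thus "norm ((real_of_int k * indicator {k. real_of_int k \<le> x} k)\<^sup>2) \<le> max 1 (x\<^sup>2)"
      by (auto simp: indicator_def)
  qed
qed simp

lemma truncated_moment2_mono:
  assumes "x \<le> y"
  shows "truncated_moment2 x \<le> truncated_moment2 y"
  unfolding truncated_moment2_def using assms
  by (intro integral_mono integrable_truncated_square) (auto simp: indicator_def)

lemma truncated_moment2_double:
  assumes "0 \<le> x"
  shows "truncated_moment2 (2 * x) \<le> truncated_moment2 x + 4 * x\<^sup>2 * tail x"
proof -
  have "truncated_moment2 (2 * x) \<le> measure_pmf.expectation p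
    (\<lambda>k. (real_of_int k * indicator {k. real_of_int k \<le> x} k)\<^sup>2 + 4 * x\<^sup>2 * indicator {k. real_of_int k \<ge> x} k)"
    unfolding truncated_moment2_def
  proof (intro integral_mono integrable_truncated_square Bochner_Integration.integrable_add integrable_mult_right
      integrable_indicator_step)
    fix k :: int
    have "(real_of_int k)\<^sup>2 \<le> 4 * x\<^sup>2" if "x < real_of_int k" "real_of_int k \<le> 2 * x"
      using power_mono[of "real_of_int k" "2 * x" 2] that assms by (simp add: power_mult_distrib)
    thus "(real_of_int k * indicator {k. real_of_int k \<le> 2 * x} k)\<^sup>2
      \<le> (real_of_int k * indicator {k. real_of_int k \<le> x} k)\<^sup>2 + 4 * x\<^sup>2 * indicator {k. real_of_int k \<ge> x} k"
      by (auto simp: indicator_def)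
  qed
  also have "\<dots> = truncated_moment2 x + 4 * x\<^sup>2 * tail x"
    unfolding truncated_moment2_def tail_def
    by (subst Bochner_Integration.integral_add[OF integrable_truncated_square integrable_mult_right[OF integrable_indicator_step]])
       simp
  finally show ?thesis .
qed

text \<open>Doubling \<open>x\<close> adds at most \<open>4 * x\<^sup>2 * tail x\<close> to the
  truncated moment but nearly doubles \<open>x\<^sup>2 * tail x\<close>, so up to a constant the
  dyadic increments are dominated by the last one.\<close>

lemma truncated_moment2_le_tail:
  obtains C where "C > 0" "eventually (\<lambda>x. truncated_moment2 x \<le> C * (x\<^sup>2 * tail x)) at_top"
proof -
  \<comment> \<open>The limit of this ratio is 1/2; with 3/8 the claimed bound still grows by the
    factor \<open>4 * 3/8 = 3/2\<close> at each doubling.\<close>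
  have "eventually (\<lambda>x. tail (2 * x) / tail x > 3 / 8) at_top"
    using tail_ratio[of 2] by (intro order_tendstoD(1)) auto
  then obtain A where A: "\<And>x. x \<ge> A \<Longrightarrow> tail (2 * x) / tail x > 3 / 8"
    unfolding eventually_at_top_linorder by auto
  define A0 where "A0 = max A 1"
  have A0: "A0 \<ge> 1" "\<And>x. x \<ge> A0 \<Longrightarrow> tail (2 * x) \<ge> 3 / 8 * tail x"
  proof -
    show "A0 \<ge> 1" by (simp add: A0_def)
    fix x assume "x \<ge> A0"
    with A[of x] tail_pos[of x] show "tail (2 * x) \<ge> 3 / 8 * tail x" by (simp add: A0_def field_simps)
  qed
  \<comment> \<open>\<open>C \<ge> 8\<close> gives \<open>C + 4 \<le> 3/2 * C\<close> in the
    doubling step; the other term settles the range from \<open>A0\<close> to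
    \<open>2 * A0\<close>.\<close>
  define C where "C = max 8 (truncated_moment2 (2 * A0) / (A0\<^sup>2 * tail (2 * A0)))"
  have C: "C \<ge> 8" by (simp add: C_def)
  have base: "truncated_moment2 x \<le> C * (x\<^sup>2 * tail x)" if "A0 \<le> x" "x \<le> 2 * A0" for x
  proof -
    have "truncated_moment2 x \<le> truncated_moment2 (2 * A0)"
      using that by (intro truncated_moment2_mono)
    also have "\<dots> = truncated_moment2 (2 * A0) / (A0\<^sup>2 * tail (2 * A0)) * (A0\<^sup>2 * tail (2 * A0))"
      using A0(1) tail_pos[of "2 * A0"] by simp
    also have "\<dots> \<le> C * (x\<^sup>2 * tail x)"
      using A0(1) that C by (intro mult_mono power_mono tail_antimono) (auto simp: C_def)
    finally show ?thesis .
  qed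
  have step: "\<forall>x. A0 \<le> x \<and> x \<le> 2 ^ Suc k * A0 \<longrightarrow> truncated_moment2 x \<le> C * (x\<^sup>2 * tail x)" for k
  proof (induction k)
    case 0
    then show ?case using base by simp
  next
    case (Suc k)
    show ?case
    proof (intro allI impI, goal_cases)
      case (1 x)
      show ?case
      proof (cases "x \<le> 2 * A0")
        case True
        with base 1 show ?thesis by blast
      next
        case False
        define y where "y = x / 2"
        have y: "A0 \<le> y" "y \<le> 2 ^ Suc k * A0" "x = 2 * y" using 1 False by (auto simp: y_def)
        have "truncated_moment2 x \<le> truncated_moment2 y + 4 * y\<^sup>2 * tail y"
          unfolding y(3) using y A0(1) by (intro truncated_moment2_double) auto
        also have "\<dots> \<le> (C + 4) * (y\<^sup>2 * tail y)"
          using Suc.IH y by (auto simp: algebra_simps)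
        also have "\<dots> \<le> (3 / 2 * C) * (y\<^sup>2 * tail y)"
          using C by (intro mult_right_mono) auto
        also have "\<dots> = 4 * C * y\<^sup>2 * (3 / 8 * tail y)" by simp
        also have "\<dots> \<le> 4 * C * y\<^sup>2 * tail (2 * y)"
          using A0(2)[OF y(1)] C by (intro mult_left_mono) auto
        also have "\<dots> = C * (x\<^sup>2 * tail x)" by (simp add: y power2_eq_square)
        finally show ?thesis .
      qed
    qed
  qed
  have "truncated_moment2 x \<le> C * (x\<^sup>2 * tail x)" if "x \<ge> A0" for x
  proof -
    obtain k where "x / A0 < 2 ^ k" using real_arch_pow[of 2 "x / A0"] by auto
    hence "x < 2 ^ k * A0" using A0 by (simp add: divide_less_eq)
    also have "\<dots> \<le> 2 ^ Suc k * A0" using A0 by (intro mult_right_mono) auto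
    finally show ?thesis using step[of k] that by simp
  qed
  hence "eventually (\<lambda>x. truncated_moment2 x \<le> C * (x\<^sup>2 * tail x)) at_top"
    unfolding eventually_at_top_linorder by blast
  with C show ?thesis by (intro that[of C]) auto
qed

end

section \<open>Scaling sequences and the weak law\<close>

context iid_steps
begin

lemma indep_coordinates:
  "P.indep_vars (\<lambda>_. measure_pmf p) (\<lambda>i x. x i) UNIV"
proof (subst P.indep_vars_iff_distr_eq_PiM)
  show "distr S (\<Pi>\<^sub>M i\<in>UNIV. measure_pmf p) (\<lambda>x. \<lambda>i\<in>UNIV. x i) =
    (\<Pi>\<^sub>M i\<in>UNIV. distr S (measure_pmf p) (\<lambda>x. x i))"
    by (simp add: distr_coordinate restrict_UNIV)
qed (auto intro: measurable_component_singleton)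

lemma
  fixes g :: "int \<Rightarrow> real"
  shows integral_coordinate: "(\<integral>x. g (x i) \<partial>S) = measure_pmf.expectation p g"
    and integrable_coordinate: "integrable (measure_pmf p) g \<Longrightarrow> integrable S (\<lambda>x. g (x i))"
proof -
  have mS: "(\<lambda>x. x i) \<in> measurable S (measure_pmf p)"
    by (rule measurable_component_singleton) simp
  show "(\<integral>x. g (x i) \<partial>S) = measure_pmf.expectation p g"
    using integral_distr[OF mS, of g] by (simp add: distr_coordinate)
  show "integrable S (\<lambda>x. g (x i))" if "integrable (measure_pmf p) g"
    using integrable_distr[OF mS, of g] that by (simp add: distr_coordinate)
qed

text \<open>Independence and centring remove the cross terms of the squared sum.\<close>

lemma Chebyshev_sum:
  fixes g :: "int \<Rightarrow> real"
  assumes g: "integrable (measure_pmf p) g" "integrable (measure_pmf p) (\<lambda>k. (g k)\<^sup>2)"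
    and mean: "measure_pmf.expectation p g = 0" and t: "t > 0"
  shows "P.prob {x. \<bar>\<Sum>i<k. g (x i)\<bar> \<ge> t} \<le> real k * measure_pmf.expectation p (\<lambda>k. (g k)\<^sup>2) / t\<^sup>2"
proof -
  have [measurable]: "(\<lambda>x. g (x i)) \<in> borel_measurable S" for i
    using integrable_coordinate[OF g(1)] by (rule borel_measurable_integrable)
  have indep: "P.indep_vars (\<lambda>_. borel) (\<lambda>i x. g (x i)) I" for I
    by (rule P.indep_vars_compose2[OF P.indep_vars_subset[OF indep_coordinates]]) auto
  have cross: "integrable S (\<lambda>x. g (x i) * g (x j))"
     "(\<integral>x. g (x i) * g (x j) \<partial>S) = (if i = j then measure_pmf.expectation p (\<lambda>k. (g k)\<^sup>2) else 0)" for i j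
  proof -
    consider "i = j" | "i \<noteq> j" by blast
    hence "integrable S (\<lambda>x. g (x i) * g (x j)) \<and>
     (\<integral>x. g (x i) * g (x j) \<partial>S) = (if i = j then measure_pmf.expectation p (\<lambda>k. (g k)\<^sup>2) else 0)"
    proof cases
      case 1
      with integrable_coordinate[OF g(2), of i] integral_coordinate[of "\<lambda>k. (g k)\<^sup>2" i]
      show ?thesis by (simp add: power2_eq_square)
    next
      case 2
      hence eq: "(\<lambda>x. \<Prod>l\<in>{i, j}. g (x l)) = (\<lambda>x. g (x i) * g (x j))" by (simp add: fun_eq_iff)
      show ?thesis
        using P.indep_vars_integrable[OF _ indep[of "{i, j}"] integrable_coordinate[OF g(1)]]
          P.indep_vars_lebesgue_integral[OF _ indep[of "{i, j}"] integrable_coordinate[OF g(1)]] 2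
          integral_coordinate[of g] mean
        by (simp add: eq)
    qed
    thus "integrable S (\<lambda>x. g (x i) * g (x j))"
     "(\<integral>x. g (x i) * g (x j) \<partial>S) = (if i = j then measure_pmf.expectation p (\<lambda>k. (g k)\<^sup>2) else 0)"
      by auto
  qed
  have sq: "(\<lambda>x. (\<Sum>i<k. g (x i))\<^sup>2) = (\<lambda>x. \<Sum>i<k. \<Sum>j<k. g (x i) * g (x j))"
    by (simp add: power2_eq_square sum_product)
  have "P.prob {x\<in>space S. \<bar>\<Sum>i<k. g (x i)\<bar> \<ge> t} \<le> (\<integral>x. (\<Sum>i<k. g (x i))\<^sup>2 \<partial>S) / t\<^sup>2"
    by (rule P.second_moment_method) (use cross t in \<open>auto simp: sq\<close>)
  also have "(\<integral>x. (\<Sum>i<k. g (x i))\<^sup>2 \<partial>S) = (\<Sum>i<k. \<Sum>j<k. (if i = j then measure_pmf.expectation p (\<lambda>k. (g k)\<^sup>2) else 0))"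
    unfolding sq using cross by (simp del: sum.delta sum.delta')
  also have "\<dots> = real k * measure_pmf.expectation p (\<lambda>k. (g k)\<^sup>2)"
    by simp
  finally show ?thesis by simp
qed

lemma determined_by_walkI:
  assumes "\<And>x y. (\<And>i. i < k \<Longrightarrow> x i = y i) \<Longrightarrow> (\<And>i. i \<le> k \<Longrightarrow> partial_sum x i = partial_sum y i)
    \<Longrightarrow> x \<in> A \<Longrightarrow> y \<in> A"
  shows "determined_by_prefix k A"
proof (rule determined_by_prefixI)
  fix x y :: "nat \<Rightarrow> int" assume *: "\<And>i. i < k \<Longrightarrow> x i = y i" "x \<in> A"
  moreover have "partial_sum x i = partial_sum y i" if "i \<le> k" for i
    using that * by (intro partial_sum_cong) auto
  ultimately show "y \<in> A" using assms[of x y] by blast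
qed

lemma determined_partial_sum:
  "i \<le> k \<Longrightarrow> determined_by_prefix k {x. P (partial_sum x i)}"
  by (rule determined_by_walkI) auto

lemma sets_partial_sum: "{x. P (partial_sum x k)} \<in> sets S"
  by (rule sets_determined[OF determined_partial_sum[OF order_refl]])

end

text \<open>\<open>m n\<close> will be \<open>\<bar>b n\<bar>\<close>. The equation is asked for
  large \<open>n\<close> only, because the two-sided truncation in \<open>b n\<close> agrees with
  the one-sided one once \<open>a n \<ge> 1\<close>.\<close>

locale cauchy_walk = cauchy_steps +
  fixes a m :: "nat \<Rightarrow> real"
  assumes a_lim: "(\<lambda>n. real n * tail (a n)) \<longlonglongrightarrow> 1"
    and m_eq: "eventually (\<lambda>n. m n = real n * excess (a n)) sequentially"
begin

lemma a_at_top: "filterlim a at_top sequentially"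
  unfolding filterlim_at_top_dense
proof
  fix K :: real
  have "eventually (\<lambda>n. real n * tail (a n) < 2) sequentially"
    using a_lim by (rule order_tendstoD) simp
  moreover have "eventually (\<lambda>n. real n > 2 / tail K) sequentially"
    using filterlim_real_sequentially by (simp add: filterlim_at_top_dense)
  ultimately show "eventually (\<lambda>n. a n > K) sequentially"
  proof eventually_elim
    case (elim n)
    show ?case
    proof (rule ccontr)
      assume "\<not> a n > K"
      hence "tail K \<le> tail (a n)" by (intro tail_antimono) simp
      hence "real n * tail K \<le> real n * tail (a n)" by (intro mult_left_mono) auto
      with elim tail_pos[of K] show False by (simp add: field_simps)
    qed
  qed
qed

lemmas eventually_a = filterlim_iff[THEN iffD1, OF a_at_top, rule_format]

lemma a_pos: "eventually (\<lambda>n. a n > 0) sequentially"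
  by (rule eventually_a) (rule eventually_gt_at_top)

lemma n_tail_a_scaled:
  assumes "c > 0"
  shows "(\<lambda>n. real n * tail (c * a n)) \<longlonglongrightarrow> 1 / c"
proof -
  have "(\<lambda>n. (real n * tail (a n)) * (tail (c * a n) / tail (a n))) \<longlonglongrightarrow> 1 * (1 / c)"
    by (intro tendsto_mult a_lim filterlim_compose[OF tail_ratio[OF assms] a_at_top])
  moreover have "(real n * tail (a n)) * (tail (c * a n) / tail (a n)) = real n * tail (c * a n)" for n
    using tail_pos[of "a n"] by simp
  ultimately show ?thesis by simp
qed

text \<open>Since \<open>n * tail (a n)\<close> tends to 1, this is
  \<open>excess_ge_multiple_tail\<close> at \<open>a n\<close>: the drift over \<open>n\<close>
  steps dominates the fluctuation scale.\<close>

lemma m_ge_multiple_a: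
  assumes "K \<ge> 0"
  shows "eventually (\<lambda>n. m n \<ge> K * a n) sequentially"
proof -
  have "eventually (\<lambda>n. real n * tail (a n) > 1 / 2) sequentially"
    using a_lim by (rule order_tendstoD) simp
  with m_eq a_pos eventually_a[OF excess_ge_multiple_tail[of "2 * K"]]
  show ?thesis
  proof eventually_elim
    case (elim n)
    have "K * a n = 2 * K * a n * (1 / 2)" by simp
    also have "\<dots> \<le> 2 * K * a n * (real n * tail (a n))"
      using elim assms by (intro mult_left_mono) auto
    also have "\<dots> = real n * (2 * K * (a n * tail (a n)))" by simp
    also have "\<dots> \<le> real n * excess (a n)" using elim by (intro mult_left_mono) auto
    finally show ?case using elim by simp
  qed
qed

lemma m_at_top: "filterlim m at_top sequentially"
  using a_at_top m_ge_multiple_a[of 1] by (auto intro: filterlim_at_top_mono)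

lemmas eventually_m = filterlim_iff[THEN iffD1, OF m_at_top, rule_format]

lemma m_pos: "eventually (\<lambda>n. m n > 0) sequentially"
  by (rule eventually_m) (rule eventually_gt_at_top)

lemma tail_m_scaled: "c > 0 \<Longrightarrow> (\<lambda>n. tail (c * m n) / tail (m n)) \<longlonglongrightarrow> 1 / c"
  by (rule filterlim_compose[OF tail_ratio m_at_top])

lemma n_tail_m: "(\<lambda>n. real n * tail (m n)) \<longlonglongrightarrow> 0"
proof (rule order_tendstoI)
  fix e :: real assume e: "e > 0"
  \<comment> \<open>\<open>n * tail (c * a n)\<close> tends to \<open>1 / c\<close>, and
    \<open>c = 2 / e\<close> makes this limit \<open>e / 2\<close>.\<close>
  have "eventually (\<lambda>n. real n * tail ((2 / e) * a n) < e) sequentially"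
    by (rule order_tendstoD[OF n_tail_a_scaled]) (use e in auto)
  moreover have "eventually (\<lambda>n. m n \<ge> (2 / e) * a n) sequentially"
    using e by (intro m_ge_multiple_a) simp
  ultimately show "eventually (\<lambda>n. real n * tail (m n) < e) sequentially"
  proof eventually_elim
    case (elim n)
    have "real n * tail (m n) \<le> real n * tail ((2 / e) * a n)"
      using elim by (intro mult_left_mono tail_antimono) auto
    with elim show ?case by simp
  qed
next
  fix e :: real assume e: "e < 0"
  hence "e < real n * tail (m n)" for n by (rule less_le_trans) simp
  thus "eventually (\<lambda>n. e < real n * tail (m n)) sequentially" by simp
qed

section \<open>Comparison of the scales at times \<open>n div d\<close> and \<open>n\<close>\<close>

lemma filterlim_div: "d > 0 \<Longrightarrow> filterlim (\<lambda>n::nat. n div d) at_top sequentially"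
  unfolding filterlim_at_top
proof
  fix K :: nat assume "d > 0"
  hence "K \<le> n div d" if "n \<ge> K * d" for n
    using that by (simp add: less_eq_div_iff_mult_less_eq)
  thus "eventually (\<lambda>n. K \<le> n div d) sequentially"
    unfolding eventually_sequentially by blast
qed

lemmas eventually_div = filterlim_iff[THEN iffD1, OF filterlim_div, rule_format]

text \<open>The smaller time has the smaller \<open>a\<close>, hence the larger
  \<open>excess\<close>, so \<open>m (n div d)\<close> is at least \<open>m n / (2 * d)\<close>;
  regular variation of the tail turns this into the claim.\<close>

lemma tail_m_div:
  assumes d: "d \<ge> 2"
  obtains C where "C > 0" "eventually (\<lambda>n. tail (m (n div d)) \<le> C * tail (m n)) sequentially"
proof -
  define c where "c = 1 / (2 * real d)"
  have c: "c > 0" using d by (simp add: c_def)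
  have "eventually (\<lambda>n. real n * tail (a n) < 3 / 2) sequentially"
    using a_lim by (rule order_tendstoD) simp
  moreover have "eventually (\<lambda>n. real n * tail (a n) > 3 / 4) sequentially"
    using a_lim by (rule order_tendstoD) simp
  hence "eventually (\<lambda>n. real (n div d) * tail (a (n div d)) > 3 / 4) sequentially"
    by (rule eventually_div[rotated]) (use d in simp)
  moreover have "eventually (\<lambda>n. a (n div d) > 0) sequentially"
    by (rule eventually_div[OF _ a_pos]) (use d in simp)
  moreover have "eventually (\<lambda>n. m (n div d) = real (n div d) * excess (a (n div d))) sequentially"
    by (rule eventually_div[OF _ m_eq]) (use d in simp)
  moreover have "eventually (\<lambda>n. tail (c * m n) / tail (m n) < 2 / c) sequentially"
    using tail_m_scaled[OF c] by (rule order_tendstoD) (use c in \<open>simp add: divide_strict_right_mono\<close>)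
  ultimately have "eventually (\<lambda>n. tail (m (n div d)) \<le> (2 / c) * tail (m n)) sequentially"
    using m_eq m_pos eventually_ge_at_top[of "2 * d"] eventually_gt_at_top[of 0]
  proof eventually_elim
    case (elim n)
    have K: "real (n div d) \<le> real n / 2"
    proof -
      have "real (n div d) \<le> real n / real d" using of_nat_div_le_of_nat[of n d, where 'a = real] by simp
      also have "\<dots> \<le> real n / 2" using d by (intro divide_left_mono) auto
      finally show ?thesis .
    qed
    \<comment> \<open>\<open>a\<close> is not assumed monotone. The bounds 3/4 and 3/2 above fit the
      factor 1/2: otherwise \<open>3/4 < n / 2 * tail (a n) < 3/4\<close>.\<close>
    have "a (n div d) \<le> a n"
    proof (rule ccontr)
      assume "\<not> a (n div d) \<le> a n"
      hence "real (n div d) * tail (a (n div d)) \<le> (real n / 2) * tail (a n)"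
        using K by (intro mult_mono tail_antimono) auto
      with elim show False by simp
    qed
    hence ex: "excess (a n) \<le> excess (a (n div d))"
      using elim by (intro excess_antimono) auto
    have "c * real n \<le> real (n div d)"
    proof -
      have "real n - real d \<le> real d * real (n div d)"
      proof -
        have "n - d \<le> d * (n div d)"
          using mod_less_divisor[of d n] d mult_div_mod_eq[of d n] by linarith
        thus ?thesis using elim by (simp flip: of_nat_mult add: of_nat_diff[symmetric] del: of_nat_diff)
      qed
      moreover have "real d \<le> real n / 2" using elim by simp
      ultimately have "real n / 2 \<le> real d * real (n div d)" by simp
      thus ?thesis using d by (simp add: c_def field_simps)
    qed
    moreover have "excess (a n) > 0" using elim by (simp add: zero_less_mult_iff)
    ultimately have "c * real n * excess (a n) \<le> real (n div d) * excess (a (n div d))"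
      using ex by (intro mult_mono) auto
    hence "c * m n \<le> m (n div d)" using elim by simp
    hence "tail (m (n div d)) \<le> tail (c * m n)" by (rule tail_antimono)
    also have "\<dots> \<le> (2 / c) * tail (m n)"
      using elim tail_pos[of "m n"] by (simp add: divide_less_eq)
    finally show ?case .
  qed
  with c show ?thesis by (intro that[of "2 / c"]) auto
qed

text \<open>Steps are truncated at a large multiple of \<open>a n\<close>: the truncated sum has variance of order
  \<open>(a n)\<^sup>2\<close>, which is negligible against \<open>(m n)\<^sup>2\<close>.\<close>
lemma weak_law:
  assumes e: "e > 0" and h: "h > 0"
  shows "eventually (\<lambda>n. \<forall>k\<le>n. P.prob {x. \<bar>real_of_int (partial_sum x k) + real k * (m n / real n)\<bar> \<ge> e * m n} \<le> h)
    sequentially"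
proof -
  obtain C1 where C1: "C1 > 0" "eventually (\<lambda>x. truncated_moment2 x \<le> C1 * (x\<^sup>2 * tail x)) at_top"
    by (rule truncated_moment2_le_tail)
  \<comment> \<open>\<open>C\<close>, the truncation level in units of \<open>a n\<close>, makes a
    step beyond it unlikely; \<open>K1\<close> brings the variance term down to
    \<open>h / 2\<close>, and \<open>K2\<close> the change of centring to
    \<open>e / 4 * m n\<close>.\<close>
  define C where "C = max 1 (4 / h)"
  have C: "C \<ge> 1" "C * h \<ge> 4" using h by (auto simp: C_def max_def field_simps)
  define K1 where "K1 = sqrt (16 * C1 * C\<^sup>2 / (e\<^sup>2 * h))"
  define K2 where "K2 = 8 * C / e"
  have K1: "K1 \<ge> 0" "K1\<^sup>2 = 16 * C1 * C\<^sup>2 / (e\<^sup>2 * h)" using C1 h by (auto simp: K1_def)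
  have K2: "K2 \<ge> 0" using C e by (simp add: K2_def)
  have A_top: "filterlim (\<lambda>n. C * a n) at_top sequentially"
    using C by (intro filterlim_tendsto_pos_mult_at_top[OF tendsto_const _ a_at_top]) simp
  have "1 / C < h / 2" using C h by (simp add: field_simps)
  hence "eventually (\<lambda>n. real n * tail (C * a n) < h / 2) sequentially"
    using C by (intro order_tendstoD(2)[OF n_tail_a_scaled]) auto
  moreover have "eventually (\<lambda>n. real n * tail (C * a n) < 2) sequentially"
    using C by (intro order_tendstoD(2)[OF n_tail_a_scaled]) (auto simp: field_simps)
  moreover have "eventually (\<lambda>n. real n * tail (a n) < 2) sequentially"
    using a_lim by (rule order_tendstoD) simp
  moreover have "eventually (\<lambda>n. truncated_moment2 (C * a n) \<le> C1 * ((C * a n)\<^sup>2 * tail (C * a n))) sequentially"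
    using C1(2) A_top by (rule eventually_compose_filterlim)
  ultimately show ?thesis
    using m_eq m_pos a_pos m_ge_multiple_a[OF K1(1)] m_ge_multiple_a[OF K2] eventually_gt_at_top[of 0]
  proof eventually_elim
    case (elim n)
    define A where "A = C * a n"
    have A: "A > 0" "a n \<le> A" using elim C by (auto simp: A_def)
    define Y where "Y = (\<lambda>k. real_of_int k * indicator {k. real_of_int k \<le> A} k)"
    define g where "g = (\<lambda>k. Y k + excess A)"
    have Y: "integrable (measure_pmf p) Y" "integrable (measure_pmf p) (\<lambda>k. (Y k)\<^sup>2)"
      "measure_pmf.expectation p Y = - excess A"
      unfolding Y_def using integrable_truncated integrable_truncated_square excess_eq by auto
    have g: "integrable (measure_pmf p) g" "integrable (measure_pmf p) (\<lambda>k. (g k)\<^sup>2)"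
      "measure_pmf.expectation p g = 0"
      unfolding g_def using Y by (auto simp: power2_sum)
    have g2: "measure_pmf.expectation p (\<lambda>k. (g k)\<^sup>2) \<le> truncated_moment2 A"
    proof -
      have "measure_pmf.expectation p (\<lambda>k. (g k)\<^sup>2) = measure_pmf.expectation p (\<lambda>k. (Y k)\<^sup>2) - (excess A)\<^sup>2"
        unfolding g_def power2_sum using Y by (simp add: power2_eq_square)
      thus ?thesis by (simp add: truncated_moment2_def Y_def)
    qed
    define t where "t = e / 2 * m n"
    have "m n > 0" by fact
    hence t: "t > 0" using e by (simp add: t_def)
    show ?case
    proof (intro allI impI)
      fix k assume k: "k \<le> n"
      \<comment> \<open>Truncation at \<open>A\<close> centres with \<open>excess A\<close>, whereas
        \<open>m n\<close> is built from \<open>excess (a n)\<close>; the difference comes from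
        steps between \<open>a n\<close> and \<open>A\<close>.\<close>
      have bias: "\<bar>real k * (m n / real n) - real k * excess A\<bar> \<le> e / 4 * m n"
      proof -
        have eq: "real k * (m n / real n) - real k * excess A = real k * (excess (a n) - excess A)"
          using elim by (simp add: algebra_simps)
        have "0 \<le> excess (a n) - excess A" using excess_antimono[of "a n" A] A elim by simp
        hence "\<bar>real k * (excess (a n) - excess A)\<bar> = real k * (excess (a n) - excess A)" by simp
        also have "\<dots> \<le> real n * (A * tail (a n))"
          using excess_diff_le[of "a n" A] A elim k \<open>0 \<le> excess (a n) - excess A\<close>
          by (intro mult_mono) auto
        also have "\<dots> = A * (real n * tail (a n))" by simp
        also have "\<dots> \<le> A * 2" using A elim by (intro mult_left_mono) auto
        also have "\<dots> = e / 4 * (K2 * a n)" using e by (simp add: K2_def A_def)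
        also have "\<dots> \<le> e / 4 * m n" using e elim by (intro mult_left_mono) auto
        finally show ?thesis unfolding eq .
      qed
      have sub: "{x. \<bar>real_of_int (partial_sum x k) + real k * (m n / real n)\<bar> \<ge> e * m n}
        \<subseteq> (\<Union>i<k. {x. x i \<in> {l. real_of_int l \<ge> A}}) \<union> {x. \<bar>\<Sum>i<k. g (x i)\<bar> \<ge> t}"
      proof (rule subsetI, rule ccontr, goal_cases)
        case (1 x)
        hence small: "\<And>i. i < k \<Longrightarrow> real_of_int (x i) < A" and "\<bar>\<Sum>i<k. g (x i)\<bar> < t" by (auto simp: not_le)
        have "(\<Sum>i<k. g (x i)) = real_of_int (partial_sum x k) + real k * excess A"
          unfolding partial_sum_def g_def sum.distrib Y_def using small
          by (simp add: indicator_def less_imp_le)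
        with \<open>\<bar>\<Sum>i<k. g (x i)\<bar> < t\<close> bias have
          "\<bar>real_of_int (partial_sum x k) + real k * (m n / real n)\<bar> < t + e / 4 * m n" by linarith
        also have "\<dots> < e * m n" using \<open>m n > 0\<close> e by (simp add: t_def)
        finally show False using 1 by simp
      qed
      have gmeas: "{x. \<bar>\<Sum>i<k. g (x i)\<bar> \<ge> t} \<in> sets S"
      proof (rule sets_determined[of k], rule determined_by_prefixI)
        fix x y :: "nat \<Rightarrow> int" assume "\<And>i. i < k \<Longrightarrow> x i = y i"
        hence "(\<Sum>i<k. g (x i)) = (\<Sum>i<k. g (y i))" by (intro sum.cong) auto
        thus "x \<in> {x. \<bar>\<Sum>i<k. g (x i)\<bar> \<ge> t} \<Longrightarrow> y \<in> {x. \<bar>\<Sum>i<k. g (x i)\<bar> \<ge> t}" by simp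
      qed
      have cmeas: "{x. x i \<in> {l. real_of_int l \<ge> A}} \<in> sets S" for i
        by (rule sets_determined[of "Suc i"], rule determined_by_prefixI) auto
      have "P.prob {x. \<bar>real_of_int (partial_sum x k) + real k * (m n / real n)\<bar> \<ge> e * m n}
        \<le> P.prob ((\<Union>i<k. {x. x i \<in> {l. real_of_int l \<ge> A}}) \<union> {x. \<bar>\<Sum>i<k. g (x i)\<bar> \<ge> t})"
        using gmeas cmeas by (intro P.finite_measure_mono sub sets.Un sets.finite_UN) auto
      also have "\<dots> \<le> P.prob (\<Union>i<k. {x. x i \<in> {l. real_of_int l \<ge> A}}) + P.prob {x. \<bar>\<Sum>i<k. g (x i)\<bar> \<ge> t}"
        using gmeas cmeas by (intro measure_Un_le sets.finite_UN) auto
      also have "\<dots> \<le> (\<Sum>i<k. P.prob {x. x i \<in> {l. real_of_int l \<ge> A}}) +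
          real k * measure_pmf.expectation p (\<lambda>k. (g k)\<^sup>2) / t\<^sup>2"
        using cmeas by (intro add_mono measure_UNION_le Chebyshev_sum g t) auto
      also have "(\<Sum>i<k. P.prob {x. x i \<in> {l. real_of_int l \<ge> A}}) = real k * tail A"
        unfolding prob_coordinate by (simp add: tail_def)
      also have "real k * tail A \<le> real n * tail A"
        using k by (intro mult_right_mono) auto
      also have "real n * tail A \<le> h / 2" using elim by (simp add: A_def)
      also have "real k * measure_pmf.expectation p (\<lambda>k. (g k)\<^sup>2) / t\<^sup>2 \<le> h / 2"
      proof -
        have "real k * measure_pmf.expectation p (\<lambda>k. (g k)\<^sup>2) \<le> real n * truncated_moment2 A"
          using k g2 by (intro mult_mono) auto
        also have "\<dots> \<le> real n * (C1 * (A\<^sup>2 * tail A))"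
          using elim by (intro mult_left_mono) (auto simp: A_def)
        also have "\<dots> = C1 * A\<^sup>2 * (real n * tail A)" by simp
        also have "\<dots> \<le> C1 * A\<^sup>2 * 2"
          using elim C1 by (intro mult_left_mono) (auto simp: A_def)
        also have "\<dots> = h / 2 * ((e / 2)\<^sup>2 * (K1 * a n)\<^sup>2)"
          unfolding power_mult_distrib K1(2) using h e by (simp add: A_def field_simps power_mult_distrib)
        also have "\<dots> \<le> h / 2 * ((e / 2)\<^sup>2 * (m n)\<^sup>2)"
          using elim h K1 by (intro mult_left_mono power_mono) auto
        also have "\<dots> = h / 2 * t\<^sup>2" unfolding t_def power_mult_distrib ..
        finally show ?thesis using t by (simp add: divide_le_eq)
      qed
      finally show "P.prob {x. \<bar>real_of_int (partial_sum x k) + real k * (m n / real n)\<bar> \<ge> e * m n} \<le> h"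
        by simp
    qed
  qed
qed

text \<open>The drift is nonpositive, so reaching a positive multiple of \<open>m n\<close> is a
  deviation in the weak law.\<close>

lemma prob_walk_high:
  assumes e: "e > 0" and h: "h > 0"
  shows "eventually (\<lambda>n. \<forall>k\<le>n. P.prob {x. real_of_int (partial_sum x k) \<ge> e * m n} \<le> h) sequentially"
  using weak_law[OF e h] m_pos
proof eventually_elim
  case (elim n)
  show ?case
  proof (intro allI impI)
    fix k assume "k \<le> n"
    have "P.prob {x. real_of_int (partial_sum x k) \<ge> e * m n}
      \<le> P.prob {x. \<bar>real_of_int (partial_sum x k) + real k * (m n / real n)\<bar> \<ge> e * m n}"
    proof (rule P.finite_measure_mono)
      have "0 \<le> real k * (m n / real n)" using elim by simp
      thus "{x. real_of_int (partial_sum x k) \<ge> e * m n}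
        \<subseteq> {x. \<bar>real_of_int (partial_sum x k) + real k * (m n / real n)\<bar> \<ge> e * m n}"
        using abs_ge_self order_trans by (fastforce intro: order_trans[OF _ abs_ge_self])
    qed (rule sets_partial_sum)
    with elim \<open>k \<le> n\<close> show "P.prob {x. real_of_int (partial_sum x k) \<ge> e * m n} \<le> h" by force
  qed
qed

text \<open>Decomposition at the first passage below the level: from there the walk does not climb back
  with probability at least 1/2, while the walk at time \<open>k\<close> is unlikely to be that low.\<close>
lemma prob_walk_low:
  assumes r: "r \<ge> 0" and e: "e > 0" and h: "h > 0"
  shows "eventually (\<lambda>n. \<forall>k\<le>n. real k \<le> r * real n \<longrightarrow>
    P.prob {x. \<exists>i\<le>k. real_of_int (partial_sum x i) < - (r + e) * m n} \<le> h) sequentially"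
proof -
  have abs_ge: "v \<le> \<bar>u\<bar>" if "u \<le> - v" for u v :: real using that by linarith
  have e2: "e / 2 > 0" and h2: "h / 2 > 0" and half: "(1 / 2 :: real) > 0" using e h by auto
  show ?thesis
    using weak_law[OF e2 h2] prob_walk_high[OF e2 half] m_pos eventually_gt_at_top[of 0]
  proof eventually_elim
    case (elim n)
    show ?case
    proof (intro allI impI)
      fix k assume k: "k \<le> n" "real k \<le> r * real n"
      define l where "l = - (r + e) * m n"
      define A where "A = (\<lambda>j. {x. real_of_int (partial_sum x j) < l \<and> (\<forall>i<j. \<not> real_of_int (partial_sum x i) < l)})"
      define B where "B = (\<lambda>j. {x. \<not> real_of_int (partial_sum x (k - j)) \<ge> e / 2 * m n})"
      have A: "determined_by_prefix j (A j)" for j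
        unfolding A_def by (rule determined_by_walkI) auto
      have B: "B j \<in> sets S" for j unfolding B_def by (rule sets_partial_sum)
      have disj: "disjoint_family_on A {..k}"
        unfolding disjoint_family_on_def A_def by (auto, metis linorder_neqE_nat)
      have UA: "(\<Union>j\<in>{..k}. A j) = {x. \<exists>i\<le>k. real_of_int (partial_sum x i) < l}"
      proof (intro equalityI subsetI)
        fix x assume "x \<in> {x. \<exists>i\<le>k. real_of_int (partial_sum x i) < l}"
        then obtain i where "i \<le> k" "real_of_int (partial_sum x i) < l" by auto
        with LeastI[of "\<lambda>i. real_of_int (partial_sum x i) < l" i]
          Least_le[of "\<lambda>i. real_of_int (partial_sum x i) < l" i]
          not_less_Least[of _ "\<lambda>i. real_of_int (partial_sum x i) < l"]
        show "x \<in> (\<Union>j\<in>{..k}. A j)"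
          by (auto simp: A_def intro!: bexI[of _ "LEAST i. real_of_int (partial_sum x i) < l"])
      qed (auto simp: A_def)
      have "1 / 2 \<le> P.prob (B j)" if "j \<in> {..k}" for j
      proof -
        have "P.prob {x. real_of_int (partial_sum x (k - j)) \<ge> e / 2 * m n} \<le> 1 / 2"
          using elim k by simp
        moreover have "B j = space S - {x. real_of_int (partial_sum x (k - j)) \<ge> e / 2 * m n}"
          by (auto simp: B_def)
        ultimately show ?thesis
          using P.prob_compl[OF sets_partial_sum[of "\<lambda>w. real_of_int w \<ge> e / 2 * m n" "k - j"]] by simp
      qed
      hence "P.prob (\<Union>j\<in>{..k}. A j) * (1 / 2) \<le> P.prob (\<Union>j\<in>{..k}. A j \<inter> {x. shift_seq j x \<in> B j})"
        by (intro prob_prefix_shift_UN_ge disj A B) auto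
      \<comment> \<open>The path ends below \<open>l + e / 2 * m n\<close>, of which
        \<open>k\<close> steps of drift explain at most \<open>r * m n\<close>; a deviation of
        \<open>e / 2 * m n\<close> remains.\<close>
      also have "\<dots> \<le> P.prob {x. \<bar>real_of_int (partial_sum x k) + real k * (m n / real n)\<bar> \<ge> e / 2 * m n}"
      proof (intro P.finite_measure_mono sets_partial_sum subsetI)
        fix x assume "x \<in> (\<Union>j\<in>{..k}. A j \<inter> {x. shift_seq j x \<in> B j})"
        then obtain j where j: "j \<le> k" "real_of_int (partial_sum x j) < l"
          "\<not> real_of_int (partial_sum (shift_seq j x) (k - j)) \<ge> e / 2 * m n"
          by (auto simp: A_def B_def)
        hence "real_of_int (partial_sum x k) < l + e / 2 * m n"
          by (simp add: partial_sum_shift_seq)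
        moreover have "real k * (m n / real n) \<le> r * m n"
        proof -
          have "real k * (m n / real n) \<le> (r * real n) * (m n / real n)"
            using k elim by (intro mult_right_mono) auto
          thus ?thesis using elim by simp
        qed
        ultimately have "real_of_int (partial_sum x k) + real k * (m n / real n) \<le> - (e / 2 * m n)"
          by (simp add: l_def algebra_simps)
        thus "x \<in> {x. \<bar>real_of_int (partial_sum x k) + real k * (m n / real n)\<bar> \<ge> e / 2 * m n}"
          unfolding mem_Collect_eq by (rule abs_ge)
      qed
      also have "\<dots> \<le> h / 2" using elim k by simp
      finally show "P.prob {x. \<exists>i\<le>k. real_of_int (partial_sum x i) < - (r + e) * m n} \<le> h"
        unfolding UA l_def by simp
    qed
  qed
qed

end

section \<open>Survival and big jumps\<close>

text \<open>This is the event \<open>\<zeta> \<ge> j\<close>. Its last constraint is at time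
  \<open>j - 1\<close>, so it does not involve the step \<open>X\<^sub>j\<close>.\<close>

definition nonneg_before :: "nat \<Rightarrow> (nat \<Rightarrow> int) set" where
  "nonneg_before j = {x. \<forall>i<j. partial_sum x i \<ge> 0}"

context iid_steps
begin

text \<open>In the notation of the overview, \<open>survival\<close>, \<open>survival_sum\<close>
  and \<open>stays_negative\<close> are \<open>p\<close>, \<open>U\<close> and
  \<open>q\<close>.\<close>

definition survival :: "nat \<Rightarrow> real" where
  "survival j = P.prob (nonneg_before j)"

definition survival_sum :: "nat \<Rightarrow> real" where
  "survival_sum n = (\<Sum>i<n. survival (Suc i))"

definition stays_negative :: "nat \<Rightarrow> real" where
  "stays_negative k = P.prob {x. \<forall>i. 1 \<le> i \<and> i \<le> k \<longrightarrow> partial_sum x i < 0}"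

lemma determined_nonneg_before: "determined_by_prefix j (nonneg_before j)"
  unfolding nonneg_before_def by (rule determined_by_walkI) auto

text \<open>This index shift makes the step \<open>x j\<close> independent of survival before it, so
  that \<open>survival (Suc j)\<close> factors out of big jump probabilities.\<close>

lemma determined_nonneg_before_Suc: "determined_by_prefix j (nonneg_before (Suc j))"
  unfolding nonneg_before_def by (rule determined_by_walkI) auto

lemma sets_nonneg_before: "nonneg_before j \<in> sets S"
  using sets_determined[OF determined_nonneg_before] .

lemma determined_steps:
  "i \<le> k \<Longrightarrow> determined_by_prefix k {x. \<forall>l<i. P (x l)}"
  "i < k \<Longrightarrow> determined_by_prefix k {x. P (x i)}"
  "i \<le> k \<Longrightarrow> determined_by_prefix k {x. \<exists>l<i. P (x l)}"
  by (rule determined_by_prefixI; auto)+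

lemma determined_Int:
  "determined_by_prefix k A \<Longrightarrow> determined_by_prefix k B \<Longrightarrow> determined_by_prefix k (A \<inter> B)"
  unfolding determined_by_prefix_def by blast

lemma sets_steps:
  "{x. \<forall>l<i. P (x l)} \<in> sets S" "{x. P (x i)} \<in> sets S" "{x. \<exists>l<i. P (x l)} \<in> sets S"
  using sets_determined determined_steps[of i i P] determined_steps(2)[of i "Suc i" P] by auto

lemma nonneg_before_antimono: "i \<le> j \<Longrightarrow> nonneg_before j \<subseteq> nonneg_before i"
  unfolding nonneg_before_def by auto

lemma survival_antimono: "i \<le> j \<Longrightarrow> survival j \<le> survival i"
  unfolding survival_def by (intro P.finite_measure_mono nonneg_before_antimono sets_nonneg_before)

lemma survival_nonneg [simp]: "survival j \<ge> 0"
  by (simp add: survival_def)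

lemma survival_le_1 [simp]: "survival j \<le> 1"
  by (simp add: survival_def)

lemma prob_UNIV: "P.prob UNIV = 1"
  using P.prob_space unfolding space_S .

lemma survival_1 [simp]: "survival (Suc 0) = 1"
proof -
  have "nonneg_before (Suc 0) = UNIV" by (auto simp: nonneg_before_def)
  thus ?thesis by (simp add: survival_def prob_UNIV)
qed

lemma survival_sum_mono: "i \<le> j \<Longrightarrow> survival_sum i \<le> survival_sum j"
  unfolding survival_sum_def by (intro sum_mono2) auto

lemma survival_sum_ge_1: "n > 0 \<Longrightarrow> survival_sum n \<ge> 1"
  using survival_sum_mono[of "Suc 0" n] by (simp add: survival_sum_def)

lemma survival_sum_nonneg [simp]: "survival_sum n \<ge> 0"
  by (simp add: survival_sum_def sum_nonneg)

lemma survival_sum_le: "survival_sum n \<le> real n"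
  unfolding survival_sum_def using sum_bounded_above[of "{..<n}" "\<lambda>i. survival (Suc i)" 1] by simp

section \<open>Big jumps of the surviving walk\<close>

lemma prob_determined_step:
  assumes "determined_by_prefix i A"
  shows "P.prob (A \<inter> {x. x i \<in> B}) = P.prob A * measure_pmf.prob p B"
proof -
  have "{x. x i \<in> B} = {x. shift_seq i x \<in> {x. x 0 \<in> B}}" by (simp add: shift_seq_def)
  thus ?thesis
    using prob_prefix_shift[OF assms, of "{x. x 0 \<in> B}"] sets_steps(2)[of "\<lambda>k. k \<in> B" 0]
    by (simp add: prob_coordinate)
qed

text \<open>A union bound over the time of the step: survival up to that time is independent of the
  size of the step, and survival afterwards is dropped.\<close>

lemma prob_nonneg_step_le:
  "P.prob (nonneg_before n \<inter> {x. \<exists>i<n. x i \<in> B}) \<le> survival_sum n * measure_pmf.prob p B"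
proof -
  have "P.prob (nonneg_before n \<inter> {x. \<exists>i<n. x i \<in> B})
    \<le> P.prob (\<Union>i\<in>{..<n}. nonneg_before (Suc i) \<inter> {x. x i \<in> B})"
  proof (rule P.finite_measure_mono)
    show "nonneg_before n \<inter> {x. \<exists>i<n. x i \<in> B} \<subseteq> (\<Union>i\<in>{..<n}. nonneg_before (Suc i) \<inter> {x. x i \<in> B})"
      using nonneg_before_antimono[OF Suc_leI] by blast
    show "(\<Union>i\<in>{..<n}. nonneg_before (Suc i) \<inter> {x. x i \<in> B}) \<in> sets S"
      using sets_nonneg_before sets_steps by (intro sets.finite_UN sets.Int) auto
  qed
  also have "\<dots> \<le> (\<Sum>i<n. P.prob (nonneg_before (Suc i) \<inter> {x. x i \<in> B}))"
    using sets_nonneg_before sets_steps by (intro measure_UNION_le sets.Int) auto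
  also have "\<dots> = survival_sum n * measure_pmf.prob p B"
    unfolding prob_determined_step[OF determined_nonneg_before_Suc]
    by (simp add: survival_sum_def survival_def sum_distrib_right)
  finally show ?thesis .
qed

text \<open>The walk survives if its first jump above \<open>M\<close> is at least \<open>R\<close>, occurs before it gets
  negative, and is not used up afterwards.\<close>
lemma survival_ge:
  assumes "M \<le> R"
  shows "survival_sum n * (1 - real n * tail M) * tail R *
      P.prob {x. \<forall>l\<le>n. real_of_int (partial_sum x l) \<ge> - R} \<le> survival n"
proof -
  define N where "N = (\<lambda>i. nonneg_before (Suc i) \<inter> {x. \<forall>l<i. x l \<in> {k. real_of_int k < M}})"
  \<comment> \<open>\<open>A j\<close> says that the walk survives until its first step of size at
    least \<open>M\<close>, that this is the \<open>j\<close>-th step, and that it is at least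
    \<open>R\<close>. These events are disjoint because \<open>M \<le> R\<close>.\<close>
  define A where "A = (\<lambda>j. N (j - 1) \<inter> {x. x (j - 1) \<in> {k. real_of_int k \<ge> R}})"
  define B where "B = {x. \<forall>l\<le>n. real_of_int (partial_sum x l) \<ge> - R}"
  have N: "determined_by_prefix i (N i)" for i
    unfolding N_def by (intro determined_Int determined_nonneg_before_Suc determined_steps) simp
  have A: "determined_by_prefix j (A j)" if "j \<in> {1..n}" for j
    unfolding A_def using that N[of "j - 1"]
    by (intro determined_Int determined_steps) (auto simp: determined_by_prefix_def)
  have B: "B \<in> sets S"
    unfolding B_def by (rule sets_determined[of n], rule determined_by_walkI) auto
  have disj: "disjoint_family_on A {1..n}"
    unfolding disjoint_family_on_def
  proof (intro ballI impI)
    fix i j :: nat assume ij: "i \<in> {1..n}" "j \<in> {1..n}" "i \<noteq> j"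
    have *: "A i \<inter> A j = {}" if "i < j" "i \<ge> 1" for i j
    proof -
      have "i - 1 < j - 1" using that by simp
      thus ?thesis using assms by (fastforce simp: A_def N_def)
    qed
    show "A i \<inter> A j = {}" using *[of i j] *[of j i] ij by (cases "i < j") (auto simp: Int_commute)
  qed
  \<comment> \<open>Discarding the surviving paths with a step of size at least \<open>M\<close>
    costs at most \<open>survival_sum n * tail M\<close> for each of the \<open>n\<close>
    times.\<close>
  have Ni: "P.prob (N i) \<ge> survival (Suc i) - survival_sum n * tail M" if "i < n" for i
  proof -
    have "survival (Suc i) \<le> P.prob (N i \<union> (nonneg_before (Suc i) \<inter> {x. \<exists>l<Suc i. x l \<in> {k. real_of_int k \<ge> M}}))"
      unfolding survival_def
      by (intro P.finite_measure_mono sets.Un sets_determined[OF N] sets.Int sets_nonneg_before sets_steps)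
         (auto simp: N_def not_less intro: less_SucI)
    also have "\<dots> \<le> P.prob (N i) + P.prob (nonneg_before (Suc i) \<inter> {x. \<exists>l<Suc i. x l \<in> {k. real_of_int k \<ge> M}})"
      by (intro measure_Un_le sets_determined[OF N] sets.Int sets_nonneg_before sets_steps)
    also have "P.prob (nonneg_before (Suc i) \<inter> {x. \<exists>l<Suc i. x l \<in> {k. real_of_int k \<ge> M}})
        \<le> survival_sum (Suc i) * tail M"
      unfolding tail_def by (rule prob_nonneg_step_le)
    also have "\<dots> \<le> survival_sum n * tail M"
      using that by (intro mult_right_mono survival_sum_mono) auto
    finally show ?thesis by simp
  qed
  have "survival_sum n * (1 - real n * tail M) = (\<Sum>i<n. survival (Suc i) - survival_sum n * tail M)"
    by (simp add: survival_sum_def sum_subtractf algebra_simps)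
  also have "\<dots> \<le> (\<Sum>i<n. P.prob (N i))" using Ni by (intro sum_mono) auto
  finally have "survival_sum n * (1 - real n * tail M) * tail R * P.prob B
      \<le> (\<Sum>i<n. P.prob (N i)) * tail R * P.prob B"
    by (intro mult_right_mono) auto
  also have "\<dots> = (\<Sum>j\<in>{1..n}. P.prob (N (j - 1)) * tail R * P.prob B)"
    unfolding sum_distrib_right
    by (rule sum.reindex_bij_witness[of _ "\<lambda>j. j - 1" Suc]) auto
  also have "\<dots> = (\<Sum>j\<in>{1..n}. P.prob (A j) * P.prob B)"
    unfolding A_def tail_def prob_determined_step[OF N] ..
  also have "\<dots> = P.prob (\<Union>j\<in>{1..n}. A j \<inter> {x. shift_seq j x \<in> B})"
    using A B disj by (intro prob_prefix_shift_UN[symmetric]) auto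
  also have "\<dots> \<le> survival n"
    unfolding survival_def
  proof (intro P.finite_measure_mono sets_nonneg_before subsetI)
    fix x assume "x \<in> (\<Union>j\<in>{1..n}. A j \<inter> {x. shift_seq j x \<in> B})"
    then obtain j where j: "1 \<le> j" "j \<le> n" "x \<in> A j" "shift_seq j x \<in> B" by auto
    hence x: "\<And>i. i < j \<Longrightarrow> partial_sum x i \<ge> 0" "real_of_int (x (j - 1)) \<ge> R"
      by (auto simp: A_def N_def nonneg_before_def)
    have "partial_sum x j = partial_sum x (j - 1) + x (j - 1)"
      using partial_sum_Suc[of x "j - 1"] j by simp
    moreover have "partial_sum x (j - 1) \<ge> 0" using x(1)[of "j - 1"] j by simp
    ultimately have xj: "real_of_int (partial_sum x j) \<ge> R" using x(2) by linarith
    have "partial_sum x i \<ge> 0" if "i < n" for i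
    proof (cases "i < j")
      case False
      have "real_of_int (partial_sum (shift_seq j x) (i - j)) \<ge> - R"
        using j(4) that by (auto simp: B_def)
      with False xj show ?thesis by (simp add: partial_sum_shift_seq)
    qed (use x in auto)
    thus "x \<in> nonneg_before n" by (simp add: nonneg_before_def)
  qed
  finally show ?thesis by (simp add: B_def)
qed

text \<open>Before \<open>t\<close> the path is at most its value at \<open>t\<close>, which is
  survival after time reversal; the path restarted at \<open>t\<close> stays negative. The two parts
  are independent.\<close>

lemma prob_last_weak_ladder_time:
  assumes t: "t \<le> n"
  shows "P.prob {x. last_weak_ladder_time n (\<lambda>i. real_of_int (partial_sum x i)) = t}
    = survival (Suc t) * stays_negative (n - t)"
proof -
  define A where "A = {x. \<forall>s\<le>t. partial_sum x s \<le> partial_sum x t}"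
  define B where "B = {x. \<forall>i. 1 \<le> i \<and> i \<le> n - t \<longrightarrow> partial_sum x i < 0}"
  have A: "determined_by_prefix t A"
    unfolding A_def by (rule determined_by_walkI) auto
  have B: "B \<in> sets S"
    unfolding B_def by (rule sets_determined[of "n - t"], rule determined_by_walkI) auto
  have "{x. last_weak_ladder_time n (\<lambda>i. real_of_int (partial_sum x i)) = t} = A \<inter> {x. shift_seq t x \<in> B}"
  proof -
    have "(\<forall>s. t < s \<and> s \<le> n \<longrightarrow> partial_sum x s < partial_sum x t) \<longleftrightarrow>
      (\<forall>i. 1 \<le> i \<and> i \<le> n - t \<longrightarrow> partial_sum x (i + t) < partial_sum x t)" for x
    proof (intro iffI allI impI, goal_cases)
      case (2 s)
      from 2(1)[rule_format, of "s - t"] 2(2) show ?case by (auto simp: diff_le_mono)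
    qed (use t in auto)
    thus ?thesis
      unfolding last_weak_ladder_time_eq_iff[OF t] A_def B_def by (auto simp: partial_sum_shift_seq)
  qed
  moreover have "P.prob A = survival (Suc t)"
  proof -
    have "(\<forall>s\<le>t. partial_sum x s \<le> partial_sum x t) \<longleftrightarrow> (\<forall>i\<le>t. partial_sum x (t - i) \<le> partial_sum x t)" for x
      by (metis diff_diff_cancel diff_le_self)
    hence "A = {x. reverse_prefix t x \<in> nonneg_before (Suc t)}"
      unfolding A_def nonneg_before_def by (auto simp: partial_sum_reverse_prefix less_Suc_eq_le)
    thus ?thesis using prob_reverse_prefix[OF sets_nonneg_before] by (simp add: survival_def)
  qed
  ultimately show ?thesis
    using prob_prefix_shift[OF A B] by (simp add: stays_negative_def B_def)
qed

text \<open>The law of the last weak ladder time has total mass 1.\<close>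

lemma sum_survival_stays_negative:
  "(\<Sum>t\<le>n. survival (Suc t) * stays_negative (n - t)) = 1"
proof -
  let ?L = "\<lambda>x. last_weak_ladder_time n (\<lambda>i. real_of_int (partial_sum x i))"
  have sets: "{x. ?L x = t} \<in> sets S" if "t \<le> n" for t
    unfolding last_weak_ladder_time_eq_iff[OF that]
    by (rule sets_determined[of n], rule determined_by_walkI) (use that in auto)
  have "(\<Sum>t\<le>n. survival (Suc t) * stays_negative (n - t)) = (\<Sum>t\<in>{..n}. P.prob {x. ?L x = t})"
    by (intro sum.cong) (auto simp: prob_last_weak_ladder_time)
  also have "\<dots> = P.prob (\<Union>t\<in>{..n}. {x. ?L x = t})"
    using sets by (intro P.finite_measure_finite_Union[symmetric]) (auto simp: disjoint_family_on_def)
  also have "(\<Union>t\<in>{..n}. {x. ?L x = t}) = UNIV"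
    using last_weak_ladder_time_le by auto
  finally show ?thesis by (simp add: prob_UNIV)
qed

section \<open>Bounds drawn from the ladder time identity\<close>

lemma stays_negative_nonneg [simp]: "stays_negative k \<ge> 0"
  by (simp add: stays_negative_def)

lemma stays_negative_le_1: "stays_negative k \<le> 1"
  by (simp add: stays_negative_def)

lemma stays_negative_antimono:
  assumes "k \<le> l"
  shows "stays_negative l \<le> stays_negative k"
  unfolding stays_negative_def
proof (rule P.finite_measure_mono)
  show "{x. \<forall>i. 1 \<le> i \<and> i \<le> k \<longrightarrow> partial_sum x i < 0} \<in> sets S"
    by (rule sets_determined[of k], rule determined_by_walkI) auto
qed (use assms in auto)

text \<open>Every factor \<open>stays_negative (n - t)\<close> of the ladder time identity is at
  least \<open>stays_negative n\<close>.\<close>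

lemma stays_negative_le_inverse: "stays_negative n * survival_sum (Suc n) \<le> 1"
proof -
  have "stays_negative n * survival_sum (Suc n) = (\<Sum>t\<le>n. survival (Suc t) * stays_negative n)"
    unfolding survival_sum_def lessThan_Suc_atMost by (simp add: sum_distrib_left mult.commute)
  also have "\<dots> \<le> (\<Sum>t\<le>n. survival (Suc t) * stays_negative (n - t))"
    by (intro sum_mono mult_left_mono stays_negative_antimono) auto
  finally show ?thesis by (simp add: sum_survival_stays_negative)
qed

text \<open>The ladder time identity at \<open>2 * n - 1\<close> has two halves of \<open>n\<close>
  terms. In the first, \<open>stays_negative\<close> has an index at least \<open>n\<close>; in the
  second, \<open>survival\<close> has an index above \<open>n\<close> while those of
  \<open>stays_negative\<close> run through \<open>{..<n}\<close>.\<close>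

lemma survival_stays_negative_lower:
  assumes "n > 0"
  shows "1 \<le> stays_negative n * survival_sum n + survival n * (\<Sum>l<n. stays_negative l)"
proof -
  have "1 = (\<Sum>t\<le>2 * n - 1. survival (Suc t) * stays_negative (2 * n - 1 - t))"
    by (rule sum_survival_stays_negative[symmetric])
  also have "{..2 * n - 1} = {..<n} \<union> {n..<2 * n}" using assms by auto
  also have "(\<Sum>t\<in>{..<n} \<union> {n..<2 * n}. survival (Suc t) * stays_negative (2 * n - 1 - t))
    = (\<Sum>t<n. survival (Suc t) * stays_negative (2 * n - 1 - t)) +
      (\<Sum>t\<in>{n..<2 * n}. survival (Suc t) * stays_negative (2 * n - 1 - t))"
    by (intro sum.union_disjoint) auto
  also have "(\<Sum>t<n. survival (Suc t) * stays_negative (2 * n - 1 - t)) \<le> (\<Sum>t<n. survival (Suc t) * stays_negative n)"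
    by (intro sum_mono mult_left_mono stays_negative_antimono) auto
  also have "\<dots> = stays_negative n * survival_sum n"
    by (simp add: survival_sum_def sum_distrib_left mult.commute)
  also have "(\<Sum>t\<in>{n..<2 * n}. survival (Suc t) * stays_negative (2 * n - 1 - t))
     \<le> (\<Sum>t\<in>{n..<2 * n}. survival n * stays_negative (2 * n - 1 - t))"
    by (intro sum_mono mult_right_mono survival_antimono) auto
  also have "\<dots> = (\<Sum>l<n. survival n * stays_negative l)"
    by (rule sum.reindex_bij_witness[of _ "\<lambda>l. 2 * n - 1 - l" "\<lambda>t. 2 * n - 1 - t"]) auto
  finally show ?thesis by (simp add: sum_distrib_left)
qed

end

section \<open>Asymptotics of the survival probability\<close>

context cauchy_walk
begin

text \<open>Let \<open>K = n div d\<close>. If the walk is at most \<open>(1 - e / 2) * m n\<close>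
  at time \<open>K\<close>, staying nonnegative until the end defies a drift close to
  \<open>- m n\<close>. If it is higher, it has passed the low level \<open>lv\<close> by a step
  below \<open>(1 - e) * m n\<close> and must then climb by \<open>e / 4 * m n\<close> until
  \<open>K\<close>, which is unlikely too. Both cases begin with an event of probability at most
  \<open>2 * survival K\<close>, since from \<open>lv\<close> the walk survives until
  \<open>K\<close> with probability at least 1/2.\<close>

lemma prob_nonneg_small_steps_le:
  assumes e: "e > 0" "e < 1" and d: "real d \<ge> 8 / e" and h: "h > 0"
  shows "eventually (\<lambda>n. P.prob (nonneg_before n \<inter> {x. \<forall>i<n. real_of_int (x i) < (1 - e) * m n})
    \<le> h * survival (n div d)) sequentially"
proof -
  have e8: "8 / e > 8" using e by (simp add: less_divide_eq)
  with d have d8: "real d > 8" by linarith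
  have "8 \<le> e * real d" using d e by (simp add: divide_le_eq mult.commute)
  hence d1: "1 / real d \<le> e / 8" "1 / real d > 0" using d8 by (auto simp: divide_le_eq)
  \<comment> \<open>One third of \<open>h\<close> is spent on \<open>E1\<close>, two thirds on
    \<open>E2\<close>.\<close>
  define h1 where "h1 = h / 3"
  have h1: "h1 > 0" using h by (simp add: h1_def)
  have e4: "e / 4 > 0" using e by simp
  have half: "(1 / 2 :: real) > 0" by simp
  have "eventually (\<lambda>n. real n > 8 / e) sequentially"
    using filterlim_real_sequentially by (simp add: filterlim_at_top_dense)
  with weak_law[OF e4 h1] prob_walk_high[OF e4 h1] prob_walk_low[OF less_imp_le[OF d1(2)] d1(2) half] m_pos
  show ?thesis
  proof eventually_elim
    case (elim n)
    have mp: "m n > 0" by fact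
    define K where "K = n div d"
    have n8: "real n > 8" using elim(5) e8 by linarith
    have "8 \<le> e * real n" using elim(5) e by (simp add: divide_less_eq mult.commute)
    hence n1: "1 / real n \<le> e / 8" using n8 by (auto simp: divide_le_eq)
    have K: "K \<le> n - 1" "K \<le> n" "real K \<le> 1 / real d * real n"
    proof -
      show "real K \<le> 1 / real d * real n"
        unfolding K_def using of_nat_div_le_of_nat[of n d, where 'a = real] by simp
      have "K < n" unfolding K_def using d8 n8 by (intro div_less_dividend) auto
      thus "K \<le> n - 1" "K \<le> n" by auto
    qed
    \<comment> \<open>Twice the bound \<open>m n / d\<close> on the drift over \<open>K\<close>
      steps: high enough to stay nonnegative until \<open>K\<close> with probability at least 1/2,
      yet at most \<open>e / 4 * m n\<close> because \<open>d \<ge> 8 / e\<close>.\<close>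
    define lv where "lv = 2 / real d * m n"
    have lv: "lv > 0" "lv \<le> e / 4 * m n"
    proof -
      show "lv > 0" using mp d8 by (simp add: lv_def)
      have "lv = 2 * (1 / real d) * m n" by (simp add: lv_def)
      also have "\<dots> \<le> e / 4 * m n" using d1 mp by (intro mult_right_mono) auto
      finally show "lv \<le> e / 4 * m n" .
    qed
    define E where "E = nonneg_before n \<inter> {x. \<forall>i<n. real_of_int (x i) < (1 - e) * m n}"
    \<comment> \<open>\<open>nonneg_before n\<close> constrains the walk up to time
      \<open>n - 1\<close>, so \<open>n - 1 - K\<close> steps remain after \<open>K\<close>.\<close>
    define B1 where "B1 = {x. real_of_int (partial_sum x (n - 1 - K)) \<ge> - (1 - e / 2) * m n}"
    define E1 where "E1 = nonneg_before K \<inter> {x. shift_seq K x \<in> B1}"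
    define A where "A = (\<lambda>j. {x. real_of_int (partial_sum x j) \<ge> lv \<and> real_of_int (partial_sum x j) < lv + (1 - e) * m n
      \<and> (\<forall>i<j. real_of_int (partial_sum x i) < lv \<and> partial_sum x i \<ge> 0)})"
    define B2 where "B2 = (\<lambda>j. {x. real_of_int (partial_sum x (K - j)) \<ge> e / 4 * m n})"
    define B3 where "B3 = {x. \<not> (\<exists>i\<le>K. real_of_int (partial_sum x i) < - lv)}"
    define E2 where "E2 = (\<Union>j\<in>{..K}. A j \<inter> {x. shift_seq j x \<in> B2 j})"
    have sB1: "B1 \<in> sets S" unfolding B1_def by (rule sets_partial_sum)
    have sB2: "B2 j \<in> sets S" for j unfolding B2_def by (rule sets_partial_sum)
    have sB3': "{x. \<exists>i\<le>K. real_of_int (partial_sum x i) < - lv} \<in> sets S"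
      by (rule sets_determined[of K], rule determined_by_walkI) auto
    have B3_eq: "B3 = space S - {x. \<exists>i\<le>K. real_of_int (partial_sum x i) < - lv}"
      by (auto simp: B3_def)
    have sB3: "B3 \<in> sets S" unfolding B3_eq using sB3' by blast
    have A: "determined_by_prefix j (A j)" for j
      unfolding A_def by (rule determined_by_walkI) auto
    have disj: "disjoint_family_on A {..K}"
      unfolding disjoint_family_on_def A_def by (auto simp: not_less, metis linorder_neqE_nat not_less)
    have E_sub: "E \<subseteq> E1 \<union> E2"
    proof
      fix x assume "x \<in> E"
      hence x: "\<And>i. i < n \<Longrightarrow> partial_sum x i \<ge> 0" "\<And>i. i < n \<Longrightarrow> real_of_int (x i) < (1 - e) * m n"
        by (auto simp: E_def nonneg_before_def)
      show "x \<in> E1 \<union> E2"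
      proof (cases "real_of_int (partial_sum x K) \<le> (1 - e / 2) * m n")
        case True
        have "partial_sum x (n - 1) \<ge> 0" using x(1)[of "n - 1"] n8 by simp
        hence "real_of_int (partial_sum x (n - 1)) - real_of_int (partial_sum x K) \<ge> - (1 - e / 2) * m n"
          using True by (simp add: algebra_simps)
        hence "shift_seq K x \<in> B1"
          unfolding B1_def mem_Collect_eq partial_sum_shift_seq of_int_diff using K(1) by (simp only: le_add_diff_inverse2)
        hence "x \<in> E1"
          using x(1) K(1) n8 by (auto simp: E1_def nonneg_before_def)
        thus ?thesis by blast
      next
        case False
        let ?P = "\<lambda>j. real_of_int (partial_sum x j) \<ge> lv"
        have PK: "?P K"
        proof -
          have "e / 4 * m n \<le> (1 - e / 2) * m n" using e mp by (intro mult_right_mono) auto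
          with False lv show ?thesis by linarith
        qed
        define j where "j = (LEAST j. ?P j)"
        have j: "?P j" "j \<le> K" "\<And>i. i < j \<Longrightarrow> \<not> ?P i"
          unfolding j_def using LeastI[of ?P, OF PK] Least_le[of ?P, OF PK] not_less_Least[of _ ?P] by auto
        have "j \<noteq> 0" using j(1) lv by (intro notI) simp
        then obtain l where l: "j = Suc l" by (cases j) auto
        have "real_of_int (partial_sum x l) < lv" "real_of_int (x l) < (1 - e) * m n"
          using j(2) j(3)[of l] x(2)[of l] K n8 by (auto simp: l)
        hence up: "real_of_int (partial_sum x j) < lv + (1 - e) * m n" by (simp add: l)
        hence "x \<in> A j" using j x(1) K n8 by (auto simp: A_def not_le)
        moreover have "shift_seq j x \<in> B2 j"
        proof -
          have "real_of_int (partial_sum x K) - real_of_int (partial_sum x j) \<ge> (1 - e / 2) * m n - (lv + (1 - e) * m n)"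
            using False up by (intro diff_mono) auto
          also have "(1 - e / 2) * m n - (lv + (1 - e) * m n) = e / 2 * m n - lv" by (simp add: algebra_simps)
          also have "e / 2 * m n - lv \<ge> e / 4 * m n" using lv(2) by simp
          finally show ?thesis using j(2) by (simp add: B2_def partial_sum_shift_seq)
        qed
        ultimately show ?thesis using j(2) by (auto simp: E2_def)
      qed
    qed
    have pB1: "P.prob B1 \<le> h1"
    proof -
      have "P.prob B1 \<le> P.prob {x. \<bar>real_of_int (partial_sum x (n - 1 - K)) + real (n - 1 - K) * (m n / real n)\<bar> \<ge> e / 4 * m n}"
      proof (intro P.finite_measure_mono sets_partial_sum subsetI)
        fix x assume "x \<in> B1"
        hence x: "real_of_int (partial_sum x (n - 1 - K)) \<ge> - (1 - e / 2) * m n" by (simp add: B1_def)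
        have "(1 - e / 4) * m n \<le> real (n - 1 - K) * (m n / real n)"
        proof -
          have "real (n - 1 - K) = real n - 1 - real K" using K n8 by simp
          also have "\<dots> \<ge> real n - 1 - 1 / real d * real n" using K by simp
          also have "real n - 1 - 1 / real d * real n = real n * (1 - 1 / real n - 1 / real d)"
            using n8 by (simp add: field_simps)
          also have "\<dots> \<ge> real n * (1 - e / 4)" using n1 d1 by (intro mult_left_mono) auto
          finally have "real n * (1 - e / 4) * (m n / real n) \<le> real (n - 1 - K) * (m n / real n)"
            using mp by (intro mult_right_mono) auto
          thus ?thesis using n8 by (simp add: mult_ac)
        qed
        with x have "- (1 - e / 2) * m n + (1 - e / 4) * m n
          \<le> real_of_int (partial_sum x (n - 1 - K)) + real (n - 1 - K) * (m n / real n)"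
          by (rule add_mono)
        moreover have "- (1 - e / 2) * m n + (1 - e / 4) * m n = e / 4 * m n"
          by (simp add: algebra_simps)
        ultimately have "e / 4 * m n \<le> real_of_int (partial_sum x (n - 1 - K)) + real (n - 1 - K) * (m n / real n)"
          by (simp only:)
        thus "x \<in> {x. \<bar>real_of_int (partial_sum x (n - 1 - K)) + real (n - 1 - K) * (m n / real n)\<bar> \<ge> e / 4 * m n}"
          unfolding mem_Collect_eq by (rule order_trans[OF _ abs_ge_self])
      qed
      also have "\<dots> \<le> h1" using elim(1) by simp
      finally show ?thesis .
    qed
    have pE1: "P.prob E1 \<le> survival K * h1"
      unfolding E1_def prob_prefix_shift[OF determined_nonneg_before sB1]
      using pB1 by (auto simp: survival_def intro!: mult_left_mono)
    \<comment> \<open>\<open>prob_walk_low\<close> with drift fraction and margin both equal to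
      \<open>1 / d\<close>; they add up to the level \<open>lv\<close>.\<close>
    have "P.prob {x. \<exists>i\<le>K. real_of_int (partial_sum x i) < - (1 / real d + 1 / real d) * m n} \<le> 1 / 2"
      using elim(3) K by blast
    hence pB3': "P.prob {x. \<exists>i\<le>K. real_of_int (partial_sum x i) < - lv} \<le> 1 / 2"
      by (simp add: lv_def)
    hence pB3: "P.prob B3 \<ge> 1 / 2"
      unfolding B3_eq P.prob_compl[OF sB3'] by simp
    have "P.prob (\<Union>j\<in>{..K}. A j) * (1 / 2) \<le> P.prob (\<Union>j\<in>{..K}. A j \<inter> {x. shift_seq j x \<in> B3})"
      using A disj sB3 pB3 by (intro prob_prefix_shift_UN_ge) auto
    also have "\<dots> \<le> survival K"
      unfolding survival_def
    proof (intro P.finite_measure_mono sets_nonneg_before subsetI)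
      fix x assume "x \<in> (\<Union>j\<in>{..K}. A j \<inter> {x. shift_seq j x \<in> B3})"
      then obtain j where j: "j \<le> K" "x \<in> A j" "shift_seq j x \<in> B3" by auto
      have "partial_sum x i \<ge> 0" if "i < K" for i
      proof (cases "i < j")
        case False
        have "real_of_int (partial_sum (shift_seq j x) (i - j)) \<ge> - lv"
          using j(3) that by (auto simp: B3_def not_less)
        moreover have "real_of_int (partial_sum x j) \<ge> lv" using j(2) by (simp add: A_def)
        ultimately show ?thesis using False by (simp add: partial_sum_shift_seq)
      qed (use j in \<open>auto simp: A_def\<close>)
      thus "x \<in> nonneg_before K" by (simp add: nonneg_before_def)
    qed
    finally have pA: "P.prob (\<Union>j\<in>{..K}. A j) \<le> 2 * survival K" by simp
    have "P.prob E2 \<le> P.prob (\<Union>j\<in>{..K}. A j) * h1"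
      unfolding E2_def using A disj sB2 elim(2) K by (intro prob_prefix_shift_UN_le) (auto simp: B2_def)
    also have "\<dots> \<le> 2 * survival K * h1" using pA h1 by (intro mult_right_mono) auto
    finally have pE2: "P.prob E2 \<le> 2 * survival K * h1" .
    have sE1: "E1 \<in> sets S" unfolding E1_def by (intro sets.Int sets_nonneg_before sets_shift sB1)
    have sE2: "E2 \<in> sets S" unfolding E2_def using A sB2 by (intro sets_prefix_shift_UN) auto
    have "P.prob E \<le> P.prob (E1 \<union> E2)" using E_sub sE1 sE2 by (intro P.finite_measure_mono) auto
    also have "\<dots> \<le> P.prob E1 + P.prob E2" using sE1 sE2 by (rule measure_Un_le)
    also have "\<dots> \<le> h * survival K" using pE1 pE2 by (simp add: h1_def mult.commute)
    finally show "P.prob (nonneg_before n \<inter> {x. \<forall>i<n. real_of_int (x i) < (1 - e) * m n}) \<le> h * survival (n div d)"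
      unfolding E_def K_def .
  qed
qed

lemma survival_le_small_steps:
  "survival n \<le> P.prob (nonneg_before n \<inter> {x. \<forall>i<n. real_of_int (x i) < y}) + survival_sum n * tail y"
proof -
  have "survival n \<le> P.prob (nonneg_before n \<inter> {x. \<forall>i<n. real_of_int (x i) < y} \<union>
      nonneg_before n \<inter> {x. \<exists>i<n. x i \<in> {k. real_of_int k \<ge> y}})"
    unfolding survival_def
    by (intro P.finite_measure_mono sets.Un sets.Int sets_nonneg_before sets_steps) force
  also have "\<dots> \<le> P.prob (nonneg_before n \<inter> {x. \<forall>i<n. real_of_int (x i) < y}) +
      P.prob (nonneg_before n \<inter> {x. \<exists>i<n. x i \<in> {k. real_of_int k \<ge> y}})"
    by (intro measure_Un_le sets.Int sets_nonneg_before sets_steps)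
  also have "P.prob (nonneg_before n \<inter> {x. \<exists>i<n. x i \<in> {k. real_of_int k \<ge> y}}) \<le> survival_sum n * tail y"
    unfolding tail_def by (rule prob_nonneg_step_le)
  finally show ?thesis by simp
qed

text \<open>A bootstrap: \<open>survival n\<close> is bounded by its conjectured order plus a small multiple of
  \<open>survival (n div 16)\<close>.\<close>
lemma survival_upper:
  obtains H where "H > 0" "\<And>n. n > 0 \<Longrightarrow> survival n \<le> H * (survival_sum n * tail (m n))"
proof -
  obtain C where C: "C > 0" "eventually (\<lambda>n. tail (m (n div 16)) \<le> C * tail (m n)) sequentially"
    by (rule tail_m_div[of 16]) auto
  \<comment> \<open>Here \<open>e = 1/2\<close>, so 16 is \<open>8 / e\<close>. The factor
    \<open>1 / (2 * C)\<close> makes the recursive term cost half of \<open>H\<close>; the 3 below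
    exceeds the limit 2 of the tail ratio at half the scale.\<close>
  have "eventually (\<lambda>n. P.prob (nonneg_before n \<inter> {x. \<forall>i<n. real_of_int (x i) < (1 - 1 / 2) * m n})
      \<le> 1 / (2 * C) * survival (n div 16)) sequentially"
    using C by (intro prob_nonneg_small_steps_le) auto
  moreover have "eventually (\<lambda>n. tail ((1 - 1 / 2) * m n) / tail (m n) < 3) sequentially"
    by (rule order_tendstoD[OF tail_m_scaled]) auto
  ultimately have "eventually (\<lambda>n. survival n \<le> 1 / (2 * C) * survival (n div 16) + 3 * (survival_sum n * tail (m n))
     \<and> tail (m (n div 16)) \<le> C * tail (m n)) sequentially"
    using C(2)
  proof eventually_elim
    case (elim n)
    have "survival_sum n * tail ((1 - 1 / 2) * m n) \<le> survival_sum n * (3 * tail (m n))"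
      using elim(2) tail_pos[of "m n"] by (intro mult_left_mono) (auto simp: divide_less_eq)
    with survival_le_small_steps[of n "(1 - 1 / 2) * m n"] elim show ?case by linarith
  qed
  then obtain n0 where n0: "\<And>n. n \<ge> n0 \<Longrightarrow> survival n \<le> 1 / (2 * C) * survival (n div 16) + 3 * (survival_sum n * tail (m n))"
     "\<And>n. n \<ge> n0 \<Longrightarrow> tail (m (n div 16)) \<le> C * tail (m n)"
    unfolding eventually_sequentially by blast
  \<comment> \<open>The sum covers \<open>n < n0 + 16\<close>, where
    \<open>survival n \<le> 1\<close> suffices; beyond that, \<open>n div 16 > 0\<close>, and
    \<open>H \<ge> 6\<close> gives \<open>H / 2 + 3 \<le> H\<close>.\<close>
  define H where "H = 6 + (\<Sum>n<n0 + 16. 1 / tail (m n))"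
  have H: "H \<ge> 6" by (simp add: H_def sum_nonneg)
  have "survival n \<le> H * (survival_sum n * tail (m n))" if "n > 0" for n
    using that
  proof (induction n rule: less_induct)
    case (less n)
    show ?case
    proof (cases "n < n0 + 16")
      case True
      have "1 / tail (m n) \<le> H"
        unfolding H_def using True member_le_sum[of n "{..<n0 + 16}" "\<lambda>n. 1 / tail (m n)"] by simp
      hence "1 \<le> H * tail (m n)" using tail_pos[of "m n"] by (simp add: divide_le_eq)
      also have "\<dots> \<le> H * (survival_sum n * tail (m n))"
        using survival_sum_ge_1[OF less.prems] H tail_pos[of "m n"] by simp
      finally show ?thesis using survival_le_1[of n] by linarith
    next
      case False
      define K where "K = n div 16"
      have K: "K < n" "K > 0" using False by (auto simp: K_def)
      have "survival n \<le> 1 / (2 * C) * survival K + 3 * (survival_sum n * tail (m n))"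
        using n0(1)[of n] False by (simp add: K_def)
      also have "1 / (2 * C) * survival K \<le> 1 / (2 * C) * (H * (survival_sum n * (C * tail (m n))))"
      proof (rule mult_left_mono)
        have "survival K \<le> H * (survival_sum K * tail (m K))" using less.IH K by simp
        also have "\<dots> \<le> H * (survival_sum n * (C * tail (m n)))"
          using n0(2)[of n] False K H by (intro mult_left_mono mult_mono survival_sum_mono) (auto simp: K_def)
        finally show "survival K \<le> H * (survival_sum n * (C * tail (m n)))" .
      qed (use C in auto)
      also have "1 / (2 * C) * (H * (survival_sum n * (C * tail (m n)))) + 3 * (survival_sum n * tail (m n))
          = (H / 2 + 3) * (survival_sum n * tail (m n))"
        using C by (simp add: field_simps)
      also have "\<dots> \<le> H * (survival_sum n * tail (m n))"
        using H by (intro mult_right_mono) auto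
      finally show ?thesis by simp
    qed
  qed
  with H show ?thesis by (intro that[of H]) auto
qed

text \<open>By \<open>survival_upper\<close> and \<open>tail_m_div\<close>,
  \<open>survival (n div d)\<close> is at most a constant times
  \<open>survival_sum n * tail (m n)\<close>, and its factor in
  \<open>prob_nonneg_small_steps_le\<close> is arbitrarily small.\<close>

lemma prob_nonneg_small_steps_negligible:
  assumes e: "e > 0" "e < 1" and h: "h > 0"
  shows "eventually (\<lambda>n. P.prob (nonneg_before n \<inter> {x. \<forall>i<n. real_of_int (x i) < (1 - e) * m n})
    \<le> h * (survival_sum n * tail (m n))) sequentially"
proof -
  obtain H where H: "H > 0" "\<And>n. n > 0 \<Longrightarrow> survival n \<le> H * (survival_sum n * tail (m n))"
    by (rule survival_upper) blast
  obtain d :: nat where d: "real d \<ge> 8 / e" using real_nat_ceiling_ge by blast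
  have "8 / e > 8" using e by (simp add: field_simps)
  with d have "real d > 8" by linarith
  hence d2: "d \<ge> 2" "d > 0" by auto
  obtain C where C: "C > 0" "eventually (\<lambda>n. tail (m (n div d)) \<le> C * tail (m n)) sequentially"
    by (rule tail_m_div[OF d2(1)])
  have "h / (H * C) > 0" using h H C by simp
  from prob_nonneg_small_steps_le[OF e d this] C(2) eventually_ge_at_top[of d]
  show ?thesis
  proof eventually_elim
    case (elim n)
    have K: "n div d > 0" using elim d2 by (simp add: div_greater_zero_iff)
    have "survival (n div d) \<le> H * (survival_sum (n div d) * tail (m (n div d)))" using H(2)[OF K] .
    also have "\<dots> \<le> H * (survival_sum n * (C * tail (m n)))"
      using elim H by (intro mult_left_mono mult_mono survival_sum_mono) auto
    finally have "h / (H * C) * survival (n div d) \<le> h / (H * C) * (H * (survival_sum n * (C * tail (m n))))"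
      using h H C by (intro mult_left_mono) auto
    also have "\<dots> = h * (survival_sum n * tail (m n))" using H C by simp
    finally show ?case using elim by linarith
  qed
qed

text \<open>\<open>survival_ge\<close> with \<open>M = m n\<close> and
  \<open>R = (1 + e) * m n\<close>: the margin \<open>e * m n\<close> over the drift keeps the walk
  nonnegative with high probability and costs only a factor close to \<open>1 / (1 + e)\<close> in
  the tail.\<close>

lemma survival_lower:
  assumes "h > 0"
  shows "eventually (\<lambda>n. (1 - h) * (survival_sum n * tail (m n)) \<le> survival n) sequentially"
proof -
  \<comment> \<open>Three factors are each at least \<open>1 - e\<close>, and
    \<open>(1 - e) ^ 3 \<ge> 1 - 4 * e \<ge> 1 - h\<close>.\<close>
  define e where "e = min h 1 / 4"
  have e: "e > 0" "e < 1" "4 * e \<le> h" using assms by (auto simp: e_def)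
  have "eventually (\<lambda>n. real n * tail (m n) < e) sequentially"
    using n_tail_m e by (intro order_tendstoD(2)) auto
  moreover have "eventually (\<lambda>n. tail ((1 + e) * m n) / tail (m n) > 1 - e) sequentially"
    using e by (intro order_tendstoD(1)[OF tail_m_scaled]) (auto simp: less_divide_eq algebra_simps)
  moreover have "eventually (\<lambda>n. \<forall>k\<le>n. real k \<le> 1 * real n \<longrightarrow>
    P.prob {x. \<exists>i\<le>k. real_of_int (partial_sum x i) < - (1 + e) * m n} \<le> e) sequentially"
    using e by (intro prob_walk_low) auto
  ultimately show ?thesis
    using m_pos
  proof eventually_elim
    case (elim n)
    have tp: "tail (m n) > 0" by (rule tail_pos)
    have eq: "- (1 + e) * m n = - ((1 + e) * m n)" by (simp add: algebra_simps)
    have sB: "{x. \<exists>i\<le>n. real_of_int (partial_sum x i) < - ((1 + e) * m n)} \<in> sets S"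
      by (rule sets_determined[of n], rule determined_by_walkI) auto
    have "P.prob {x. \<exists>i\<le>n. real_of_int (partial_sum x i) < - ((1 + e) * m n)} \<le> e"
      using elim(3)[rule_format, of n] unfolding eq by simp
    moreover have "{x. \<forall>l\<le>n. real_of_int (partial_sum x l) \<ge> - ((1 + e) * m n)} =
       space S - {x. \<exists>i\<le>n. real_of_int (partial_sum x i) < - ((1 + e) * m n)}"
      by (auto simp: not_less)
    ultimately have B: "P.prob {x. \<forall>l\<le>n. real_of_int (partial_sum x l) \<ge> - ((1 + e) * m n)} \<ge> 1 - e"
      using P.prob_compl[OF sB] by simp
    have "1 - h \<le> 1 - 4 * e" using e by simp
    also have "\<dots> \<le> (1 - e) ^ 3"
    proof -
      have "(1 - e) ^ 3 = 1 - 4 * e + (e + e\<^sup>2 * (3 - e))" by (simp add: power3_eq_cube power2_eq_square algebra_simps)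
      moreover have "e + e\<^sup>2 * (3 - e) \<ge> 0" using e by simp
      ultimately show ?thesis by linarith
    qed
    finally have "(1 - h) * (survival_sum n * tail (m n)) \<le> (1 - e) ^ 3 * (survival_sum n * tail (m n))"
      by (intro mult_right_mono) auto
    also have "\<dots> = survival_sum n * (1 - e) * ((1 - e) * tail (m n)) * (1 - e)"
      by (simp add: power3_eq_cube)
    also have "\<dots> \<le> survival_sum n * (1 - real n * tail (m n)) * tail ((1 + e) * m n) *
        P.prob {x. \<forall>l\<le>n. real_of_int (partial_sum x l) \<ge> - ((1 + e) * m n)}"
    proof -
      have "1 - e \<le> 1 - real n * tail (m n)" using elim(1) by simp
      moreover have "(1 - e) * tail (m n) \<le> tail ((1 + e) * m n)"
        using elim(2) tp by (simp add: less_divide_eq less_imp_le)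
      ultimately show ?thesis using B e tp by (intro mult_mono mult_nonneg_nonneg) auto
    qed
    also have "\<dots> \<le> survival n"
      using elim(4) e by (intro survival_ge) simp
    finally show ?case .
  qed
qed

text \<open>Survival with all steps below \<open>(1 - e) * m n\<close> is already negligible, and a
  step between \<open>(1 - e) * m n\<close> and \<open>m n\<close> is rare because the tails at
  these two points are close.\<close>

lemma prob_nonneg_no_big_jump:
  assumes h: "h > 0"
  shows "eventually (\<lambda>n. P.prob (nonneg_before n \<inter> {x. \<forall>i<n. real_of_int (x i) < m n}) \<le> h * survival n) sequentially"
proof -
  \<comment> \<open>The two parts add up to \<open>3 * e * (survival_sum n * tail (m n))\<close>,
    hence to at most \<open>6 * e * survival n\<close> by \<open>survival_lower\<close> with
    \<open>h = 1/2\<close>.\<close>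
  define e where "e = min h 1 / 8"
  have e: "e > 0" "e < 1" "8 * e \<le> h" "8 * e \<le> 1" using assms by (auto simp: e_def)
  have "1 / (1 - e) < 1 + 2 * e"
  proof -
    have "(1 + 2 * e) * (1 - e) = 1 + e * (1 - 2 * e)" by (simp add: algebra_simps)
    moreover have "e * (1 - 2 * e) > 0" using e by (intro mult_pos_pos) auto
    ultimately show ?thesis using e by (simp add: divide_less_eq)
  qed
  hence "eventually (\<lambda>n. tail ((1 - e) * m n) / tail (m n) < 1 + 2 * e) sequentially"
    using e by (intro order_tendstoD(2)[OF tail_m_scaled]) auto
  moreover have "eventually (\<lambda>n. (1 - 1 / 2) * (survival_sum n * tail (m n)) \<le> survival n) sequentially"
    by (rule survival_lower) simp
  ultimately show ?thesis
    using prob_nonneg_small_steps_negligible[OF e(1,2,1)]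
  proof eventually_elim
    case (elim n)
    let ?B = "{k. (1 - e) * m n \<le> real_of_int k \<and> real_of_int k < m n}"
    have tp: "tail (m n) > 0" by (rule tail_pos)
    have diff: "measure_pmf.prob p ?B \<le> 2 * e * tail (m n)"
    proof (cases "(1 - e) * m n \<le> m n")
      case True
      hence "?B = {k. (1 - e) * m n \<le> real_of_int k} - {k. m n \<le> real_of_int k}" by auto
      also have "measure_pmf.prob p \<dots> = tail ((1 - e) * m n) - tail (m n)"
        unfolding tail_def using True by (intro measure_pmf.finite_measure_Diff) auto
      also have "\<dots> \<le> 2 * e * tail (m n)" using elim(1) tp by (simp add: divide_less_eq algebra_simps)
      finally show ?thesis .
    next
      case False
      hence "?B = {}" by force
      moreover have "0 \<le> 2 * e * tail (m n)" using e tp by simp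
      ultimately show ?thesis by (simp only: measure_empty)
    qed
    have "P.prob (nonneg_before n \<inter> {x. \<forall>i<n. real_of_int (x i) < m n}) \<le>
      P.prob (nonneg_before n \<inter> {x. \<forall>i<n. real_of_int (x i) < (1 - e) * m n} \<union> nonneg_before n \<inter> {x. \<exists>i<n. x i \<in> ?B})"
      by (intro P.finite_measure_mono sets.Un sets.Int sets_nonneg_before sets_steps) force
    also have "\<dots> \<le> P.prob (nonneg_before n \<inter> {x. \<forall>i<n. real_of_int (x i) < (1 - e) * m n}) +
       P.prob (nonneg_before n \<inter> {x. \<exists>i<n. x i \<in> ?B})"
      by (intro measure_Un_le sets.Int sets_nonneg_before sets_steps)
    also have "\<dots> \<le> e * (survival_sum n * tail (m n)) + survival_sum n * (2 * e * tail (m n))"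
      using elim(3) diff by (intro add_mono order_trans[OF prob_nonneg_step_le] mult_left_mono) auto
    also have "\<dots> = 6 * e * ((1 - 1 / 2) * (survival_sum n * tail (m n)))" by (simp add: algebra_simps)
    also have "\<dots> \<le> 6 * e * survival n" using elim(2) e by (intro mult_left_mono) auto
    also have "\<dots> \<le> h * survival n" using e by (intro mult_right_mono) auto
    finally show ?case .
  qed
qed

text \<open>The increment over the upper half is at most \<open>n * survival (n div 2)\<close>, a
  vanishing fraction of \<open>survival_sum (n div 2)\<close> because \<open>n * tail (m n)\<close>
  tends to 0. What matters later is that 3/2 is below 2.\<close>

lemma survival_sum_half:
  "eventually (\<lambda>n. survival_sum n \<le> 3 / 2 * survival_sum (n div 2)) sequentially"
proof -
  obtain H where H: "H > 0" "\<And>n. n > 0 \<Longrightarrow> survival n \<le> H * (survival_sum n * tail (m n))"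
    by (rule survival_upper) blast
  obtain C where C: "C > 0" "eventually (\<lambda>n. tail (m (n div 2)) \<le> C * tail (m n)) sequentially"
    by (rule tail_m_div[of 2]) auto
  have "eventually (\<lambda>n. real n * tail (m n) < 1 / (2 * H * C)) sequentially"
    using n_tail_m H C by (intro order_tendstoD(2)) auto
  with C(2) eventually_ge_at_top[of 2] show ?thesis
  proof eventually_elim
    case (elim n)
    define K where "K = n div 2"
    have K: "K > 0" "K \<le> n" using elim by (auto simp: K_def)
    have "{..<n} = {..<K} \<union> {K..<n}" using K by auto
    hence "survival_sum n = survival_sum K + (\<Sum>i\<in>{K..<n}. survival (Suc i))"
      unfolding survival_sum_def by (simp add: sum.union_disjoint ivl_disj_int)
    also have "(\<Sum>i\<in>{K..<n}. survival (Suc i)) \<le> real (card {K..<n}) * survival K"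
      by (intro sum_bounded_above survival_antimono) auto
    also have "\<dots> \<le> real n * survival K" by (intro mult_right_mono) auto
    also have "\<dots> \<le> real n * (H * (survival_sum K * tail (m K)))"
      using H(2)[OF K(1)] by (intro mult_left_mono) auto
    also have "\<dots> \<le> real n * (H * (survival_sum K * (C * tail (m n))))"
      using elim H by (intro mult_left_mono) (auto simp: K_def)
    also have "\<dots> = (real n * tail (m n)) * (H * C * survival_sum K)" by simp
    also have "\<dots> \<le> 1 / (2 * H * C) * (H * C * survival_sum K)"
      using elim H C by (intro mult_right_mono) auto
    also have "\<dots> = survival_sum K / 2" using H C by simp
    finally show ?case by (simp add: K_def)
  qed
qed

text \<open>Induction by halving: the lower half of the sum is covered by the induction hypothesis,
  and in the upper half each \<open>survival_sum K * stays_negative l\<close> is at most 1.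
  Replacing \<open>survival_sum n\<close> by \<open>survival_sum K\<close> costs 3/2, while the
  bound at \<open>K\<close> is half as large, so the constant does not grow.\<close>

lemma stays_negative_sum_upper:
  obtains C where "C > 0" "\<And>n. survival_sum n * (\<Sum>l<n. stays_negative l) \<le> C * real n"
proof -
  obtain n0 where n0: "\<And>n. n \<ge> n0 \<Longrightarrow> survival_sum n \<le> 3 / 2 * survival_sum (n div 2)"
    using survival_sum_half unfolding eventually_sequentially by blast
  define Q where "Q = (\<lambda>n. \<Sum>l<n. stays_negative l)"
  have Q: "Q n \<ge> 0" "Q n \<le> real n" for n
    unfolding Q_def using sum_bounded_above[of "{..<n}" stays_negative 1] stays_negative_le_1
    by (auto intro: sum_nonneg)
  \<comment> \<open>6 is where \<open>3/4 * C + 3/2 \<le> C\<close> begins to hold; the added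
    \<open>n0 + 2\<close> covers small \<open>n\<close> by the trivial bound
    \<open>n * n\<close>.\<close>
  define C where "C = 6 + real (n0 + 2)"
  have "survival_sum n * Q n \<le> C * real n" for n
  proof (induction n rule: less_induct)
    case (less n)
    show ?case
    proof (cases "n < n0 + 2")
      case True
      have "survival_sum n * Q n \<le> real n * real n"
        using Q survival_sum_le by (intro mult_mono) auto
      also have "\<dots> \<le> C * real n" using True by (intro mult_right_mono) (auto simp: C_def)
      finally show ?thesis .
    next
      case False
      define K where "K = n div 2"
      have K: "K > 0" "K < n" "2 * K \<le> n" using False by (auto simp: K_def)
      have "{..<n} = {..<K} \<union> {K..<n}" using K by auto
      hence "Q n = Q K + (\<Sum>l\<in>{K..<n}. stays_negative l)"
        unfolding Q_def by (simp add: sum.union_disjoint ivl_disj_int)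
      hence "survival_sum K * Q n = survival_sum K * Q K + (\<Sum>l\<in>{K..<n}. survival_sum K * stays_negative l)"
        by (simp add: algebra_simps sum_distrib_left)
      also have "survival_sum K * Q K \<le> C * real K" using less.IH K by simp
      also have "(\<Sum>l\<in>{K..<n}. survival_sum K * stays_negative l) \<le> real (card {K..<n}) * 1"
      proof (intro sum_bounded_above)
        fix l assume "l \<in> {K..<n}"
        hence "survival_sum K * stays_negative l \<le> survival_sum (Suc l) * stays_negative l"
          by (intro mult_right_mono survival_sum_mono) auto
        also have "\<dots> \<le> 1" using stays_negative_le_inverse[of l] by (simp add: mult.commute)
        finally show "survival_sum K * stays_negative l \<le> 1" .
      qed
      also have "real (card {K..<n}) * 1 \<le> real n" by simp
      also have "C * real K \<le> C * (real n / 2)" using K by (intro mult_left_mono) (auto simp: C_def)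
      finally have *: "survival_sum K * Q n \<le> C * (real n / 2) + real n" by simp
      have "survival_sum n * Q n \<le> 3 / 2 * survival_sum K * Q n"
        using n0[of n] False Q by (intro mult_right_mono) (auto simp: K_def)
      also have "\<dots> \<le> 3 / 2 * (C * (real n / 2) + real n)"
        unfolding mult.assoc using * by (intro mult_left_mono) auto
      also have "\<dots> = (3 / 4 * C + 3 / 2) * real n" by (simp add: algebra_simps)
      also have "\<dots> \<le> C * real n" by (intro mult_right_mono) (auto simp: C_def field_simps)
      finally show ?thesis .
    qed
  qed
  thus ?thesis unfolding Q_def by (intro that[of C]) (auto simp: C_def)
qed

text \<open>The error term in \<open>survival_stays_negative_lower\<close> is of order at most
  \<open>n * tail (m n)\<close> and vanishes, so \<open>stays_negative n * survival_sum n\<close> is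
  at least nearly 1; \<open>survival_lower\<close> then trades the sum for
  \<open>survival n / tail (m n)\<close>.\<close>

lemma stays_negative_times_survival_lower:
  assumes h: "h > 0" "h < 1"
  shows "eventually (\<lambda>n. (1 - h) * tail (m n) \<le> stays_negative n * survival n) sequentially"
proof -
  obtain H where H: "H > 0" "\<And>n. n > 0 \<Longrightarrow> survival n \<le> H * (survival_sum n * tail (m n))"
    by (rule survival_upper) blast
  obtain C where C: "C > 0" "\<And>n. survival_sum n * (\<Sum>l<n. stays_negative l) \<le> C * real n"
    by (rule stays_negative_sum_upper) blast
  define e where "e = h / 2"
  have e: "e > 0" "e < 1" using h by (auto simp: e_def)
  have "eventually (\<lambda>n. real n * tail (m n) < e / (H * C)) sequentially"
    using n_tail_m H C e by (intro order_tendstoD(2)) auto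
  with survival_lower[OF e(1)] eventually_gt_at_top[of 0] show ?thesis
  proof eventually_elim
    case (elim n)
    let ?Q = "\<Sum>l<n. stays_negative l"
    have "survival n * ?Q \<le> H * (survival_sum n * tail (m n)) * ?Q"
      using H(2)[OF elim(2)] by (intro mult_right_mono sum_nonneg) auto
    also have "\<dots> = H * tail (m n) * (survival_sum n * ?Q)" by simp
    also have "\<dots> \<le> H * tail (m n) * (C * real n)" using C(2) H by (intro mult_left_mono) auto
    also have "\<dots> = H * C * (real n * tail (m n))" by simp
    also have "\<dots> \<le> H * C * (e / (H * C))" using elim H C by (intro mult_left_mono) auto
    also have "\<dots> = e" using H C by simp
    finally have qU: "1 - e \<le> stays_negative n * survival_sum n"
      using survival_stays_negative_lower[OF elim(2)] by linarith
    have "(1 - h) * tail (m n) \<le> (1 - e) * (1 - e) * tail (m n)"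
      by (intro mult_right_mono) (auto simp: e_def algebra_simps)
    also have "\<dots> = (1 - e) * ((1 - e) * tail (m n))" by simp
    also have "\<dots> \<le> (stays_negative n * survival_sum n) * ((1 - e) * tail (m n))"
      using qU e by (intro mult_right_mono) auto
    also have "\<dots> = stays_negative n * ((1 - e) * (survival_sum n * tail (m n)))" by simp
    also have "\<dots> \<le> stays_negative n * survival n" using elim by (intro mult_left_mono) auto
    finally show ?case .
  qed
qed

end

section \<open>The law of the big jump process\<close>

lemma prob_indep_vars3:
  assumes Q: "prob_space Q" and ind: "indep_vars3 Q A f B g C h"
    and S: "a \<in> sets A" "b \<in> sets B" "c \<in> sets C"
  shows "measure Q {\<omega> \<in> space Q. f \<omega> \<in> a \<and> g \<omega> \<in> b \<and> h \<omega> \<in> c} =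
    measure (distr Q A f) a * measure (distr Q B g) b * measure (distr Q C h) c"
proof -
  interpret Q: prob_space Q by fact
  have m: "f \<in> measurable Q A" "g \<in> measurable Q B" "h \<in> measurable Q C"
    using ind by (auto simp: indep_vars3_def)
  define F where "F = (\<lambda>k::nat. if k = 0 then {f -` S \<inter> space Q | S. S \<in> sets A}
                 else if k = 1 then {g -` S \<inter> space Q | S. S \<in> sets B}
                 else {h -` S \<inter> space Q | S. S \<in> sets C})"
  define E where "E = (\<lambda>k::nat. if k = 0 then f -` a \<inter> space Q else if k = 1 then g -` b \<inter> space Q else h -` c \<inter> space Q)"
  have "Q.indep_sets F {0, 1, 2}" using ind by (simp add: indep_vars3_def F_def)
  hence "Q.prob (\<Inter>k\<in>{0, 1, 2}. E k) = (\<Prod>k\<in>{0, 1, 2}. Q.prob (E k))"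
    using S by (rule_tac Q.indep_setsD[of F "{0, 1, 2}"]) (auto simp: F_def E_def)
  also have "(\<Inter>k\<in>{0, 1, 2}. E k) = {\<omega> \<in> space Q. f \<omega> \<in> a \<and> g \<omega> \<in> b \<and> h \<omega> \<in> c}"
    by (auto simp: E_def)
  also have "(\<Prod>k\<in>{0, 1, 2}. Q.prob (E k)) = measure (distr Q A f) a * measure (distr Q B g) b * measure (distr Q C h) c"
    using m S by (simp add: E_def measure_distr)
  finally show ?thesis .
qed

text \<open>Measurable boxes form an intersection-stable generator of the triple product, so
  agreement on them determines the joint law.\<close>

lemma distr_triple_eqI:
  assumes Q: "prob_space Q" and R: "prob_space R"
    and f: "f \<in> measurable Q A" "f' \<in> measurable R A"
    and g: "g \<in> measurable Q B" "g' \<in> measurable R B"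
    and h: "h \<in> measurable Q C" "h' \<in> measurable R C"
    and eq: "\<And>a b c. a \<in> sets A \<Longrightarrow> b \<in> sets B \<Longrightarrow> c \<in> sets C \<Longrightarrow>
      measure Q {\<omega> \<in> space Q. f \<omega> \<in> a \<and> g \<omega> \<in> b \<and> h \<omega> \<in> c} =
      measure R {\<omega> \<in> space R. f' \<omega> \<in> a \<and> g' \<omega> \<in> b \<and> h' \<omega> \<in> c}"
  shows "distr Q (A \<Otimes>\<^sub>M (B \<Otimes>\<^sub>M C)) (\<lambda>\<omega>. (f \<omega>, g \<omega>, h \<omega>)) =
         distr R (A \<Otimes>\<^sub>M (B \<Otimes>\<^sub>M C)) (\<lambda>\<omega>. (f' \<omega>, g' \<omega>, h' \<omega>))"
proof -
  interpret Q: prob_space Q by fact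
  interpret R: prob_space R by fact
  define E where "E = {a \<times> b \<times> c | a b c. a \<in> sets A \<and> b \<in> sets B \<and> c \<in> sets C}"
  let ?P = "A \<Otimes>\<^sub>M (B \<Otimes>\<^sub>M C)"
  have "sets ?P = sets (sigma (space A \<times> space (B \<Otimes>\<^sub>M C))
      {a \<times> b | a b. a \<in> sets A \<and> b \<in> {b \<times> c | b c. b \<in> sets B \<and> c \<in> sets C}})"
  proof (rule sets_pair_eq[where Ca = "{space A}" and Cb = "{space B \<times> space C}"])
    show "sets (B \<Otimes>\<^sub>M C) = sigma_sets (space (B \<Otimes>\<^sub>M C)) {b \<times> c |b c. b \<in> sets B \<and> c \<in> sets C}"
      by (simp add: sets_pair_measure space_pair_measure)
  qed (auto simp: sets.sigma_sets_eq sets.space_closed space_pair_measure dest: sets.sets_into_space)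
  also have "{a \<times> b | a b. a \<in> sets A \<and> b \<in> {b \<times> c | b c. b \<in> sets B \<and> c \<in> sets C}} = E"
    unfolding E_def by blast
  also have "sets (sigma (space A \<times> space (B \<Otimes>\<^sub>M C)) E) = sigma_sets (space ?P) E"
    by (subst sets_measure_of)
       (auto simp: E_def space_pair_measure dest: sets.sets_into_space)
  finally have gen: "sets ?P = sigma_sets (space ?P) E" .
  have mQ: "(\<lambda>\<omega>. (f \<omega>, g \<omega>, h \<omega>)) \<in> measurable Q ?P" using f g h by measurable
  have mR: "(\<lambda>\<omega>. (f' \<omega>, g' \<omega>, h' \<omega>)) \<in> measurable R ?P" using f g h by measurable
  show ?thesis
  proof (rule measure_eqI_generator_eq[where E = E and \<Omega> = "space ?P" and A = "\<lambda>_. space ?P"])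
    show "Int_stable E"
    proof (rule Int_stableI)
      fix V W assume "V \<in> E" "W \<in> E"
      then obtain a b c a' b' c' where VW: "V = a \<times> b \<times> c" "W = a' \<times> b' \<times> c'"
        and sets: "a \<inter> a' \<in> sets A" "b \<inter> b' \<in> sets B" "c \<inter> c' \<in> sets C"
        by (auto simp: E_def)
      have "V \<inter> W = (a \<inter> a') \<times> (b \<inter> b') \<times> (c \<inter> c')" by (auto simp: VW)
      thus "V \<inter> W \<in> E" using sets unfolding E_def by blast
    qed
    show "E \<subseteq> Pow (space ?P)"
      by (auto simp: E_def space_pair_measure dest: sets.sets_into_space)
    show "range (\<lambda>_. space ?P) \<subseteq> E"
      by (auto simp: E_def space_pair_measure)
    show "emeasure (distr Q ?P (\<lambda>\<omega>. (f \<omega>, g \<omega>, h \<omega>))) X = emeasure (distr R ?P (\<lambda>\<omega>. (f' \<omega>, g' \<omega>, h' \<omega>))) X"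
      if X: "X \<in> E" for X
    proof -
      obtain a b c where abc: "a \<in> sets A" "b \<in> sets B" "c \<in> sets C" "X = a \<times> b \<times> c"
        using X by (auto simp: E_def)
      have XP: "X \<in> sets ?P" using abc by auto
      have "(\<lambda>\<omega>. (f \<omega>, g \<omega>, h \<omega>)) -` X \<inter> space Q = {\<omega> \<in> space Q. f \<omega> \<in> a \<and> g \<omega> \<in> b \<and> h \<omega> \<in> c}"
        "(\<lambda>\<omega>. (f' \<omega>, g' \<omega>, h' \<omega>)) -` X \<inter> space R = {\<omega> \<in> space R. f' \<omega> \<in> a \<and> g' \<omega> \<in> b \<and> h' \<omega> \<in> c}"
        using abc by auto
      thus ?thesis
        using eq[OF abc(1-3)]
        by (simp add: emeasure_distr[OF mQ XP] emeasure_distr[OF mR XP] Q.emeasure_eq_measure R.emeasure_eq_measure)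
    qed
    show "emeasure (distr Q ?P (\<lambda>\<omega>. (f \<omega>, g \<omega>, h \<omega>))) (space ?P) \<noteq> \<infinity>"
      using Q.prob_space_distr[OF mQ] by (simp add: prob_space.emeasure_space_1 Q.emeasure_eq_measure emeasure_distr[OF mQ])
  qed (use gen in auto)
qed

lemma measure_uniform_measure_prob:
  assumes "prob_space M" "E \<in> sets M" "measure M E > 0" "T \<in> sets M"
  shows "measure (uniform_measure M E) T = measure M (E \<inter> T) / measure M E"
proof -
  interpret prob_space M by fact
  show ?thesis
    using assms(3,4) by (intro measure_uniform_measure) (auto simp: emeasure_eq_measure)
qed

lemma prob_space_uniform_measure_prob:
  assumes "prob_space M" "measure M E > 0"
  shows "prob_space (uniform_measure M E)"
proof -
  interpret prob_space M by fact
  show ?thesis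
    using assms(2) by (intro prob_space_uniform_measure) (auto simp: emeasure_eq_measure)
qed

section \<open>Paths of the walk, cut and reassembled at a time \<open>j\<close>\<close>

definition real_walk :: "(nat \<Rightarrow> int) \<Rightarrow> nat \<Rightarrow> real" where
  "real_walk x i = real_of_int (partial_sum x i)"

definition steps :: "(nat \<Rightarrow> 'a \<Rightarrow> int) \<Rightarrow> 'a \<Rightarrow> nat \<Rightarrow> int" where
  "steps \<xi> \<omega> k = \<xi> (Suc k) \<omega>"

lemma walk_eq_real_walk: "walk \<xi> \<omega> = real_walk (steps \<xi> \<omega>)"
proof
  fix n show "walk \<xi> \<omega> n = real_walk (steps \<xi> \<omega>) n"
    by (induction n) (simp_all add: walk_def real_walk_def steps_def)
qed

lemma enat_le_first_negative_real_walk: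
  "enat n \<le> first_negative (real_walk x) \<longleftrightarrow> x \<in> nonneg_before n"
proof -
  have "(\<forall>i. 1 \<le> i \<and> i < n \<longrightarrow> partial_sum x i \<ge> 0) \<longleftrightarrow> (\<forall>i<n. partial_sum x i \<ge> 0)"
    by (metis One_nat_def Suc_leI neq0_conv order_refl partial_sum_0)
  thus ?thesis
    by (simp add: enat_le_first_negative_iff real_walk_def nonneg_before_def)
qed

text \<open>Inverse of cutting a path into the three pieces of \<open>big_jump_process\<close> (see
  \<open>glue_split\<close>). It reads the first piece at \<open>j - 1\<close>, whence the
  assumption \<open>j > 0\<close> in the lemmas about it.\<close>

definition glue :: "nat \<Rightarrow> (nat \<Rightarrow> real) \<times> real \<times> (nat \<Rightarrow> real) \<Rightarrow> nat \<Rightarrow> real" where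
  "glue j = (\<lambda>(u, y, v) i. if i < j then u i else u (j - 1) + y + v (i - j))"

lemma measurable_glue:
  assumes "j > 0"
  shows "glue j \<in> measurable ((\<Pi>\<^sub>M i\<in>{..<j}. borel) \<Otimes>\<^sub>M (borel \<Otimes>\<^sub>M borel)) borel"
proof (rule measurable_coordinatewise_then_product)
  fix i
  have [measurable]: "(\<lambda>v::nat \<Rightarrow> real. v k) \<in> borel_measurable borel" for k
    by (rule measurable_product_coordinates)
  have [measurable]: "(\<lambda>u. u k) \<in> borel_measurable (\<Pi>\<^sub>M i\<in>{..<j}. (borel :: real measure))" if "k < j" for k
    using that by (intro measurable_component_singleton) simp
  have "j - 1 < j" using assms by simp
  then show "(\<lambda>w. glue j w i) \<in> borel_measurable ((\<Pi>\<^sub>M i\<in>{..<j}. borel) \<Otimes>\<^sub>M (borel \<Otimes>\<^sub>M borel))"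
    unfolding glue_def case_prod_unfold by (cases "i < j") simp_all
qed

lemma glue_split:
  assumes "j > 0"
  shows "glue j (restrict w {..<j}, w j - w (j - 1), (\<lambda>i. w (i + j) - w j)) = w"
  using assms by (auto simp: glue_def fun_eq_iff)

section \<open>Transfer between the given probability space and the canonical one\<close>

locale iid_walk_model = iid_steps p + base: prob_space M
  for p :: "int pmf" and M :: "'a measure" +
  fixes X :: "'a \<Rightarrow> int" and \<xi> :: "nat \<Rightarrow> 'a \<Rightarrow> int"
  assumes X_meas: "X \<in> measurable M (count_space UNIV)"
    and X_law: "distr M (count_space UNIV) X = measure_pmf p"
    and steps_meas: "steps \<xi> \<in> measurable M S"
    and steps_law: "distr M S (steps \<xi>) = S"
begin

lemma prob_steps:
  assumes "T \<in> sets S"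
  shows "{\<omega> \<in> space M. steps \<xi> \<omega> \<in> T} \<in> sets M"
    and "measure M {\<omega> \<in> space M. steps \<xi> \<omega> \<in> T} = P.prob T"
proof -
  have eq: "steps \<xi> -` T \<inter> space M = {\<omega> \<in> space M. steps \<xi> \<omega> \<in> T}" by auto
  show "{\<omega> \<in> space M. steps \<xi> \<omega> \<in> T} \<in> sets M"
    using measurable_sets[OF steps_meas assms] by (simp add: eq)
  have "P.prob T = measure (distr M S (steps \<xi>)) T" by (simp add: steps_law)
  also have "\<dots> = measure M {\<omega> \<in> space M. steps \<xi> \<omega> \<in> T}"
    by (simp add: measure_distr[OF steps_meas assms] eq)
  finally show "measure M {\<omega> \<in> space M. steps \<xi> \<omega> \<in> T} = P.prob T" by simp
qed

lemma prob_X: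
  shows "{\<omega> \<in> space M. X \<omega> \<in> T} \<in> sets M"
    and "measure M {\<omega> \<in> space M. X \<omega> \<in> T} = measure_pmf.prob p T"
proof -
  have eq: "X -` T \<inter> space M = {\<omega> \<in> space M. X \<omega> \<in> T}" by auto
  show "{\<omega> \<in> space M. X \<omega> \<in> T} \<in> sets M"
    using measurable_sets[OF X_meas, of T] by (simp add: eq)
  have "measure_pmf.prob p T = measure (distr M (count_space UNIV) X) T" by (simp add: X_law)
  also have "\<dots> = measure M {\<omega> \<in> space M. X \<omega> \<in> T}"
    by (simp add: measure_distr[OF X_meas] eq)
  finally show "measure M {\<omega> \<in> space M. X \<omega> \<in> T} = measure_pmf.prob p T" by simp
qed

lemma measurable_real_walk: "real_walk \<in> measurable S borel"
proof (rule measurable_coordinatewise_then_product)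
  fix i show "(\<lambda>x. real_walk x i) \<in> borel_measurable S"
  proof (rule measurableI)
    fix A :: "real set"
    have "(\<lambda>x. real_walk x i) -` A \<inter> space S = {x. real_of_int (partial_sum x i) \<in> A}"
      by (auto simp: real_walk_def)
    thus "(\<lambda>x. real_walk x i) -` A \<inter> space S \<in> sets S" using sets_partial_sum by simp
  qed simp
qed

lemma sets_real_walk: "A \<in> sets borel \<Longrightarrow> {x. real_walk x \<in> A} \<in> sets S"
  using measurable_sets[OF measurable_real_walk] by (simp add: vimage_def)

lemma measurable_walk: "walk \<xi> \<in> measurable M borel"
  using measurable_compose[OF steps_meas measurable_real_walk]
  by (simp add: walk_eq_real_walk[abs_def])

lemma first_negative_event:
  "{\<omega> \<in> space M. enat n \<le> first_negative (walk \<xi> \<omega>)} = {\<omega> \<in> space M. steps \<xi> \<omega> \<in> nonneg_before n}"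
  by (simp add: walk_eq_real_walk enat_le_first_negative_real_walk)

text \<open>With \<open>f\<close> the restriction to \<open>{..<j}\<close> this gives the law of the
  first piece of \<open>Z\<close>, with \<open>f\<close> the identity that of the conditioned
  walk.\<close>

lemma measure_conditioned_walk:
  assumes n: "survival n > 0" and f: "f \<in> measurable borel A" and a: "a \<in> sets A"
  shows "measure (distr (given M (\<lambda>\<omega>. enat n \<le> first_negative (walk \<xi> \<omega>))) A (\<lambda>\<omega>. f (walk \<xi> \<omega>))) a
    = P.prob (nonneg_before n \<inter> {x. f (real_walk x) \<in> a}) / survival n"
proof -
  let ?E = "{\<omega> \<in> space M. steps \<xi> \<omega> \<in> nonneg_before n}"
  have E: "?E \<in> sets M" "measure M ?E = survival n"
    using prob_steps[OF sets_nonneg_before] by (auto simp: survival_def)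
  have m: "(\<lambda>\<omega>. f (walk \<xi> \<omega>)) \<in> measurable (uniform_measure M ?E) A"
    using measurable_compose[OF measurable_walk f] by simp
  have T: "{x. f (real_walk x) \<in> a} \<in> sets S"
    using measurable_sets[OF measurable_compose[OF measurable_real_walk f] a] by (simp add: vimage_def)
  have "measure (distr (given M (\<lambda>\<omega>. enat n \<le> first_negative (walk \<xi> \<omega>))) A (\<lambda>\<omega>. f (walk \<xi> \<omega>))) a
    = measure (uniform_measure M ?E) {\<omega> \<in> space M. steps \<xi> \<omega> \<in> {x. f (real_walk x) \<in> a}}"
    unfolding given_def first_negative_event
    by (subst measure_distr[OF m a]) (auto simp: walk_eq_real_walk intro!: arg_cong[where f = "measure _"])
  also have "\<dots> = measure M (?E \<inter> {\<omega> \<in> space M. steps \<xi> \<omega> \<in> {x. f (real_walk x) \<in> a}}) / survival n"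
    using E n prob_steps(1)[OF T] by (subst measure_uniform_measure_prob) (auto intro: base.prob_space_axioms)
  also have "?E \<inter> {\<omega> \<in> space M. steps \<xi> \<omega> \<in> {x. f (real_walk x) \<in> a}}
    = {\<omega> \<in> space M. steps \<xi> \<omega> \<in> nonneg_before n \<inter> {x. f (real_walk x) \<in> a}}" by auto
  also have "measure M \<dots> = P.prob (nonneg_before n \<inter> {x. f (real_walk x) \<in> a})"
    using T sets_nonneg_before by (intro prob_steps) auto
  finally show ?thesis .
qed

lemma measure_conditioned_step:
  assumes t: "tail t > 0" and a: "a \<in> sets borel"
  shows "measure (distr (given M (\<lambda>\<omega>. real_of_int (X \<omega>) \<ge> t)) borel (\<lambda>\<omega>. real_of_int (X \<omega>))) a
    = measure_pmf.prob p {k. real_of_int k \<ge> t \<and> real_of_int k \<in> a} / tail t"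
proof -
  let ?E = "{\<omega> \<in> space M. X \<omega> \<in> {k. real_of_int k \<ge> t}}"
  have E: "?E \<in> sets M" "measure M ?E = tail t"
    using prob_X[of "{k. real_of_int k \<ge> t}"] by (simp_all add: tail_def)
  have m: "(\<lambda>\<omega>. real_of_int (X \<omega>)) \<in> measurable (uniform_measure M ?E) borel"
    using measurable_compose[OF X_meas, of real_of_int borel] by simp
  have eq: "{\<omega> \<in> space M. real_of_int (X \<omega>) \<ge> t} = ?E" by simp
  have "measure (distr (given M (\<lambda>\<omega>. real_of_int (X \<omega>) \<ge> t)) borel (\<lambda>\<omega>. real_of_int (X \<omega>))) a
    = measure (uniform_measure M ?E) {\<omega> \<in> space M. X \<omega> \<in> {k. real_of_int k \<in> a}}"
    unfolding given_def eq
    by (subst measure_distr[OF m a]) (auto intro!: arg_cong[where f = "measure _"])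
  also have "\<dots> = measure M (?E \<inter> {\<omega> \<in> space M. X \<omega> \<in> {k. real_of_int k \<in> a}}) / tail t"
    using E t prob_X(1)[of "{k. real_of_int k \<in> a}"]
    by (subst measure_uniform_measure_prob) (auto intro: base.prob_space_axioms)
  also have "?E \<inter> {\<omega> \<in> space M. X \<omega> \<in> {k. real_of_int k \<in> a}}
    = {\<omega> \<in> space M. X \<omega> \<in> {k. real_of_int k \<ge> t \<and> real_of_int k \<in> a}}" by auto
  finally show ?thesis by (simp only: prob_X)
qed

lemma measure_walk:
  assumes "c \<in> sets borel"
  shows "measure (distr M borel (walk \<xi>)) c = P.prob {x. real_walk x \<in> c}"
proof -
  have "walk \<xi> -` c \<inter> space M = {\<omega> \<in> space M. steps \<xi> \<omega> \<in> {x. real_walk x \<in> c}}"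
    by (auto simp: walk_eq_real_walk)
  thus ?thesis
    using prob_steps(2)[OF sets_real_walk[OF assms]] by (simp add: measure_distr[OF measurable_walk assms])
qed

text \<open>The event \<open>\<zeta> \<ge> j\<close> and \<open>X\<^sub>j \<ge> t\<close>; the
  \<open>j\<close>-th step has index \<open>j - 1\<close>.\<close>

definition big_jump_at :: "nat \<Rightarrow> real \<Rightarrow> (nat \<Rightarrow> int) set" where
  "big_jump_at j t = nonneg_before j \<inter> {x. x (j - 1) \<in> {k. real_of_int k \<ge> t}}"

lemma sets_big_jump_at: "big_jump_at j t \<in> sets S"
  unfolding big_jump_at_def by (intro sets.Int sets_nonneg_before sets_steps)

lemma prob_big_jump_at: "j > 0 \<Longrightarrow> P.prob (big_jump_at j t) = survival j * tail t"
  unfolding big_jump_at_def tail_def survival_def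
  using determined_nonneg_before_Suc[of "j - 1"] by (intro prob_determined_step) simp

text \<open>The first piece depends on the steps of index below \<open>j - 1\<close>, the increment
  is the step of index \<open>j - 1\<close>, and the last piece is the walk of the later
  steps.\<close>

lemma prob_big_jump_at_split:
  assumes j: "j > 0" and a: "a \<in> sets (\<Pi>\<^sub>M i\<in>{..<j}. (borel :: real measure))" and c: "c \<in> sets borel"
  shows "P.prob (big_jump_at j t \<inter>
      {x. restrict (real_walk x) {..<j} \<in> a \<and> real_walk x j - real_walk x (j - 1) \<in> b \<and>
          (\<lambda>i. real_walk x (i + j) - real_walk x j) \<in> c}) =
    P.prob (nonneg_before j \<inter> {x. restrict (real_walk x) {..<j} \<in> a}) *
    measure_pmf.prob p {k. real_of_int k \<ge> t \<and> real_of_int k \<in> b} * P.prob {x. real_walk x \<in> c}"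
proof -
  define A where "A = nonneg_before j \<inter> {x. restrict (real_walk x) {..<j} \<in> a}"
  define B where "B = {k. real_of_int k \<ge> t \<and> real_of_int k \<in> b}"
  have A: "determined_by_prefix (j - 1) A"
  proof (rule determined_by_walkI)
    fix x y assume xy: "\<And>i. i \<le> j - 1 \<Longrightarrow> partial_sum x i = partial_sum y i" and x: "x \<in> A"
    have *: "partial_sum x i = partial_sum y i" if "i < j" for i using that xy by simp
    hence "restrict (real_walk x) {..<j} = restrict (real_walk y) {..<j}"
      by (intro restrict_ext) (simp add: real_walk_def)
    with x * show "y \<in> A" by (auto simp: A_def nonneg_before_def)
  qed
  have AB: "determined_by_prefix j (A \<inter> {x. x (j - 1) \<in> B})"
    using A j by (intro determined_Int determined_steps) (auto simp: determined_by_prefix_def)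
  have "real_walk x j - real_walk x (j - 1) = real_of_int (x (j - 1))" for x
    using partial_sum_Suc[of x "j - 1"] j by (simp add: real_walk_def)
  moreover have "(\<lambda>i. real_walk x (i + j) - real_walk x j) = real_walk (shift_seq j x)" for x
    by (simp add: real_walk_def partial_sum_shift_seq fun_eq_iff)
  ultimately have "big_jump_at j t \<inter>
      {x. restrict (real_walk x) {..<j} \<in> a \<and> real_walk x j - real_walk x (j - 1) \<in> b \<and>
          (\<lambda>i. real_walk x (i + j) - real_walk x j) \<in> c}
    = (A \<inter> {x. x (j - 1) \<in> B}) \<inter> {x. shift_seq j x \<in> {x. real_walk x \<in> c}}"
    by (auto simp: big_jump_at_def A_def B_def)
  thus ?thesis
    using prob_prefix_shift[OF AB sets_real_walk[OF c]] prob_determined_step[OF A, of B]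
    by (simp add: A_def B_def)
qed

text \<open>Given \<open>I = j - 1\<close>, \<open>Z\<close> has the law of the walk conditioned on
  \<open>big_jump_at j \<bar>\<beta>\<bar>\<close>: under both laws the three pieces are independent
  with the same marginals, and \<open>glue\<close> recovers the path from them.\<close>

lemma big_jump_process_conditional_law:
  assumes bj: "big_jump_process M X (walk \<xi>) \<beta> n N I Z"
    and j: "j > 0" and pos: "\<P>(\<omega> in N. I \<omega> = j - 1) > 0"
    and surv: "survival j > 0" and tl: "tail \<bar>\<beta>\<bar> > 0" and A: "A \<in> sets borel"
  shows "measure N {\<omega> \<in> space N. I \<omega> = j - 1 \<and> Z \<omega> \<in> A} =
    \<P>(\<omega> in N. I \<omega> = j - 1) * P.prob (big_jump_at j \<bar>\<beta>\<bar> \<inter> {x. real_walk x \<in> A}) / (survival j * tail \<bar>\<beta>\<bar>)"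
proof -
  interpret N: prob_space N using bj by (simp add: big_jump_process_def)
  have I_meas: "I \<in> measurable N (count_space UNIV)" and Z_meas: "Z \<in> measurable N borel"
    using bj by (auto simp: big_jump_process_def)
  define D where "D = {\<omega> \<in> space N. I \<omega> = j - 1}"
  define Q where "Q = uniform_measure N D"
  define R where "R = uniform_measure S (big_jump_at j \<bar>\<beta>\<bar>)"
  define paths where "paths = (\<Pi>\<^sub>M i\<in>{..<j}. (borel :: real measure))"
  define before where "before = (\<lambda>\<omega>. restrict (Z \<omega>) {..<j})"
  define Y where "Y = (\<lambda>\<omega>. Z \<omega> j - Z \<omega> (j - 1))"
  define after where "after = (\<lambda>\<omega> i. Z \<omega> (i + j) - Z \<omega> j)"
  have "(\<lambda>\<omega>. I \<omega>) -` {j - 1} \<inter> space N \<in> sets N" using I_meas by (rule measurable_sets) simp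
  hence sD: "D \<in> sets N" by (simp add: D_def vimage_def Int_def conj_commute)
  have pD: "measure N D > 0" using pos by (simp add: D_def)
  have pE: "P.prob (big_jump_at j \<bar>\<beta>\<bar>) > 0" using prob_big_jump_at[OF j] surv tl by simp
  have "Q = given N (\<lambda>\<omega>. I \<omega> = j - 1)" by (simp add: Q_def given_def D_def)
  hence law: "indep_vars3 Q paths before borel Y borel after"
    "distr Q paths before = distr (given M (\<lambda>\<omega>. first_negative (walk \<xi> \<omega>) \<ge> enat j)) paths
                 (\<lambda>\<omega>. restrict (walk \<xi> \<omega>) {..<j})"
    "distr Q borel Y = distr (given M (\<lambda>\<omega>. real_of_int (X \<omega>) \<ge> \<bar>\<beta>\<bar>)) borel (\<lambda>\<omega>. real_of_int (X \<omega>))"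
    "distr Q borel after = distr M borel (walk \<xi>)"
    using bj j pos unfolding big_jump_process_def Let_def paths_def before_def Y_def after_def by auto
  have Q: "prob_space Q" unfolding Q_def using pD by (intro prob_space_uniform_measure_prob N.prob_space_axioms)
  have R: "prob_space R" unfolding R_def using pE by (intro prob_space_uniform_measure_prob P.prob_space_axioms)
  have mQ: "before \<in> measurable Q paths" "Y \<in> measurable Q borel" "after \<in> measurable Q borel"
    using law(1) by (auto simp: indep_vars3_def)
  have coord: "(\<lambda>v::nat \<Rightarrow> real. v k) \<in> borel_measurable borel" for k
    by (rule measurable_product_coordinates)
  have mrestrict: "(\<lambda>w::nat \<Rightarrow> real. restrict w {..<j}) \<in> measurable borel paths"
    unfolding paths_def by (rule measurable_restrict) (rule coord)
  have mwalk: "real_walk \<in> measurable R borel" using measurable_real_walk by (simp add: R_def)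
  have mR: "(\<lambda>x. restrict (real_walk x) {..<j}) \<in> measurable R paths"
    "(\<lambda>x. real_walk x j - real_walk x (j - 1)) \<in> measurable R borel"
    "(\<lambda>x i. real_walk x (i + j) - real_walk x j) \<in> measurable R borel"
    using measurable_compose[OF mwalk mrestrict] measurable_compose[OF mwalk coord]
    by (auto intro!: measurable_coordinatewise_then_product)
  have "distr Q (paths \<Otimes>\<^sub>M (borel \<Otimes>\<^sub>M borel)) (\<lambda>\<omega>. (before \<omega>, Y \<omega>, after \<omega>)) =
    distr R (paths \<Otimes>\<^sub>M (borel \<Otimes>\<^sub>M borel)) (\<lambda>x. (restrict (real_walk x) {..<j},
      real_walk x j - real_walk x (j - 1), (\<lambda>i. real_walk x (i + j) - real_walk x j)))" (is "?L1 = ?L2")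
  proof (intro distr_triple_eqI Q R mQ mR)
    fix a b c assume abc: "a \<in> sets paths" "b \<in> sets (borel :: real measure)" "c \<in> sets (borel :: (nat \<Rightarrow> real) measure)"
    let ?T = "{x. restrict (real_walk x) {..<j} \<in> a \<and> real_walk x j - real_walk x (j - 1) \<in> b \<and>
          (\<lambda>i. real_walk x (i + j) - real_walk x j) \<in> c}"
    have "{x \<in> space R. restrict (real_walk x) {..<j} \<in> a \<and> real_walk x j - real_walk x (j - 1) \<in> b \<and>
          (\<lambda>i. real_walk x (i + j) - real_walk x j) \<in> c} \<in> sets R"
      using mR abc by measurable
    hence sT: "?T \<in> sets S" by (simp add: R_def)
    have "measure R ?T = P.prob (big_jump_at j \<bar>\<beta>\<bar> \<inter> ?T) / P.prob (big_jump_at j \<bar>\<beta>\<bar>)"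
      unfolding R_def using pE sT
      by (intro measure_uniform_measure_prob P.prob_space_axioms sets_big_jump_at)
    also have "\<dots> = P.prob (nonneg_before j \<inter> {x. restrict (real_walk x) {..<j} \<in> a}) / survival j *
      (measure_pmf.prob p {k. real_of_int k \<ge> \<bar>\<beta>\<bar> \<and> real_of_int k \<in> b} / tail \<bar>\<beta>\<bar>) * P.prob {x. real_walk x \<in> c}"
      using prob_big_jump_at_split[OF j abc(1)[unfolded paths_def] abc(3)] prob_big_jump_at[OF j]
      by simp
    also have "\<dots> = measure (distr Q paths before) a * measure (distr Q borel Y) b * measure (distr Q borel after) c"
      unfolding law(2-4) using measure_conditioned_walk[OF surv mrestrict abc(1)]
        measure_conditioned_step[OF tl abc(2)] measure_walk[OF abc(3)] by simp
    also have "\<dots> = measure Q {\<omega> \<in> space Q. before \<omega> \<in> a \<and> Y \<omega> \<in> b \<and> after \<omega> \<in> c}"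
      using prob_indep_vars3[OF Q law(1) abc] by simp
    finally show "measure Q {\<omega> \<in> space Q. before \<omega> \<in> a \<and> Y \<omega> \<in> b \<and> after \<omega> \<in> c} =
      measure R {x \<in> space R. restrict (real_walk x) {..<j} \<in> a \<and> real_walk x j - real_walk x (j - 1) \<in> b \<and>
          (\<lambda>i. real_walk x (i + j) - real_walk x j) \<in> c}"
      by (simp add: R_def)
  qed
  hence "distr ?L1 borel (glue j) = distr ?L2 borel (glue j)" by simp
  moreover have mglue: "glue j \<in> measurable (paths \<Otimes>\<^sub>M (borel \<Otimes>\<^sub>M borel)) borel"
    unfolding paths_def by (rule measurable_glue[OF j])
  ultimately have "distr Q borel (\<lambda>\<omega>. glue j (before \<omega>, Y \<omega>, after \<omega>)) =
    distr R borel (\<lambda>x. glue j (restrict (real_walk x) {..<j},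
      real_walk x j - real_walk x (j - 1), (\<lambda>i. real_walk x (i + j) - real_walk x j)))"
    using mQ mR by (simp add: distr_distr comp_def)
  hence "distr Q borel Z = distr R borel real_walk"
    unfolding before_def Y_def after_def glue_split[OF j] by simp
  moreover have "measure (distr Q borel Z) A = measure N (D \<inter> {\<omega> \<in> space N. Z \<omega> \<in> A}) / measure N D"
  proof -
    have ZA: "{\<omega> \<in> space N. Z \<omega> \<in> A} \<in> sets N"
      using measurable_sets[OF Z_meas A] by (simp add: vimage_def Int_def conj_commute)
    have "Z \<in> measurable Q borel" using Z_meas by (simp add: Q_def)
    hence "measure (distr Q borel Z) A = measure Q {\<omega> \<in> space N. Z \<omega> \<in> A}"
      using A by (subst measure_distr) (auto simp: Q_def intro!: arg_cong[where f = "measure _"])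
    thus ?thesis unfolding Q_def
      using measure_uniform_measure_prob[OF N.prob_space_axioms sD pD ZA] by simp
  qed
  moreover have "measure (distr R borel real_walk) A =
      P.prob (big_jump_at j \<bar>\<beta>\<bar> \<inter> {x. real_walk x \<in> A}) / (survival j * tail \<bar>\<beta>\<bar>)"
  proof -
    have "measure (distr R borel real_walk) A = measure R {x. real_walk x \<in> A}"
      using A by (subst measure_distr[OF mwalk]) (auto simp: R_def vimage_def)
    thus ?thesis unfolding R_def
      using measure_uniform_measure_prob[OF P.prob_space_axioms sets_big_jump_at pE sets_real_walk[OF A]]
      by (simp add: prob_big_jump_at[OF j])
  qed
  moreover have "D \<inter> {\<omega> \<in> space N. Z \<omega> \<in> A} = {\<omega> \<in> space N. I \<omega> = j - 1 \<and> Z \<omega> \<in> A}"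
    by (auto simp: D_def)
  ultimately show ?thesis using pD by (simp add: D_def field_simps)
qed

lemma big_jump_process_index_law:
  assumes bj: "big_jump_process M X (walk \<xi>) \<beta> n N I Z" and t: "t \<le> n"
  shows "\<P>(\<omega> in N. I \<omega> = t) = survival (Suc t) * stays_negative (n - t)"
proof -
  have I_meas: "I \<in> measurable N (count_space UNIV)"
    and I_law: "distr N (count_space UNIV) I
       = distr M (count_space UNIV) (\<lambda>\<omega>. last_weak_ladder_time n (walk \<xi> \<omega>))"
    using bj by (auto simp: big_jump_process_def)
  let ?L = "\<lambda>x. last_weak_ladder_time n (real_walk x)"
  have sets: "{x. ?L x = t} \<in> sets S" if "t \<le> n" for t
    unfolding last_weak_ladder_time_eq_iff[OF that] real_walk_def
    by (rule sets_determined[of n], rule determined_by_walkI) (use that in auto)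
  have "{x. ?L x = t} \<in> sets S" for t
  proof (cases "t \<le> n")
    case False
    hence "{x. ?L x = t} = {}" using last_weak_ladder_time_le by fastforce
    thus ?thesis by simp
  qed (rule sets)
  hence "?L \<in> measurable S (count_space UNIV)"
    by (subst measurable_count_space_eq2_countable) (auto simp: vimage_def)
  hence mL: "(\<lambda>\<omega>. last_weak_ladder_time n (walk \<xi> \<omega>)) \<in> measurable M (count_space UNIV)"
    unfolding walk_eq_real_walk by (rule measurable_compose[OF steps_meas])
  have "\<P>(\<omega> in N. I \<omega> = t) = measure (distr N (count_space UNIV) I) {t}"
    using I_meas by (simp add: measure_distr vimage_def Int_def conj_commute)
  also have "\<dots> = measure M {\<omega> \<in> space M. steps \<xi> \<omega> \<in> {x. ?L x = t}}"
    unfolding I_law using mL by (simp add: measure_distr vimage_def Int_def conj_commute walk_eq_real_walk)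
  also have "\<dots> = P.prob {x. ?L x = t}" using sets[OF t] by (rule prob_steps)
  also have "\<dots> = survival (Suc t) * stays_negative (n - t)"
    using prob_last_weak_ladder_time[OF t] by (simp add: real_walk_def[abs_def])
  finally show ?thesis .
qed

text \<open>The law of \<open>Z\<close> has density at least \<open>stays_negative n / tail \<bar>\<beta>\<bar>\<close> with respect to that of the
  walk, on the event that the walk stays nonnegative before \<open>n\<close> and has a big jump.\<close>
lemma big_jump_process_lower:
  assumes bj: "big_jump_process M X (walk \<xi>) \<beta> n N I Z"
    and surv: "survival n > 0" and tl: "tail \<bar>\<beta>\<bar> > 0" and A: "A \<in> sets borel"
  shows "stays_negative n / tail \<bar>\<beta>\<bar> *
      P.prob (nonneg_before n \<inter> {x. \<exists>i<n. x i \<in> {k. real_of_int k \<ge> \<bar>\<beta>\<bar>}} \<inter> {x. real_walk x \<in> A})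
    \<le> measure (distr N borel Z) A"
proof -
  interpret N: prob_space N using bj by (simp add: big_jump_process_def)
  have I_meas[measurable]: "I \<in> measurable N (count_space UNIV)" and Z_meas[measurable]: "Z \<in> measurable N borel"
    using bj by (auto simp: big_jump_process_def)
  let ?c = "stays_negative n / tail \<bar>\<beta>\<bar>"
  let ?G = "\<lambda>i. big_jump_at (Suc i) \<bar>\<beta>\<bar> \<inter> {x. real_walk x \<in> A}"
  let ?N = "\<lambda>i. {\<omega> \<in> space N. I \<omega> = i \<and> Z \<omega> \<in> A}"
  have sG: "?G i \<in> sets S" for i using sets_big_jump_at sets_real_walk[OF A] by blast
  have sN: "?N i \<in> sets N" for i using A by measurable
  \<comment> \<open>The factor \<open>survival (Suc i)\<close> in the law of \<open>I\<close>
    cancels against the conditioning, which leaves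
    \<open>stays_negative (n - i) / tail \<bar>\<beta>\<bar>\<close>.\<close>
  have jump_le: "?c * P.prob (?G i) \<le> measure N (?N i)" if i: "i < n" for i
  proof -
    have surv_i: "survival (Suc i) > 0" using survival_antimono[of "Suc i" n] surv i by simp
    have anti: "stays_negative n \<le> stays_negative (n - i)" by (rule stays_negative_antimono) simp
    have pI: "\<P>(\<omega> in N. I \<omega> = i) = survival (Suc i) * stays_negative (n - i)"
      using big_jump_process_index_law[OF bj, of i] i by simp
    show ?thesis
    proof (cases "stays_negative (n - i) = 0")
      \<comment> \<open>If \<open>I = i\<close> has probability 0, the law of \<open>Z\<close> given
        this event is unspecified, but the left side is then 0.\<close>
      case True
      hence "stays_negative n = 0" using anti stays_negative_nonneg[of n] by linarith
      thus ?thesis by simp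
    next
      case False
      hence "stays_negative (n - i) > 0" using stays_negative_nonneg[of "n - i"] by linarith
      hence "measure N (?N i) = survival (Suc i) * stays_negative (n - i) * P.prob (?G i) / (survival (Suc i) * tail \<bar>\<beta>\<bar>)"
        using big_jump_process_conditional_law[OF bj, of "Suc i" A] surv_i tl A pI by simp
      also have "\<dots> = stays_negative (n - i) / tail \<bar>\<beta>\<bar> * P.prob (?G i)" using surv_i by simp
      finally show ?thesis
        using anti tl by (auto intro!: mult_right_mono divide_right_mono)
    qed
  qed
  \<comment> \<open>The events \<open>?G i\<close> may overlap, so a union bound is used; the events
    \<open>?N i\<close> are disjoint through the value of \<open>I\<close>. Leaving out
    \<open>I = n\<close> is harmless for a lower bound.\<close>
  have "?c * P.prob (nonneg_before n \<inter> {x. \<exists>i<n. x i \<in> {k. real_of_int k \<ge> \<bar>\<beta>\<bar>}} \<inter> {x. real_walk x \<in> A})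
    \<le> ?c * P.prob (\<Union>i<n. ?G i)"
  proof (intro mult_left_mono P.finite_measure_mono sets.finite_UN)
    show "nonneg_before n \<inter> {x. \<exists>i<n. x i \<in> {k. real_of_int k \<ge> \<bar>\<beta>\<bar>}} \<inter> {x. real_walk x \<in> A} \<subseteq> (\<Union>i<n. ?G i)"
      using nonneg_before_antimono[OF Suc_leI, of _ n] by (fastforce simp: big_jump_at_def)
  qed (use sG tl in auto)
  also have "\<dots> \<le> ?c * (\<Sum>i<n. P.prob (?G i))"
    using sG tl by (intro mult_left_mono measure_UNION_le) auto
  also have "\<dots> \<le> (\<Sum>i<n. measure N (?N i))"
    unfolding sum_distrib_left using jump_le by (intro sum_mono) auto
  also have "\<dots> = measure N (\<Union>i<n. ?N i)"
    using sN by (intro N.finite_measure_finite_Union[symmetric]) (auto simp: disjoint_family_on_def)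
  also have "\<dots> \<le> measure N {\<omega> \<in> space N. Z \<omega> \<in> A}"
    using A by (intro N.finite_measure_mono) auto
  also have "\<dots> = measure (distr N borel Z) A"
    using A by (simp add: measure_distr vimage_def Int_def conj_commute)
  finally show ?thesis .
qed

text \<open>By \<open>h2\<close> the conditioned walk lacks a big jump with probability at most
  \<open>h\<close>; elsewhere \<open>h1\<close> makes the density of the law of \<open>Z\<close> at
  least \<open>1 - h\<close> times the conditioned one. Each of the two defects costs at most
  \<open>h\<close>.\<close>

lemma tv_dist_big_jump_process:
  assumes bj: "big_jump_process M X (walk \<xi>) \<beta> n N I Z"
    and surv: "survival n > 0" and tl: "tail \<bar>\<beta>\<bar> > 0"
    and h1: "(1 - h) * tail \<bar>\<beta>\<bar> \<le> stays_negative n * survival n"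
    and h2: "P.prob (nonneg_before n \<inter> {x. \<forall>i<n. real_of_int (x i) < \<bar>\<beta>\<bar>}) \<le> h * survival n"
  shows "tv_dist (distr (given M (\<lambda>\<omega>. enat n \<le> first_negative (walk \<xi> \<omega>))) borel (walk \<xi>)) (distr N borel Z) \<in> {0..2 * h}"
proof -
  interpret N: prob_space N using bj by (simp add: big_jump_process_def)
  have Z_meas: "Z \<in> measurable N borel" using bj by (auto simp: big_jump_process_def)
  define \<mu> where "\<mu> = distr (given M (\<lambda>\<omega>. enat n \<le> first_negative (walk \<xi> \<omega>))) borel (walk \<xi>)"
  define \<nu> where "\<nu> = distr N borel Z"
  have [simp]: "sets \<mu> = sets borel" "space \<mu> = UNIV" "sets \<nu> = sets borel" "space \<nu> = UNIV"
    by (auto simp: \<mu>_def \<nu>_def)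
  have sE: "{\<omega> \<in> space M. enat n \<le> first_negative (walk \<xi> \<omega>)} \<in> sets M"
    "measure M {\<omega> \<in> space M. enat n \<le> first_negative (walk \<xi> \<omega>)} = survival n"
    unfolding first_negative_event using prob_steps[OF sets_nonneg_before] by (auto simp: survival_def)
  interpret \<mu>: prob_space \<mu>
    unfolding \<mu>_def given_def using sE surv measurable_walk
    by (intro prob_space.prob_space_distr prob_space_uniform_measure_prob base.prob_space_axioms) auto
  interpret \<nu>: prob_space \<nu> unfolding \<nu>_def using Z_meas by (rule N.prob_space_distr)
  have one_sided: "measure \<mu> A - measure \<nu> A \<le> 2 * h" if A: "A \<in> sets borel" for A
  proof -
    let ?J = "{x. \<exists>i<n. x i \<in> {k. real_of_int k \<ge> \<bar>\<beta>\<bar>}}"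
    let ?G = "nonneg_before n \<inter> ?J \<inter> {x. real_walk x \<in> A}"
    let ?B = "nonneg_before n \<inter> {x. \<forall>i<n. real_of_int (x i) < \<bar>\<beta>\<bar>}"
    have sG: "?G \<in> sets S" by (intro sets.Int sets_nonneg_before sets_steps sets_real_walk A)
    have sB: "?B \<in> sets S" by (intro sets.Int sets_nonneg_before sets_steps)
    have "measure \<mu> A = P.prob (nonneg_before n \<inter> {x. real_walk x \<in> A}) / survival n"
      using measure_conditioned_walk[OF surv, of "\<lambda>x. x" borel A] A by (simp add: \<mu>_def)
    also have "P.prob (nonneg_before n \<inter> {x. real_walk x \<in> A}) \<le> P.prob (?G \<union> ?B)"
      using sG sB by (intro P.finite_measure_mono sets.Un) force+
    also have "P.prob (?G \<union> ?B) \<le> P.prob ?G + P.prob ?B" using sG sB by (rule measure_Un_le)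
    also have "\<dots> \<le> P.prob ?G + h * survival n" using h2 by simp
    also have "(P.prob ?G + h * survival n) / survival n = P.prob ?G / survival n + h"
      using surv by (simp add: add_divide_distrib)
    finally have up: "measure \<mu> A \<le> P.prob ?G / survival n + h"
      using surv by (simp add: divide_right_mono)
    have "P.prob ?G / survival n \<le> 1"
    proof -
      have "P.prob ?G \<le> survival n" unfolding survival_def
        by (intro P.finite_measure_mono sets_nonneg_before) auto
      thus ?thesis using surv by simp
    qed
    have h0: "h \<ge> 0"
    proof -
      have "0 \<le> h * survival n" by (rule order_trans[OF _ h2]) simp
      thus ?thesis using surv by (simp add: zero_le_mult_iff)
    qed
    have "r - h \<le> (1 - h) * r" if "r \<le> 1" for r :: real
      using mult_left_mono[OF that h0] by (simp add: algebra_simps)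
    hence "P.prob ?G / survival n - h \<le> (1 - h) * (P.prob ?G / survival n)"
      using \<open>P.prob ?G / survival n \<le> 1\<close> by blast
    also have "\<dots> = (1 - h) / survival n * P.prob ?G" by simp
    also have "\<dots> \<le> stays_negative n / tail \<bar>\<beta>\<bar> * P.prob ?G"
      using h1 surv tl by (intro mult_right_mono) (auto simp: field_simps)
    also have "\<dots> \<le> measure \<nu> A"
      unfolding \<nu>_def by (rule big_jump_process_lower[OF bj surv tl A])
    finally show ?thesis using up by linarith
  qed
  \<comment> \<open>The reverse inequality is the one-sided bound for the complement, both laws
    having mass 1.\<close>
  have two_sided: "\<bar>measure \<mu> A - measure \<nu> A\<bar> \<le> 2 * h" if A: "A \<in> sets borel" for A
  proof -
    have "- A \<in> sets borel" using A by (simp add: borel_comp)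
    moreover have "measure \<mu> (- A) = 1 - measure \<mu> A" "measure \<nu> (- A) = 1 - measure \<nu> A"
      using \<mu>.prob_compl[of A] \<nu>.prob_compl[of A] A by (simp_all add: Compl_eq_Diff_UNIV)
    ultimately show ?thesis using one_sided[of A] one_sided[of "- A"] A by linarith
  qed
  have "(SUP A\<in>sets \<mu>. \<bar>measure \<mu> A - measure \<nu> A\<bar>) \<le> 2 * h"
    using two_sided by (intro cSUP_least) auto
  moreover have "0 \<le> (SUP A\<in>sets \<mu>. \<bar>measure \<mu> A - measure \<nu> A\<bar>)"
    using two_sided by (intro cSUP_upper2[of _ _ "{}"] bdd_aboveI2[where M = "2 * h"]) auto
  ultimately show ?thesis by (simp add: tv_dist_def \<mu>_def \<nu>_def)
qed

end

section \<open>From the slowly varying function to the tail\<close>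

lemma tail_ratio_slowly_varying:
  fixes F L :: "real \<Rightarrow> real"
  assumes L: "slowly_varying L" and F: "F \<sim>[at_top] (\<lambda>x. L x / x)" and c: "c > 0"
  shows "((\<lambda>x. F (c * x) / F x) \<longlongrightarrow> 1 / c) at_top"
proof -
  have top: "filterlim (\<lambda>x::real. c * x) at_top at_top"
    using c by (intro filterlim_tendsto_pos_mult_at_top[OF tendsto_const _ filterlim_ident])
  have "(\<lambda>x. F (c * x)) \<sim>[at_top] (\<lambda>x. L (c * x) / (c * x))"
    using asymp_equiv_compose'[OF F top] by simp
  hence "(\<lambda>x. F (c * x) / F x) \<sim>[at_top] (\<lambda>x. (L (c * x) / (c * x)) / (L x / x))"
    using F by (rule asymp_equiv_intros)
  moreover have "((\<lambda>x. (L (c * x) / (c * x)) / (L x / x)) \<longlongrightarrow> 1 / c) at_top"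
  proof (rule Lim_transform_eventually)
    have "((\<lambda>x. L (c * x) / L x) \<longlongrightarrow> 1) at_top"
      using L c unfolding slowly_varying_def by blast
    from tendsto_mult[OF tendsto_const[of "1 / c"] this]
    show "((\<lambda>x. 1 / c * (L (c * x) / L x)) \<longlongrightarrow> 1 / c) at_top" by simp
    show "\<forall>\<^sub>F x in at_top. 1 / c * (L (c * x) / L x) = (L (c * x) / (c * x)) / (L x / x)"
      using eventually_gt_at_top[of 0] by eventually_elim (simp add: field_simps)
  qed
  ultimately show ?thesis using asymp_equiv_symI tendsto_asymp_equiv_cong by blast
qed

lemma eventually_pos_slowly_varying:
  fixes F L :: "real \<Rightarrow> real"
  assumes L: "slowly_varying L" and F: "F \<sim>[at_top] (\<lambda>x. L x / x)" and nonneg: "\<And>x. F x \<ge> 0"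
  shows "eventually (\<lambda>x. F x > 0) at_top"
proof -
  have "eventually (\<lambda>x. L x > 0) at_top"
    using L unfolding slowly_varying_def eventually_at_top_linorder by blast
  with asymp_equiv_eventually_zeros[OF F] eventually_gt_at_top[of 0] show ?thesis
  proof eventually_elim
    case (elim x)
    hence "F x \<noteq> 0" by simp
    with nonneg[of x] show ?case by linarith
  qed
qed

section \<open>Convergence in total variation\<close>

lemma distr_countable_eq_measure_pmf:
  fixes X :: "'a \<Rightarrow> 'b :: countable"
  assumes "prob_space M" "X \<in> measurable M (count_space UNIV)"
  obtains p where "distr M (count_space UNIV) X = measure_pmf p"
proof -
  interpret D: prob_space "distr M (count_space UNIV) X"
    using assms by (rule prob_space.prob_space_distr)
  have "AE x in distr M (count_space UNIV) X. measure (distr M (count_space UNIV) X) {x} \<noteq> 0"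
    by (subst D.AE_support_countable) (auto intro!: exI[of _ UNIV])
  hence "measure_pmf (Abs_pmf (distr M (count_space UNIV) X)) = distr M (count_space UNIV) X"
    by (intro Abs_pmf_inverse) (simp add: D.prob_space_axioms)
  from that[OF this[symmetric]] show ?thesis .
qed

theorem theorem27:
  fixes M :: "'a measure" and X :: "'a \<Rightarrow> int" and \<xi> :: "nat \<Rightarrow> 'a \<Rightarrow> int"
    and L :: "real \<Rightarrow> real" and a b :: "nat \<Rightarrow> real"
    and N :: "nat \<Rightarrow> 'b measure" and I :: "nat \<Rightarrow> 'b \<Rightarrow> nat" and Z :: "nat \<Rightarrow> 'b \<Rightarrow> nat \<Rightarrow> real"
  assumes "prob_space M"
    and "X \<in> measurable M (count_space UNIV)"
    and "integrable M (\<lambda>\<omega>. real_of_int (X \<omega>))"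
    and "(\<integral>\<omega>. real_of_int (X \<omega>) \<partial>M) = 0"
    and "\<P>(\<omega> in M. X \<omega> < -1) = 0"
    and "slowly_varying L"
    and "(\<lambda>x::real. \<P>(\<omega> in M. real_of_int (X \<omega>) \<ge> x)) \<sim>[at_top] (\<lambda>x. L x / x)"
    and "prob_space.indep_vars M (\<lambda>_. count_space UNIV) \<xi> {1..}"
    and "\<And>i. i \<ge> 1 \<Longrightarrow> distr M (count_space UNIV) (\<xi> i) = distr M (count_space UNIV) X"
    and "(\<lambda>n. real n * \<P>(\<omega> in M. real_of_int (X \<omega>) \<ge> a n)) \<longlonglongrightarrow> 1"
    and "\<And>n. n \<ge> 1 \<Longrightarrow>
           b n = real n * (\<integral>\<omega>. real_of_int (X \<omega>) *
             indicator {\<omega> \<in> space M. \<bar>real_of_int (X \<omega>)\<bar> \<le> a n} \<omega> \<partial>M)"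
    and "\<And>n. n \<ge> 1 \<Longrightarrow> big_jump_process M X (walk \<xi>) (b n) n (N n) (I n) (Z n)"
  shows "(\<lambda>n. tv_dist
             (distr (given M (\<lambda>\<omega>. first_negative (walk \<xi> \<omega>) \<ge> enat n)) borel (walk \<xi>))
             (distr (N n) borel (Z n))) \<longlonglongrightarrow> 0"
proof -
  interpret M: prob_space M by fact
  note X = assms(2)
  obtain p where p: "distr M (count_space UNIV) X = measure_pmf p"
    using distr_countable_eq_measure_pmf[OF assms(1,2)] .
  have prob_p: "measure_pmf.prob p T = measure M {\<omega> \<in> space M. X \<omega> \<in> T}" for T
    unfolding p[symmetric] using X by (subst measure_distr) (auto simp: vimage_def Int_def conj_commute)
  have int_p: "measure_pmf.expectation p f = (\<integral>\<omega>. f (X \<omega>) \<partial>M)" for f :: "int \<Rightarrow> real"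
    unfolding p[symmetric] using X by (intro integral_distr) auto
  have tail_eq: "iid_steps.tail p = (\<lambda>x. \<P>(\<omega> in M. real_of_int (X \<omega>) \<ge> x))"
    unfolding iid_steps.tail_def by (simp add: prob_p fun_eq_iff)
  have F: "iid_steps.tail p \<sim>[at_top] (\<lambda>x. L x / x)" unfolding tail_eq by fact
  have steps_ge: "k \<ge> -1" if "k \<in> set_pmf p" for k
  proof -
    have "measure_pmf.prob p {k. k < -1} = 0" using assms(5) by (simp add: prob_p)
    hence "set_pmf p \<inter> {k. k < -1} = {}" by (simp add: measure_pmf_zero_iff)
    with that show ?thesis by force
  qed
  \<comment> \<open>Asymptotic equivalence gives positivity for large arguments only; monotonicity
    extends it to all.\<close>
  have tail_pos: "iid_steps.tail p x > 0" for x
  proof -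
    have "eventually (\<lambda>y. iid_steps.tail p y > 0 \<and> y \<ge> x) at_top"
      by (intro eventually_conj eventually_pos_slowly_varying[OF assms(6) F] eventually_ge_at_top)
         (rule iid_steps.tail_nonneg)
    then obtain y where "iid_steps.tail p y > 0" "y \<ge> x"
      by (auto dest: eventually_happens)
    thus ?thesis using iid_steps.tail_antimono[of x y p] by linarith
  qed
  interpret cauchy_steps p
  proof
    show "integrable (measure_pmf p) real_of_int"
      unfolding p[symmetric] using assms(3) X by (subst integrable_distr_eq) auto
    show "measure_pmf.expectation p real_of_int = 0" using assms(4) by (simp add: int_p)
    show "((\<lambda>x. iid_steps.tail p (c * x) / iid_steps.tail p x) \<longlongrightarrow> 1 / c) at_top" if "c > 0" for c
      by (rule tail_ratio_slowly_varying[OF assms(6) F that])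
  qed (use steps_ge tail_pos in auto)
  have a_lim: "(\<lambda>n. real n * tail (a n)) \<longlonglongrightarrow> 1" using assms(10) by (simp add: tail_eq)
  \<comment> \<open>A provisional instance with the scale \<open>n * excess (a n)\<close>:
    identifying this scale with \<open>\<bar>b n\<bar>\<close> requires that \<open>a\<close> tends
    to infinity.\<close>
  have "cauchy_walk p a (\<lambda>n. real n * excess (a n))"
    by unfold_locales (use a_lim in auto)
  hence a_top: "filterlim a at_top sequentially" by (rule cauchy_walk.a_at_top)
  have "eventually (\<lambda>n. \<bar>b n\<bar> = real n * excess (a n)) sequentially"
    using filterlim_at_top[THEN iffD1, OF a_top, rule_format, of 1] eventually_ge_at_top[of 1]
  proof eventually_elim
    case (elim n)
    have AE_X: "AE \<omega> in M. X \<omega> \<ge> -1"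
    proof -
      have "AE k in distr M (count_space UNIV) X. k \<ge> -1" unfolding p by (rule AE_pmfI) (rule steps_ge)
      thus ?thesis using X by (subst (asm) AE_distr_iff) auto
    qed
    \<comment> \<open>As the step is almost surely at least -1 and \<open>a n \<ge> 1\<close>, the
      two-sided truncation is a one-sided one, to which \<open>excess_eq\<close> applies.\<close>
    have "(\<integral>\<omega>. real_of_int (X \<omega>) * indicator {\<omega> \<in> space M. \<bar>real_of_int (X \<omega>)\<bar> \<le> a n} \<omega> \<partial>M) =
      (\<integral>\<omega>. real_of_int (X \<omega>) * indicator {k. real_of_int k \<le> a n} (X \<omega>) \<partial>M)"
    proof (rule integral_cong_AE)
      show "AE \<omega> in M. real_of_int (X \<omega>) * indicator {\<omega> \<in> space M. \<bar>real_of_int (X \<omega>)\<bar> \<le> a n} \<omega> =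
        real_of_int (X \<omega>) * indicator {k. real_of_int k \<le> a n} (X \<omega>)"
        using AE_X AE_space
      proof eventually_elim
        case (elim \<omega>)
        have "real_of_int (X \<omega>) \<ge> -1" using elim(1) by linarith
        with \<open>1 \<le> a n\<close> elim(2) show ?case by (auto simp: indicator_def abs_le_iff)
      qed
    qed (use X in measurable)
    also have "\<dots> = - excess (a n)" by (simp add: excess_eq int_p)
    finally have "b n = - (real n * excess (a n))" using assms(11)[of n] elim by simp
    moreover have "excess (a n) \<ge> 0"
      unfolding excess_def using elim by (intro integral_nonneg_AE) (auto simp: indicator_def)
    ultimately show ?case by simp
  qed
  then interpret cauchy_walk p a "\<lambda>n. \<bar>b n\<bar>"
    by unfold_locales (use a_lim in auto)
  have \<xi>: "\<xi> i \<in> measurable M (count_space UNIV)" if "i \<ge> 1" for i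
    using assms(8) that by (simp add: M.indep_vars_def)
  have steps_law: "steps \<xi> \<in> measurable M S \<and> distr M S (steps \<xi>) = S"
  proof
    have sets_S: "sets S = sets (\<Pi>\<^sub>M i\<in>UNIV. count_space (UNIV :: int set))"
      by (intro sets_PiM_cong) simp_all
    have "steps \<xi> \<in> measurable M (\<Pi>\<^sub>M i\<in>UNIV. count_space (UNIV :: int set))"
      unfolding steps_def[abs_def] by (rule measurable_PiM_single') (use \<xi> in auto)
    thus "steps \<xi> \<in> measurable M S" by (simp cong: measurable_cong_sets add: sets_S)
    \<comment> \<open>Independence gives a product law over the indices \<open>{1..}\<close>;
      reindexing by \<open>Suc\<close> moves it to the canonical space, indexed from 0.\<close>
    let ?K = "\<Pi>\<^sub>M i\<in>{1::nat..}. count_space (UNIV :: int set)"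
    let ?\<xi> = "\<lambda>\<omega>. \<lambda>i\<in>{1..}. \<xi> i \<omega>"
    have "distr M ?K ?\<xi> = (\<Pi>\<^sub>M i\<in>{1..}. distr M (count_space UNIV) (\<xi> i))"
      using assms(8) \<xi> by (subst (asm) M.indep_vars_iff_distr_eq_PiM') auto
    also have "\<dots> = (\<Pi>\<^sub>M i\<in>{1..}. measure_pmf p)"
      using assms(9) p by (intro PiM_cong) auto
    finally have law: "distr M ?K ?\<xi> = (\<Pi>\<^sub>M i\<in>{1..}. measure_pmf p)" .
    have "?\<xi> \<in> measurable M ?K" using \<xi> by (intro measurable_restrict) auto
    moreover have "(\<lambda>y. \<lambda>n\<in>UNIV. y (Suc n)) \<in> measurable ?K S"
    proof (rule measurable_restrict)
      fix i show "(\<lambda>y. y (Suc i)) \<in> measurable ?K (measure_pmf p)"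
        using measurable_component_singleton[of "Suc i" "{1..}" "\<lambda>_. count_space (UNIV :: int set)"] by simp
    qed
    ultimately have "distr M S (steps \<xi>) = distr (distr M ?K ?\<xi>) S (\<lambda>y. \<lambda>n\<in>UNIV. y (Suc n))"
      by (subst distr_distr) (auto simp: comp_def steps_def[abs_def] restrict_UNIV)
    also have "\<dots> = S"
      unfolding law using distr_PiM_reindex[of "{1..}" "\<lambda>_. measure_pmf p" Suc UNIV]
      by (simp add: measure_pmf.prob_space_axioms)
    finally show "distr M S (steps \<xi>) = S" .
  qed
  interpret iid_walk_model p M X \<xi>
    by unfold_locales (use X p steps_law in auto)
  show ?thesis
  proof (rule order_tendstoI)
    fix e :: real assume e: "e > 0"
    \<comment> \<open>\<open>e / 3\<close> yields \<open>2 * h < e\<close>, and the cap 1/2 yields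
      \<open>h < 1\<close>.\<close>
    define h where "h = min (e / 3) (1 / 2)"
    have h: "h > 0" "h < 1" "2 * h < e" using e by (auto simp: h_def min_def)
    show "eventually (\<lambda>n. tv_dist
             (distr (given M (\<lambda>\<omega>. first_negative (walk \<xi> \<omega>) \<ge> enat n)) borel (walk \<xi>))
             (distr (N n) borel (Z n)) < e) sequentially"
      using stays_negative_times_survival_lower[OF h(1,2)] prob_nonneg_no_big_jump[OF h(1)]
        eventually_ge_at_top[of 1]
    proof eventually_elim
      case (elim n)
      \<comment> \<open>Positivity of \<open>survival n\<close>, on which the conditioning rests,
        follows from the lower bound on its product with \<open>stays_negative n\<close>.\<close>
      have "0 < (1 - h) * tail \<bar>b n\<bar>" using h tail_pos by simp
      with elim(1) have "survival n \<noteq> 0" by auto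
      hence "survival n > 0" using survival_nonneg[of n] by linarith
      from tv_dist_big_jump_process[OF assms(12) this tail_pos elim(1,2)] elim(3) h(3)
      show ?case by auto
    qed
  next
    fix e :: real assume e: "e < 0"
    \<comment> \<open>Nonnegativity of the distance is part of
      \<open>tv_dist_big_jump_process\<close>, applied here with the fixed value 1/2 for
      \<open>h\<close>.\<close>
    have h: "(1 / 2 :: real) > 0" "(1 / 2 :: real) < 1" by auto
    show "eventually (\<lambda>n. e < tv_dist
             (distr (given M (\<lambda>\<omega>. first_negative (walk \<xi> \<omega>) \<ge> enat n)) borel (walk \<xi>))
             (distr (N n) borel (Z n))) sequentially"
      using stays_negative_times_survival_lower[OF h] prob_nonneg_no_big_jump[OF h(1)]
        eventually_ge_at_top[of 1]
    proof eventually_elim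
      case (elim n)
      have "0 < (1 - 1 / 2) * tail \<bar>b n\<bar>" using tail_pos by simp
      with elim(1) have "survival n \<noteq> 0" by auto
      hence "survival n > 0" using survival_nonneg[of n] by linarith
      from tv_dist_big_jump_process[OF assms(12) this tail_pos elim(1,2)] elim(3) e
      show ?case by auto
    qed
  qed
qed

end
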